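(* Let $n\ge1$ be fixed, and identify the set of monic polynomials of degree $n$ over $\mathbb{C}$ with $\mathbb{C}^n$, endowed with the Zariski topology. There are at most countably many classes of KR-equivalence of potentials of degree $n$. One of these classes is generic in the sense that it contains a countable intersection of non-empty Zariski-open (and thus dense) sets.
   Context: KR-equivalence: two potentials (monic polynomials) $\partial w,\partial w'$ of degree $n$ are KR-equivalent if for every link $L$ (with diagram $D$) the filtered cochain complexes $C_{\partial w}(D)$ and $C_{\partial w'}(D)$ are homotopy equivalent as filtered cochain complexes over $\mathbb{C}$. Khovanov–Rozansky complex. A potential of degree $n$ is a monic $\partial w\in\mathbb{C}[x]$ of degree $n$; let $w$ be a polynomial with $w'=(n+1)\partial w$. All variables have (quantum) degree 2, and $[k]$ means raising all quantum/filtration degrees by $k$. Let $D$ be an oriented link diagram. Replacing each crossing either by its oriented smoothing $\Gamma_0$ or by a thick edge $\Gamma_1$ (with two incoming and two outgoing thin edges) yields MOY graphs $\Gamma$. Put marks with variables on the thin edges. To a thin arc oriented from mark $x_j$ to mark $x_i$ assign the matrix factorization $R\xrightarrow{\pi}R[1-n]\xrightarrow{x_i-x_j}R$ with $\pi=\frac{w(x_i)-w(x_j)}{x_i-x_j}$. To a thick edge with outgoing $x_1,x_2$ and incoming $x_3,x_4$ assign the tensor product of $R\xrightarrow{u_1}R[1-n]\xrightarrow{x_1+x_2-x_3-x_4}R$ and $R\xrightarrow{u_2}R[3-n]\xrightarrow{x_1x_2-x_3x_4}R$, shifted by $[-1]$, where $w(x)+w(y)=g(x+y,xy)$, $u_1=\frac{g(x_1+x_2,x_1x_2)-g(x_3+x_4,x_1x_2)}{x_1+x_2-x_3-x_4}$,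 $u_2=\frac{g(x_3+x_4,x_1x_2)-g(x_3+x_4,x_3x_4)}{x_1x_2-x_3x_4}$. Tensoring over all pieces of $\Gamma$ gives a 2-periodic complex; its cohomology $h_{\partial w}(\Gamma)$ is a finite-dimensional filtered vector space; a circle gives $(\mathbb{C}[x]/\partial w)[1-n]$. The Khovanov–Rozansky maps $\chi_0:\Gamma_0\to\Gamma_1$, $\chi_1:\Gamma_1\to\Gamma_0$ are filtered of degree 1, with both composites multiplication by $x_1-x_3$ (where $\Gamma_0$ joins $x_4$ to $x_1$ and $x_3$ to $x_2$). A positive crossing is assigned $\Gamma_0[1-n]\xrightarrow{\chi_0}\Gamma_1[-n]$ in cohomological degrees $0,1$, a negative crossing $\Gamma_1[n]\xrightarrow{\chi_1}\Gamma_0[n-1]$ in degrees $-1,0$; the resulting cube of resolutions is a filtered cochain complex $C_{\partial w}(D)$ of finite-dimensional vector spaces, where $\mathcal F^j$ is the part of quantum degree $\le j$. Its filtered homotopy type is a link invariant. *)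

theory Defs
  imports
    "HOL-Algebra.Module"
    "HOL-Algebra.AbelCoset"
    "HOL-Library.Poly_Mapping"
    "HOL-Library.FuncSet"
    "HOL-Library.Countable_Set"
    "HOL-Computational_Algebra.Polynomial"
    "HOL-Analysis.Abstract_Topology"
begin

section \<open>Multivariate polynomials over the complex numbers\<close>

type_synonym mpoly = "(nat \<Rightarrow>\<^sub>0 nat) \<Rightarrow>\<^sub>0 complex"

definition Const :: "complex \<Rightarrow> mpoly" where
  "Const c = Poly_Mapping.single 0 c"

definition X :: "nat \<Rightarrow> mpoly" where
  "X i = Poly_Mapping.single (Poly_Mapping.single i 1) 1"

definition vars :: "mpoly \<Rightarrow> nat set" where
  "vars f = (\<Union>m\<in>Poly_Mapping.keys f. Poly_Mapping.keys m)"

definition monomial_degree :: "(nat \<Rightarrow>\<^sub>0 nat) \<Rightarrow> nat" where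
  "monomial_degree m = (\<Sum>i\<in>Poly_Mapping.keys m. Poly_Mapping.lookup m i)"

definition monomial_value :: "(nat \<Rightarrow> 'a::comm_ring_1) \<Rightarrow> (nat \<Rightarrow>\<^sub>0 nat) \<Rightarrow> 'a" where
  "monomial_value \<sigma> m = (\<Prod>i\<in>Poly_Mapping.keys m. \<sigma> i ^ Poly_Mapping.lookup m i)"

text \<open>Evaluation in a commutative algebra with structure map \<open>\<iota>\<close>.\<close>

definition mpoly_value ::
    "(complex \<Rightarrow> 'a::comm_ring_1) \<Rightarrow> (nat \<Rightarrow> 'a) \<Rightarrow> mpoly \<Rightarrow> 'a" where
  "mpoly_value \<iota> \<sigma> f =
     (\<Sum>m\<in>Poly_Mapping.keys f. \<iota> (Poly_Mapping.lookup f m) * monomial_value \<sigma> m)"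

abbreviation eval_at :: "(nat \<Rightarrow> complex) \<Rightarrow> mpoly \<Rightarrow> complex" where
  "eval_at \<equiv> mpoly_value (\<lambda>c. c)"

abbreviation substitute :: "(nat \<Rightarrow> mpoly) \<Rightarrow> mpoly \<Rightarrow> mpoly" where
  "substitute \<equiv> mpoly_value Const"

abbreviation poly_in :: "complex poly \<Rightarrow> mpoly \<Rightarrow> mpoly" where
  "poly_in p f \<equiv> poly (map_poly Const p) f"

text \<open>Exact division in the integral domain of polynomials; it is only used where the
  quotient exists.\<close>

definition exact_quotient :: "mpoly \<Rightarrow> mpoly \<Rightarrow> mpoly" where
  "exact_quotient f g = (THE q. f = q * g)"


section \<open>The Zariski topology on monic polynomials of degree \<open>n\<close>\<close>

definition monic_polys :: "nat \<Rightarrow> complex poly set" where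
  "monic_polys n = {p. degree p = n \<and> lead_coeff p = 1}"

text \<open>The point of affine \<open>n\<close>-space corresponding to \<open>p\<close> is
  \<open>(coeff p 0, \<dots>, coeff p (n - 1))\<close>.\<close>

definition zero_locus :: "nat \<Rightarrow> mpoly set \<Rightarrow> complex poly set" where
  "zero_locus n F = {p \<in> monic_polys n. \<forall>f\<in>F. eval_at (coeff p) f = 0}"

definition is_zariski_open :: "nat \<Rightarrow> complex poly set \<Rightarrow> bool" where
  "is_zariski_open n U \<longleftrightarrow>
     (\<exists>F. (\<forall>f\<in>F. vars f \<subseteq> {..<n}) \<and> U = monic_polys n - zero_locus n F)"

definition zariski :: "nat \<Rightarrow> complex poly topology" where
  "zariski n = topology (is_zariski_open n)"

lemma monomial_value_superset:
  assumes "finite A" "Poly_Mapping.keys m \<subseteq> A"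
  shows "monomial_value \<sigma> m = (\<Prod>i\<in>A. \<sigma> i ^ Poly_Mapping.lookup m i)"
  unfolding monomial_value_def
  by (rule prod.mono_neutral_left) (use assms in \<open>auto simp: in_keys_iff\<close>)

lemma monomial_value_add:
  "monomial_value \<sigma> (m + m') = monomial_value \<sigma> m * monomial_value \<sigma> m'"
proof -
  let ?A = "Poly_Mapping.keys m \<union> Poly_Mapping.keys m'"
  have "monomial_value \<sigma> (m + m') = (\<Prod>i\<in>?A. \<sigma> i ^ Poly_Mapping.lookup (m + m') i)"
    by (rule monomial_value_superset) (auto dest: subsetD[OF keys_add])
  also have "\<dots> = (\<Prod>i\<in>?A. \<sigma> i ^ Poly_Mapping.lookup m i) *
      (\<Prod>i\<in>?A. \<sigma> i ^ Poly_Mapping.lookup m' i)"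
    by (simp add: lookup_add power_add prod.distrib)
  also have "\<dots> = monomial_value \<sigma> m * monomial_value \<sigma> m'"
    using monomial_value_superset[of ?A m \<sigma>] monomial_value_superset[of ?A m' \<sigma>] by simp
  finally show ?thesis .
qed

lemma eval_at_superset:
  assumes "finite A" "Poly_Mapping.keys f \<subseteq> A"
  shows "eval_at a f = (\<Sum>m\<in>A. Poly_Mapping.lookup f m * monomial_value a m)"
  unfolding mpoly_value_def
  by (rule sum.mono_neutral_left) (use assms in \<open>auto simp: in_keys_iff\<close>)

lemma eval_at_zero [simp]: "eval_at a 0 = 0"
  by (simp add: mpoly_value_def)

lemma eval_at_one [simp]: "eval_at a 1 = 1"
  by (simp add: mpoly_value_def monomial_value_def)

lemma eval_at_single [simp]:
  "eval_at a (Poly_Mapping.single m c) = c * monomial_value a m"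
  by (cases "c = 0") (simp_all add: mpoly_value_def)

lemma eval_at_add: "eval_at a (f + g) = eval_at a f + eval_at a g"
proof -
  let ?A = "Poly_Mapping.keys f \<union> Poly_Mapping.keys g"
  have "eval_at a (f + g) = (\<Sum>m\<in>?A. Poly_Mapping.lookup (f + g) m * monomial_value a m)"
    by (rule eval_at_superset) (auto dest: subsetD[OF keys_add])
  also have "\<dots> = eval_at a f + eval_at a g"
    using eval_at_superset[of ?A f a] eval_at_superset[of ?A g a]
    by (simp add: lookup_add distrib_right sum.distrib)
  finally show ?thesis .
qed

lemma mpoly_induct [case_names zero add_single]:
  assumes "P (0 :: mpoly)" and "\<And>f m c. P f \<Longrightarrow> P (f + Poly_Mapping.single m c)"
  shows "P f"
proof (induction f rule: update_induct)
  case const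
  show ?case by (rule assms(1))
next
  case (update f m c)
  have "Poly_Mapping.update m c f = f + Poly_Mapping.single m c"
  proof (rule poly_mapping_eqI)
    fix k
    show "Poly_Mapping.lookup (Poly_Mapping.update m c f) k =
        Poly_Mapping.lookup (f + Poly_Mapping.single m c) k"
      using update(1) by (cases "k = m") (simp_all add: lookup_update lookup_add lookup_single in_keys_iff)
  qed
  then show ?case using assms(2)[OF update(3)] by simp
qed

lemma eval_at_mult: "eval_at a (f * g) = eval_at a f * eval_at a g"
proof (induction f rule: mpoly_induct)
  case (add_single f m c)
  have "eval_at a (Poly_Mapping.single m c * g) = c * monomial_value a m * eval_at a g"
  proof (induction g rule: mpoly_induct)
    case (add_single g m' c')
    then show ?case
      by (simp add: distrib_left eval_at_add mult_single monomial_value_add)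
  qed simp
  then show ?case
    using add_single by (simp add: distrib_right eval_at_add)
qed simp

lemma vars_mult: "vars (f * g) \<subseteq> vars f \<union> vars g"
proof
  fix i assume "i \<in> vars (f * g)"
  then obtain m where m: "m \<in> Poly_Mapping.keys (f * g)" "i \<in> Poly_Mapping.keys m"
    by (auto simp: vars_def)
  then obtain p q where "m = p + q" "p \<in> Poly_Mapping.keys f" "q \<in> Poly_Mapping.keys g"
    using keys_mult[of f g] by blast
  then show "i \<in> vars f \<union> vars g"
    using m(2) keys_add[of p q] by (auto simp: vars_def)
qed

lemma istopology_zariski: "istopology (is_zariski_open n)"
  unfolding istopology_def
proof (intro conjI allI impI)
  fix S T assume "is_zariski_open n S" "is_zariski_open n T"
  then obtain F G where
    F: "\<forall>f\<in>F. vars f \<subseteq> {..<n}" "S = monic_polys n - zero_locus n F" and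
    G: "\<forall>f\<in>G. vars f \<subseteq> {..<n}" "T = monic_polys n - zero_locus n G"
    by (auto simp: is_zariski_open_def)
  let ?H = "{f * g | f g. f \<in> F \<and> g \<in> G}"
  have "zero_locus n ?H = zero_locus n F \<union> zero_locus n G"
  proof
    show "zero_locus n ?H \<subseteq> zero_locus n F \<union> zero_locus n G"
    proof
      fix p assume p: "p \<in> zero_locus n ?H"
      show "p \<in> zero_locus n F \<union> zero_locus n G"
      proof (rule ccontr)
        assume "p \<notin> zero_locus n F \<union> zero_locus n G"
        then obtain f g where fg: "f \<in> F" "g \<in> G"
          "eval_at (coeff p) f \<noteq> 0" "eval_at (coeff p) g \<noteq> 0"
          using p by (auto simp: zero_locus_def)
        then have "eval_at (coeff p) (f * g) = 0"
          using p unfolding zero_locus_def by blast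
        then show False using fg by (simp add: eval_at_mult)
      qed
    qed
  qed (auto simp: zero_locus_def eval_at_mult)
  moreover have "\<forall>f\<in>?H. vars f \<subseteq> {..<n}"
  proof
    fix h assume "h \<in> ?H"
    then obtain f g where "h = f * g" "f \<in> F" "g \<in> G" by blast
    then show "vars h \<subseteq> {..<n}" using F(1) G(1) vars_mult[of f g] by blast
  qed
  ultimately show "is_zariski_open n (S \<inter> T)"
    unfolding is_zariski_open_def using F(2) G(2) by (intro exI[of _ ?H]) auto
next
  fix K assume "\<forall>S\<in>K. is_zariski_open n S"
  then have "\<forall>S\<in>K. \<exists>F. (\<forall>f\<in>F. vars f \<subseteq> {..<n}) \<and> S = monic_polys n - zero_locus n F"
    by (simp add: is_zariski_open_def)
  from bchoice[OF this] obtain F where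
    F: "\<forall>S\<in>K. (\<forall>f\<in>F S. vars f \<subseteq> {..<n}) \<and> S = monic_polys n - zero_locus n (F S)"
    by (rule exE)
  have "(\<Union>S\<in>K. S) = (\<Union>S\<in>K. monic_polys n - zero_locus n (F S))"
    by (rule SUP_cong[OF refl]) (rule conjunct2[OF bspec[OF F]])
  also have "\<dots> = monic_polys n - zero_locus n (\<Union>S\<in>K. F S)"
    by (auto simp: zero_locus_def)
  finally have eq: "\<Union>K = monic_polys n - zero_locus n (\<Union>S\<in>K. F S)"
    by simp
  have "vars f \<subseteq> {..<n}" if "f \<in> (\<Union>S\<in>K. F S)" for f
  proof -
    obtain S where "S \<in> K" "f \<in> F S" using \<open>f \<in> (\<Union>S\<in>K. F S)\<close> by (rule UN_E)
    then show ?thesis using conjunct1[OF bspec[OF F \<open>S \<in> K\<close>]] by (rule_tac bspec)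
  qed
  with eq show "is_zariski_open n (\<Union>K)"
    unfolding is_zariski_open_def by (intro exI[of _ "\<Union>S\<in>K. F S"] conjI ballI)
qed


section \<open>Filtered cochain complexes\<close>

text \<open>Vector spaces are records of type \<open>module\<close>; the fields \<open>mult\<close> and
  \<open>one\<close>, which that record inherits from rings, play no role.\<close>

definition quotient_module :: "('r, 'a, 'm) module_scheme \<Rightarrow> 'a set \<Rightarrow> ('r, 'a set) module" where
  "quotient_module M N =
     \<lparr>carrier = a_rcosets\<^bsub>M\<^esub> N, monoid.mult = undefined, one = undefined, zero = N, add = set_add M,
      module.smult = (\<lambda>c A. \<Union>x\<in>A. N +>\<^bsub>M\<^esub> (c \<odot>\<^bsub>M\<^esub> x))\<rparr>"

text \<open>The map of quotients induced by \<open>f\<close>, with codomain a quotient of \<open>M\<close> by \<open>N\<close>.\<close>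

definition induced_map ::
    "('r, 'b, 'm) module_scheme \<Rightarrow> 'b set \<Rightarrow> ('a \<Rightarrow> 'b) \<Rightarrow> 'a set \<Rightarrow> 'b set" where
  "induced_map M N f A = (\<Union>x\<in>A. N +>\<^bsub>M\<^esub> f x)"

definition direct_sum_module ::
    "'i set \<Rightarrow> ('i \<Rightarrow> ('r, 'a, 'm) module_scheme) \<Rightarrow> ('r, 'i \<Rightarrow> 'a) module" where
  "direct_sum_module I M =
     \<lparr>carrier = (\<Pi>\<^sub>E i\<in>I. carrier (M i)), monoid.mult = undefined, one = undefined,
      zero = (\<lambda>i\<in>I. \<zero>\<^bsub>M i\<^esub>), add = (\<lambda>x y. \<lambda>i\<in>I. x i \<oplus>\<^bsub>M i\<^esub> y i),
      module.smult = (\<lambda>c x. \<lambda>i\<in>I. c \<odot>\<^bsub>M i\<^esub> x i)\<rparr>"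

definition linear_maps ::
    "('r, 'a, 'm) module_scheme \<Rightarrow> ('r, 'b, 'k) module_scheme \<Rightarrow> ('a \<Rightarrow> 'b) set" where
  "linear_maps M N = {f \<in> carrier M \<rightarrow> carrier N.
     (\<forall>x\<in>carrier M. \<forall>y\<in>carrier M. f (x \<oplus>\<^bsub>M\<^esub> y) = f x \<oplus>\<^bsub>N\<^esub> f y) \<and>
     (\<forall>c. \<forall>x\<in>carrier M. f (c \<odot>\<^bsub>M\<^esub> x) = c \<odot>\<^bsub>N\<^esub> f x)}"

text \<open>\<open>filtration C i j\<close> is the \<open>j\<close>-th step, increasing in \<open>j\<close>, of the filtration
  of the cochain space in cohomological degree \<open>i\<close>.\<close>

record 'a filtered_complex =
  cochains :: "int \<Rightarrow> (complex, 'a) module"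
  differential :: "int \<Rightarrow> 'a \<Rightarrow> 'a"
  filtration :: "int \<Rightarrow> int \<Rightarrow> 'a set"

definition filtered_maps ::
    "'a filtered_complex \<Rightarrow> 'b filtered_complex \<Rightarrow> int \<Rightarrow> (int \<Rightarrow> 'a \<Rightarrow> 'b) set" where
  "filtered_maps C D s =
     {f. \<forall>i. f i \<in> linear_maps (cochains C i) (cochains D (i + s)) \<and>
             (\<forall>j. f i ` filtration C i j \<subseteq> filtration D (i + s) j)}"

definition filtered_cochain_maps ::
    "'a filtered_complex \<Rightarrow> 'b filtered_complex \<Rightarrow> (int \<Rightarrow> 'a \<Rightarrow> 'b) set" where
  "filtered_cochain_maps C D =
     {f \<in> filtered_maps C D 0. \<forall>i. \<forall>x\<in>carrier (cochains C i).
        f (i + 1) (differential C i x) = differential D i (f i x)}"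

definition filtered_homotopic ::
    "'a filtered_complex \<Rightarrow> 'b filtered_complex \<Rightarrow>
     (int \<Rightarrow> 'a \<Rightarrow> 'b) \<Rightarrow> (int \<Rightarrow> 'a \<Rightarrow> 'b) \<Rightarrow> bool" where
  "filtered_homotopic C D f g \<longleftrightarrow>
     (\<exists>h\<in>filtered_maps C D (-1). \<forall>i. \<forall>x\<in>carrier (cochains C i).
        f i x = g i x \<oplus>\<^bsub>cochains D i\<^esub>
          (differential D (i - 1) (h i x) \<oplus>\<^bsub>cochains D i\<^esub> h (i + 1) (differential C i x)))"

definition filtered_homotopy_equivalent ::
    "'a filtered_complex \<Rightarrow> 'b filtered_complex \<Rightarrow> bool" where
  "filtered_homotopy_equivalent C D \<longleftrightarrow>
     (\<exists>f\<in>filtered_cochain_maps C D. \<exists>g\<in>filtered_cochain_maps D C.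
        filtered_homotopic C C (\<lambda>i. g i \<circ> f i) (\<lambda>i x. x) \<and>
        filtered_homotopic D D (\<lambda>i. f i \<circ> g i) (\<lambda>i x. x))"


section \<open>Oriented link diagrams\<close>

text \<open>Drawn with both strands running upwards, a crossing has outgoing edges \<open>e1\<close> (top left)
  and \<open>e2\<close> (top right) and incoming edges \<open>e3\<close> (bottom right) and \<open>e4\<close> (bottom left);
  the two strands run from \<open>e4\<close> to \<open>e2\<close> and from \<open>e3\<close> to \<open>e1\<close>, and the sign tells which
  one passes over. The oriented smoothing joins \<open>e4\<close> to \<open>e1\<close> and \<open>e3\<close> to \<open>e2\<close>.\<close>

datatype crossing = Crossing (positive: bool) (e1: nat) (e2: nat) (e3: nat) (e4: nat)

text \<open>Edges are labelled by natural numbers; \<open>circles\<close> lists the labels of the components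
  without crossings.\<close>

datatype diagram = Diagram (crossings: "crossing list") (circles: "nat list")

definition out_edges :: "diagram \<Rightarrow> nat list" where
  "out_edges D = concat (map (\<lambda>c. [e1 c, e2 c]) (crossings D))"

definition in_edges :: "diagram \<Rightarrow> nat list" where
  "in_edges D = concat (map (\<lambda>c. [e3 c, e4 c]) (crossings D))"

definition edges :: "diagram \<Rightarrow> nat set" where
  "edges D = set (out_edges D) \<union> set (circles D)"

text \<open>The half-edge \<open>(k, s)\<close> is the \<open>s\<close>-th one, counterclockwise from the top left, at the
  \<open>k\<close>-th crossing.\<close>

definition half_edges :: "diagram \<Rightarrow> (nat \<times> nat) set" where
  "half_edges D = {..<length (crossings D)} \<times> {..<4}"

definition edge_of :: "diagram \<Rightarrow> nat \<times> nat \<Rightarrow> nat" where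
  "edge_of D = (\<lambda>(k, s). let c = crossings D ! k in [e1 c, e4 c, e3 c, e2 c] ! s)"

definition rotate_half_edge :: "nat \<times> nat \<Rightarrow> nat \<times> nat" where
  "rotate_half_edge = (\<lambda>(k, s). (k, (s + 1) mod 4))"

definition opposite :: "diagram \<Rightarrow> nat \<times> nat \<Rightarrow> nat \<times> nat" where
  "opposite D d = (THE d'. d' \<in> half_edges D \<and> d' \<noteq> d \<and> edge_of D d' = edge_of D d)"

definition faces :: "diagram \<Rightarrow> (nat \<times> nat) set set" where
  "faces D = half_edges D // {(d, rotate_half_edge (opposite D d)) | d. d \<in> half_edges D}\<^sup>*"

definition components :: "diagram \<Rightarrow> (nat \<times> nat) set set" where
  "components D = half_edges D //
     ({(d, rotate_half_edge d) | d. d \<in> half_edges D} \<union>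
      {(d, opposite D d) | d. d \<in> half_edges D})\<^sup>*"

text \<open>With \<open>V\<close> crossings there are \<open>2 V\<close> edges between them, so that all connected
  components of the underlying 4-valent graph are embedded in spheres if and only if the Euler
  characteristic \<open>V - 2 V + card (faces D)\<close> is twice the number of components.\<close>

definition planar :: "diagram \<Rightarrow> bool" where
  "planar D \<longleftrightarrow> card (faces D) = length (crossings D) + 2 * card (components D)"

definition link_diagram :: "diagram \<Rightarrow> bool" where
  "link_diagram D \<longleftrightarrow>
     distinct (out_edges D @ circles D) \<and> distinct (in_edges D) \<and>
     set (in_edges D) = set (out_edges D) \<and> planar D"


section \<open>Matrix factorizations\<close>

text \<open>A triple \<open>(a, b, s)\<close> stands for the factorization \<open>R \<rightarrow> R[s] \<rightarrow> R\<close> with first map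
  \<open>a\<close> and second map \<open>b\<close>. In the tensor product of a list of \<open>N\<close> of these, the basis element
  indexed by \<open>S \<subseteq> {..<N}\<close> is the product of the generators of the odd parts of the factors
  in \<open>S\<close> and of the even parts of the others, in the order of the list; an element of the
  tensor product is the family of its coefficients.\<close>

type_synonym factor = "mpoly \<times> mpoly \<times> int"

type_synonym mf = "nat set \<Rightarrow> mpoly"

definition mf_module :: "nat set \<Rightarrow> factor list \<Rightarrow> (complex, mf) module" where
  "mf_module E fs =
     \<lparr>carrier = {x. (\<forall>S. vars (x S) \<subseteq> E) \<and> (\<forall>S. \<not> S \<subseteq> {..<length fs} \<longrightarrow> x S = 0)},
      monoid.mult = undefined, one = undefined,
      zero = (\<lambda>S. 0), add = (\<lambda>x y S. x S + y S), module.smult = (\<lambda>c x S. Const c * x S)\<rparr>"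

definition mf_differential :: "factor list \<Rightarrow> mf \<Rightarrow> mf" where
  "mf_differential fs x S =
     (\<Sum>k<length fs. (-1) ^ card {j \<in> S. j < k} *
        (case fs ! k of (a, b, s) \<Rightarrow> if k \<in> S then a * x (S - {k}) else b * x (insert k S)))"

text \<open>The part of quantum degree at most \<open>j\<close>, all variables having degree 2.\<close>

definition mf_filtration :: "nat set \<Rightarrow> factor list \<Rightarrow> int \<Rightarrow> mf set" where
  "mf_filtration E fs j = {x \<in> carrier (mf_module E fs).
     \<forall>S. \<forall>m\<in>Poly_Mapping.keys (x S).
       2 * int (monomial_degree m) + (\<Sum>k\<in>S. snd (snd (fs ! k))) \<le> j}"

definition mf_cocycles :: "nat set \<Rightarrow> factor list \<Rightarrow> mf set" where
  "mf_cocycles E fs = {x \<in> carrier (mf_module E fs). mf_differential fs x = (\<lambda>S. 0)}"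

definition mf_coboundaries :: "nat set \<Rightarrow> factor list \<Rightarrow> mf set" where
  "mf_coboundaries E fs = mf_differential fs ` carrier (mf_module E fs)"

definition mf_cohomology :: "nat set \<Rightarrow> factor list \<Rightarrow> (complex, mf set) module" where
  "mf_cohomology E fs =
     quotient_module (mf_module E fs\<lparr>carrier := mf_cocycles E fs\<rparr>) (mf_coboundaries E fs)"

definition mf_cohomology_filtration :: "nat set \<Rightarrow> factor list \<Rightarrow> int \<Rightarrow> mf set set" where
  "mf_cohomology_filtration E fs j =
     {mf_coboundaries E fs +>\<^bsub>mf_module E fs\<^esub> x | x. x \<in> mf_cocycles E fs \<inter> mf_filtration E fs j}"


section \<open>The Khovanov--Rozansky complex\<close>

text \<open>The \<open>w\<close> with \<open>w' = (n + 1) dw\<close>, where \<open>n\<close> is the degree of \<open>dw\<close>, normalized by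
  \<open>w(0) = 0\<close>; only differences of values of \<open>w\<close> will matter.\<close>

definition primitive :: "complex poly \<Rightarrow> complex poly" where
  "primitive dw = (THE w. pderiv w = Polynomial.smult (of_nat (degree dw + 1)) dw \<and> coeff w 0 = 0)"

text \<open>The polynomials of this block are in variables indexed by 1 to 4, later to be replaced by
  those on the edges at a crossing. Dividing before replacing gives quotients
  also where edges coincide, for instance \<open>(w(x) - w(x)) / (x - x)\<close> is \<open>w'(x)\<close>.\<close>

definition arc_poly :: "complex poly \<Rightarrow> mpoly" where
  "arc_poly dw = (let w = primitive dw in
     exact_quotient (poly_in w (X 1) - poly_in w (X 2)) (X 1 - X 2))"

definition g_poly :: "complex poly \<Rightarrow> mpoly" where
  "g_poly dw = (let w = primitive dw in
     THE g. vars g \<subseteq> {1, 2} \<and>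
       substitute (\<lambda>i. if i = 1 then X 1 + X 2 else X 1 * X 2) g = poly_in w (X 1) + poly_in w (X 2))"

definition g_at :: "complex poly \<Rightarrow> mpoly \<Rightarrow> mpoly \<Rightarrow> mpoly" where
  "g_at dw s p = substitute (\<lambda>i. if i = 1 then s else p) (g_poly dw)"

definition u1_poly :: "complex poly \<Rightarrow> mpoly" where
  "u1_poly dw = exact_quotient
     (g_at dw (X 1 + X 2) (X 1 * X 2) - g_at dw (X 3 + X 4) (X 1 * X 2))
     (X 1 + X 2 - X 3 - X 4)"

definition u2_poly :: "complex poly \<Rightarrow> mpoly" where
  "u2_poly dw = exact_quotient
     (g_at dw (X 3 + X 4) (X 1 * X 2) - g_at dw (X 3 + X 4) (X 3 * X 4))
     (X 1 * X 2 - X 3 * X 4)"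

text \<open>\<open>arc_at dw i j\<close> is \<open>(w(x\<^sub>i) - w(x\<^sub>j)) / (x\<^sub>i - x\<^sub>j)\<close>.\<close>

definition arc_at :: "complex poly \<Rightarrow> nat \<Rightarrow> nat \<Rightarrow> mpoly" where
  "arc_at dw i j = substitute (\<lambda>k. if k = 1 then X i else X j) (arc_poly dw)"

text \<open>With \<open>x\<^sub>i\<close> the variable of the \<open>i\<close>-th edge at a crossing, this is the coefficient of the homotopy correction
  in \<open>\<chi>\<^sub>0\<close> and \<open>\<chi>\<^sub>1\<close>. Writing
  \<open>a\<^sub>0, a\<^sub>1\<close> for the first and \<open>b\<^sub>0 = x\<^sub>1 - x\<^sub>4, b\<^sub>1 = x\<^sub>2 - x\<^sub>3\<close> for the second maps of the two arcs of
  the oriented smoothing, it is the \<open>c\<close> with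
  \<open>a\<^sub>0 = u\<^sub>1 + x\<^sub>3 u\<^sub>2 + c b\<^sub>1\<close> and \<open>a\<^sub>1 = u\<^sub>1 + x\<^sub>1 u\<^sub>2 - c b\<^sub>0\<close>.\<close>

definition chi_poly :: "complex poly \<Rightarrow> mpoly" where
  "chi_poly dw = exact_quotient (arc_at dw 1 4 - u1_poly dw - X 3 * u2_poly dw) (X 2 - X 3)"

definition at_crossing :: "crossing \<Rightarrow> mpoly \<Rightarrow> mpoly" where
  "at_crossing c = substitute (\<lambda>i. X (if i = 1 then e1 c else if i = 2 then e2 c
                                      else if i = 3 then e3 c else e4 c))"

definition arc_factor :: "complex poly \<Rightarrow> nat \<Rightarrow> nat \<Rightarrow> factor" where
  "arc_factor dw i j = (arc_at dw i j, X i - X j, 1 - int (degree dw))"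

text \<open>The shift \<open>[-1]\<close> of a thick edge is accounted for in \<open>graph_shift\<close> below.\<close>

definition crossing_factors :: "complex poly \<Rightarrow> bool \<Rightarrow> crossing \<Rightarrow> factor list" where
  "crossing_factors dw thick c =
     (if thick
      then [(at_crossing c (u1_poly dw), X (e1 c) + X (e2 c) - X (e3 c) - X (e4 c),
               1 - int (degree dw)),
            (at_crossing c (u2_poly dw), X (e1 c) * X (e2 c) - X (e3 c) * X (e4 c),
               3 - int (degree dw))]
      else [arc_factor dw (e1 c) (e4 c), arc_factor dw (e2 c) (e3 c)])"

text \<open>A resolution is given by the set \<open>V\<close> of (indices of) crossings replaced by thick edges, the
  others being replaced by their oriented smoothings. Each edge of the diagram carries one
  mark. The factors of the \<open>k\<close>-th crossing have the indices \<open>2 k\<close> and \<open>2 k + 1\<close>.\<close>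

definition graph_factors :: "complex poly \<Rightarrow> diagram \<Rightarrow> nat set \<Rightarrow> factor list" where
  "graph_factors dw D V =
     concat (map (\<lambda>k. crossing_factors dw (k \<in> V) (crossings D ! k)) [0..<length (crossings D)]) @
     map (\<lambda>i. arc_factor dw i i) (circles D)"

definition graph_shift :: "nat set \<Rightarrow> int" where
  "graph_shift V = - int (card V)"

definition graph_cohomology :: "complex poly \<Rightarrow> diagram \<Rightarrow> nat set \<Rightarrow> (complex, mf set) module" where
  "graph_cohomology dw D V = mf_cohomology (edges D) (graph_factors dw D V)"

definition graph_filtration :: "complex poly \<Rightarrow> diagram \<Rightarrow> nat set \<Rightarrow> int \<Rightarrow> mf set set" where
  "graph_filtration dw D V j =
     mf_cohomology_filtration (edges D) (graph_factors dw D V) (j - graph_shift V)"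

text \<open>The maps \<open>\<chi>\<^sub>0\<close> and \<open>\<chi>\<^sub>1\<close> at the \<open>k\<close>-th crossing, tensored with the identity on
  the other factors. With \<open>1, e\<^sub>0, e\<^sub>1, e\<^sub>0e\<^sub>1\<close> denoting the basis of the two local
  factors on either side, these are
  \<open>\<chi>\<^sub>0\<close>: \<open>1 \<mapsto> (x\<^sub>1 - x\<^sub>3) - c e\<^sub>0e\<^sub>1\<close>, \<open>e\<^sub>0 \<mapsto> x\<^sub>1 e\<^sub>0 - e\<^sub>1\<close>, \<open>e\<^sub>1 \<mapsto> - x\<^sub>3 e\<^sub>0 + e\<^sub>1\<close>,
  \<open>e\<^sub>0e\<^sub>1 \<mapsto> e\<^sub>0e\<^sub>1\<close>, and
  \<open>\<chi>\<^sub>1\<close>: \<open>1 \<mapsto> 1 + c e\<^sub>0e\<^sub>1\<close>, \<open>e\<^sub>0 \<mapsto> e\<^sub>0 + e\<^sub>1\<close>, \<open>e\<^sub>1 \<mapsto> x\<^sub>3 e\<^sub>0 + x\<^sub>1 e\<^sub>1\<close>,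
  \<open>e\<^sub>0e\<^sub>1 \<mapsto> (x\<^sub>1 - x\<^sub>3) e\<^sub>0e\<^sub>1\<close>. Both composites are multiplication by \<open>x\<^sub>1 - x\<^sub>3\<close>.\<close>

definition chi0 :: "complex poly \<Rightarrow> diagram \<Rightarrow> nat \<Rightarrow> mf \<Rightarrow> mf" where
  "chi0 dw D k x S =
     (let c = crossings D ! k; A = 2 * k; B = 2 * k + 1; T = S - {A, B} in
      if A \<notin> S \<and> B \<notin> S then (X (e1 c) - X (e3 c)) * x T
      else if A \<in> S \<and> B \<notin> S then X (e1 c) * x (T \<union> {A}) - X (e3 c) * x (T \<union> {B})
      else if A \<notin> S \<and> B \<in> S then x (T \<union> {B}) - x (T \<union> {A})
      else x (T \<union> {A, B}) - at_crossing c (chi_poly dw) * x T)"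

definition chi1 :: "complex poly \<Rightarrow> diagram \<Rightarrow> nat \<Rightarrow> mf \<Rightarrow> mf" where
  "chi1 dw D k x S =
     (let c = crossings D ! k; A = 2 * k; B = 2 * k + 1; T = S - {A, B} in
      if A \<notin> S \<and> B \<notin> S then x T
      else if A \<in> S \<and> B \<notin> S then x (T \<union> {A}) + X (e3 c) * x (T \<union> {B})
      else if A \<notin> S \<and> B \<in> S then x (T \<union> {A}) + X (e1 c) * x (T \<union> {B})
      else (X (e1 c) - X (e3 c)) * x (T \<union> {A, B}) + at_crossing c (chi_poly dw) * x T)"

definition cohomological_degree :: "diagram \<Rightarrow> nat set \<Rightarrow> int" where
  "cohomological_degree D V = (\<Sum>k\<in>V. if positive (crossings D ! k) then 1 else -1)"

definition quantum_shift :: "complex poly \<Rightarrow> diagram \<Rightarrow> nat set \<Rightarrow> int" where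
  "quantum_shift dw D V = (let n = int (degree dw) in
     \<Sum>k<length (crossings D).
       if positive (crossings D ! k) then (if k \<in> V then - n else 1 - n)
       else (if k \<in> V then n else n - 1))"

definition resolutions :: "diagram \<Rightarrow> int \<Rightarrow> nat set set" where
  "resolutions D i = {V. V \<subseteq> {..<length (crossings D)} \<and> cohomological_degree D V = i}"

text \<open>The component from \<open>V\<close> to \<open>W\<close> of the differential, where \<open>V\<close> and \<open>W\<close> differ at the
  \<open>k\<close>-th crossing; the sign is that of a tensor product of two-term complexes, as the
  cohomological degree at a crossing is odd if and only if it carries a thick edge.\<close>

definition edge_map :: "complex poly \<Rightarrow> diagram \<Rightarrow> nat set \<Rightarrow> nat \<Rightarrow> mf set \<Rightarrow> mf set" where
  "edge_map dw D W k =
     (let fs = graph_factors dw D W in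
      induced_map (mf_module (edges D) fs) (mf_coboundaries (edges D) fs)
        (\<lambda>x S. (-1) ^ card {j \<in> W. j < k} *
           (if positive (crossings D ! k) then chi0 dw D k x S else chi1 dw D k x S)))"

text \<open>The component of the differential at \<open>W\<close> collects the edges of the cube
  ending at \<open>W\<close>: at a positive crossing \<open>k\<close> these have \<open>k \<in> W\<close> and start at \<open>W - {k}\<close>, at
  a negative one \<open>k \<notin> W\<close> and they start at \<open>insert k W\<close>.\<close>

definition KR_complex :: "complex poly \<Rightarrow> diagram \<Rightarrow> (nat set \<Rightarrow> mf set) filtered_complex" where
  "KR_complex dw D =
     \<lparr>cochains = (\<lambda>i. direct_sum_module (resolutions D i) (graph_cohomology dw D)),
      differential = (\<lambda>i x. \<lambda>W\<in>resolutions D (i + 1).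
        \<Oplus>\<^bsub>graph_cohomology dw D W\<^esub>
          k\<in>{k. k < length (crossings D) \<and> (positive (crossings D ! k) \<longleftrightarrow> k \<in> W)}.
            edge_map dw D W k (x (if k \<in> W then W - {k} else insert k W))),
      filtration = (\<lambda>i j. \<Pi>\<^sub>E V\<in>resolutions D i.
        graph_filtration dw D V (j - quantum_shift dw D V))\<rparr>"

text \<open>As the filtered homotopy type of the complex is a link invariant, quantifying over links with
  a diagram each is the same as quantifying over all diagrams.\<close>

definition KR_equivalent :: "complex poly \<Rightarrow> complex poly \<Rightarrow> bool" where
  "KR_equivalent p q \<longleftrightarrow>
     (\<forall>D. link_diagram D \<longrightarrow> filtered_homotopy_equivalent (KR_complex p D) (KR_complex q D))"

definition KR_relation :: "nat \<Rightarrow> (complex poly \<times> complex poly) set" where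
  "KR_relation n = {(p, q). p \<in> monic_polys n \<and> q \<in> monic_polys n \<and> KR_equivalent p q}"

end

theory Submission
  imports Defs "HOL-Computational_Algebra.Fundamental_Theorem_Algebra"
    "HOL-Analysis.Continuum_Not_Denumerable" "HOL-Library.Function_Algebras"
begin

text \<open>Let \<open>\<sigma>\<close> be an automorphism of the field of complex numbers. Applying \<open>\<sigma>\<close> to all coefficients is a
  \<open>\<sigma>\<close>-semilinear isomorphism from the complex of a potential \<open>p\<close> to that of \<open>\<sigma>(p)\<close>. A
  filtered complex over a field whose filtrations are exhaustive and bounded below has a basis that
  is adapted to the filtrations and to the differential, hence a \<open>\<sigma>\<close>-semilinear automorphism for every \<open>\<sigma>\<close>.
  Composing the two shows that \<open>p\<close> and \<open>\<sigma>(p)\<close> are KR-equivalent. By Steinitz, two tuples of complex numbers are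
  in the same orbit of the automorphism group as soon as they satisfy the same polynomial relations
  over the integers, and the latter are determined by finitely many
  minimal polynomials, so that there are only countably many orbits. The
  generic class contains all potentials outside the proper hypersurfaces that are defined over the integers.\<close>

section \<open>Automorphisms of the field of complex numbers\<close>

text \<open>Conjugation by a non-trivial \<open>\<sigma>\<close> is not linear over the complex
  numbers; the second semilinear map undoes its effect on scalars. The composite is an isomorphism
  on the nose, so all homotopies are zero. The obstacle is that a semilinear map of the cochain
  spaces has to respect the differential and the filtration at once. The differential need not be
  strict: the boundaries carry two different filtrations, one induced from the cochain space around
  them and one pushed forward from the preceding space. A common adapted basis always exists for two
  filtrations, but not for three. Hence the bases start with the boundaries, are enlarged to the
  cycles with only one filtration left to care for, and are carried to all cochains by a filtered
  section of the differential.

  On the side of fields, partial isomorphisms are relations between subrings rather than subfields,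
  so that they can be reversed and enlarged without fractions. The price is that polynomial division
  becomes pseudo-division.\<close>

definition partial_iso :: "(complex \<times> complex) set \<Rightarrow> bool" where
  "partial_iso r \<longleftrightarrow> (1, 1) \<in> r \<and>
     (\<forall>a b c d. (a, b) \<in> r \<longrightarrow> (c, d) \<in> r \<longrightarrow> (a - c, b - d) \<in> r \<and> (a * c, b * d) \<in> r) \<and>
     (\<forall>a b. (a, b) \<in> r \<longrightarrow> (a = 0 \<longleftrightarrow> b = 0))"

definition poly_rel :: "(complex \<times> complex) set \<Rightarrow> complex poly \<Rightarrow> complex poly \<Rightarrow> bool" where
  "poly_rel r g h \<longleftrightarrow> (\<forall>i. (coeff g i, coeff h i) \<in> r)"

text \<open>The candidate for the extension that sends \<open>x\<close> to \<open>y\<close>. As a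
  relation between values of corresponding polynomials it exists for every \<open>y\<close>; the
  choice of \<open>y\<close> only decides whether it is a partial isomorphism.\<close>

definition adjoin :: "(complex \<times> complex) set \<Rightarrow> complex \<Rightarrow> complex \<Rightarrow> (complex \<times> complex) set" where
  "adjoin r x y = {(poly g x, poly h y) | g h. poly_rel r g h}"

text \<open>The partner \<open>h\<close> is a way of saying that the coefficients of
  \<open>g\<close> lie in the domain of \<open>r\<close>. Algebraicity over the range is the same
  notion for the converse relation.\<close>

definition algebraic_over :: "(complex \<times> complex) set \<Rightarrow> complex \<Rightarrow> bool" where
  "algebraic_over r x \<longleftrightarrow> (\<exists>g h. poly_rel r g h \<and> g \<noteq> 0 \<and> poly g x = 0)"

lemma adjoinI: "poly_rel r g h \<Longrightarrow> poly g x = a \<Longrightarrow> poly h y = b \<Longrightarrow> (a, b) \<in> adjoin r x y"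
  unfolding adjoin_def by blast

lemma partial_iso_one: "partial_iso r \<Longrightarrow> (1, 1) \<in> r"
  and partial_iso_diff: "partial_iso r \<Longrightarrow> (a, b) \<in> r \<Longrightarrow> (c, d) \<in> r \<Longrightarrow> (a - c, b - d) \<in> r"
  and partial_iso_mult: "partial_iso r \<Longrightarrow> (a, b) \<in> r \<Longrightarrow> (c, d) \<in> r \<Longrightarrow> (a * c, b * d) \<in> r"
  and partial_iso_0_iff: "partial_iso r \<Longrightarrow> (a, b) \<in> r \<Longrightarrow> a = 0 \<longleftrightarrow> b = 0"
  unfolding partial_iso_def by blast+

lemma partial_iso_zero: "partial_iso r \<Longrightarrow> (0, 0) \<in> r"
  using partial_iso_diff[OF _ partial_iso_one partial_iso_one, of r] by simp

lemma partial_iso_add: "partial_iso r \<Longrightarrow> (a, b) \<in> r \<Longrightarrow> (c, d) \<in> r \<Longrightarrow> (a + c, b + d) \<in> r"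
  using partial_iso_diff[of r a b "0 - c" "0 - d"] partial_iso_diff[of r 0 0 c d] partial_iso_zero[of r]
  by simp

lemma partial_iso_sum:
  "partial_iso r \<Longrightarrow> (\<And>i. i \<in> A \<Longrightarrow> (f i, g i) \<in> r) \<Longrightarrow> (sum f A, sum g A) \<in> r"
  by (induction A rule: infinite_finite_induct) (auto intro: partial_iso_zero partial_iso_add)

lemma partial_iso_converse: "partial_iso r \<Longrightarrow> partial_iso (r\<inverse>)"
  unfolding partial_iso_def converse_iff by blast

text \<open>Closure under differences turns the clause on zeros into single-valuedness; applied to
  the converse relation this gives injectivity.\<close>

lemma partial_iso_unique:
  assumes "partial_iso r" "(a, b) \<in> r" "(a, c) \<in> r"
  shows "b = c"
  using partial_iso_0_iff[OF assms(1) partial_iso_diff[OF assms]] by simp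

lemma poly_rel_converse: "poly_rel (r\<inverse>) h g \<longleftrightarrow> poly_rel r g h"
  by (simp add: poly_rel_def)

context
  fixes r assumes r: "partial_iso r"
begin

lemma poly_rel_coeff_0_iff: "poly_rel r g h \<Longrightarrow> coeff g i = 0 \<longleftrightarrow> coeff h i = 0"
  unfolding poly_rel_def by (rule partial_iso_0_iff[OF r]) blast

lemma poly_rel_eq_0_iff: "poly_rel r g h \<Longrightarrow> g = 0 \<longleftrightarrow> h = 0"
  unfolding poly_eq_iff coeff_0 using poly_rel_coeff_0_iff by simp

lemma poly_rel_degree: "poly_rel r g h \<Longrightarrow> degree g = degree h"
  unfolding degree_def using poly_rel_coeff_0_iff by simp

lemma poly_rel_zero: "poly_rel r 0 0"
  using partial_iso_zero[OF r] by (simp add: poly_rel_def)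

lemma poly_rel_const: "(a, b) \<in> r \<Longrightarrow> poly_rel r [:a:] [:b:]"
  using partial_iso_zero[OF r] by (auto simp: poly_rel_def coeff_pCons split: nat.splits)

lemma poly_rel_X: "poly_rel r [:0, 1:] [:0, 1:]"
  using partial_iso_zero[OF r] partial_iso_one[OF r]
  by (auto simp: poly_rel_def coeff_pCons split: nat.splits)

lemma poly_rel_diff: "poly_rel r g h \<Longrightarrow> poly_rel r g' h' \<Longrightarrow> poly_rel r (g - g') (h - h')"
  using partial_iso_diff[OF r] by (simp add: poly_rel_def)

lemma poly_rel_add: "poly_rel r g h \<Longrightarrow> poly_rel r g' h' \<Longrightarrow> poly_rel r (g + g') (h + h')"
  using partial_iso_add[OF r] by (simp add: poly_rel_def)

lemma poly_rel_mult: "poly_rel r g h \<Longrightarrow> poly_rel r g' h' \<Longrightarrow> poly_rel r (g * g') (h * h')"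
  unfolding poly_rel_def coeff_mult
  by (intro allI partial_iso_sum[OF r] partial_iso_mult[OF r]) auto

lemma poly_rel_monom: "(a, b) \<in> r \<Longrightarrow> poly_rel r (monom a k) (monom b k)"
  using partial_iso_zero[OF r] by (simp add: poly_rel_def)

lemma poly_rel_smult: "(a, b) \<in> r \<Longrightarrow> poly_rel r g h \<Longrightarrow> poly_rel r (smult a g) (smult b h)"
  using partial_iso_mult[OF r] by (simp add: poly_rel_def)

text \<open>The coefficients form only a subring, so the leading coefficient of \<open>h\<close>
  cannot be inverted and \<open>f\<close> is scaled by a nonzero \<open>c\<close> instead. The
  divisions on the two sides run in lockstep, which makes quotients and remainders correspond under
  \<open>r\<close>.\<close>

lemma poly_rel_pseudo_division:
  assumes h: "poly_rel r h h'" "h \<noteq> 0"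
  shows "poly_rel r f f' \<Longrightarrow>
    \<exists>c c' q q' s s'. (c, c') \<in> r \<and> c \<noteq> 0 \<and> poly_rel r q q' \<and> poly_rel r s s' \<and>
      smult c f = q * h + s \<and> smult c' f' = q' * h' + s' \<and> (s = 0 \<or> degree s < degree h)"
proof (induction "degree f" arbitrary: f f' rule: less_induct)
  case less
  note f = less.prems
  have lc: "(lead_coeff h, lead_coeff h') \<in> r"
    using h(1) poly_rel_degree[OF h(1)] by (simp add: poly_rel_def)
  show ?case
  proof (cases "degree f < degree h")
    case True
    then show ?thesis
      using f partial_iso_one[OF r] poly_rel_zero
      by (intro exI[of _ 1] exI[of _ 0] exI[of _ f] exI[of _ f']) auto
  next
    case deg: False
    show ?thesis
    \<comment> \<open>For constant \<open>h\<close> a cancellation step need not lower the degree,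
      as \<open>f\<close> may be constant too; here \<open>f\<close> itself is the quotient.\<close>
    proof (cases "degree h = 0")
      case True
      then have "h = [:lead_coeff h:]" "h' = [:lead_coeff h':]"
        using poly_rel_degree[OF h(1)] by (simp_all add: degree_0_id)
      moreover have "f * [:c:] = smult c f" for c :: complex and f by simp
      ultimately have "smult (lead_coeff h) f = f * h" "smult (lead_coeff h') f' = f' * h'"
        by metis+
      then show ?thesis
        using lc f h(2) poly_rel_zero
        by (intro exI[of _ "lead_coeff h"] exI[of _ "lead_coeff h'"] exI[of _ f] exI[of _ f']
            exI[of _ 0]) auto
    next
      case pos: False
      \<comment> \<open>\<open>f1\<close> is \<open>f\<close> scaled by \<open>lead_coeff h\<close>
        minus the multiple of \<open>h\<close> with the same leading term. The degree drops, and the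
        scalar of the recursive call gets multiplied by \<open>lead_coeff h\<close>.\<close>
      define k where "k = degree f - degree h"
      define a where "a = monom (lead_coeff f) k"
      define a' where "a' = monom (lead_coeff f') k"
      have a: "poly_rel r a a'"
        unfolding a_def a'_def using f poly_rel_degree[OF f]
        by (intro poly_rel_monom) (simp add: poly_rel_def)
      define f1 where "f1 = smult (lead_coeff h) f - a * h"
      define f1' where "f1' = smult (lead_coeff h') f' - a' * h'"
      have f1: "poly_rel r f1 f1'"
        unfolding f1_def f1'_def
        by (intro poly_rel_diff poly_rel_smult poly_rel_mult lc f h a)
      have "degree (a * h) \<le> degree f"
        using degree_mult_le[of a h] degree_monom_le[of "lead_coeff f" k] deg
        unfolding a_def k_def by linarith
      then have "degree f1 \<le> degree f"
        unfolding f1_def by (intro degree_diff_le) (auto simp: degree_smult_le)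
      moreover have "coeff f1 (degree f) = 0"
        using deg unfolding f1_def a_def k_def by (simp add: coeff_monom_mult)
      ultimately have "degree f1 < degree f"
        using deg pos by (cases "f1 = 0") (auto intro: degree_less_if_less_eqI)
      from less.hyps[OF this f1] obtain c c' q q' s s' where
        *: "(c, c') \<in> r" "c \<noteq> 0" "poly_rel r q q'" "poly_rel r s s'"
          "smult c f1 = q * h + s" "smult c' f1' = q' * h' + s'" "s = 0 \<or> degree s < degree h"
        by blast
      have "smult (c * lead_coeff h) f = (smult c a + q) * h + s"
        using *(5) unfolding f1_def by (simp add: algebra_simps smult_diff_right)
      moreover have "smult (c' * lead_coeff h') f' = (smult c' a' + q') * h' + s'"
        using *(6) unfolding f1'_def by (simp add: algebra_simps smult_diff_right)
      ultimately show ?thesis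
        using *(2,7) h(2) partial_iso_mult[OF r *(1) lc] *(4)
          poly_rel_add[OF poly_rel_smult[OF *(1) a] *(3)]
        by (metis leading_coeff_0_iff mult_eq_0_iff)
    qed
  qed
qed

lemma partial_iso_adjoin:
  assumes "\<And>g h. poly_rel r g h \<Longrightarrow> poly g x = 0 \<longleftrightarrow> poly h y = 0"
  shows "partial_iso (adjoin r x y)"
  unfolding partial_iso_def
proof (intro conjI allI impI)
  show "(1, 1) \<in> adjoin r x y"
    by (rule adjoinI[OF poly_rel_const[OF partial_iso_one[OF r]]]) simp_all
next
  fix a b c d assume "(a, b) \<in> adjoin r x y" "(c, d) \<in> adjoin r x y"
  then obtain g h g' h' where
    *: "a = poly g x" "b = poly h y" "poly_rel r g h" "c = poly g' x" "d = poly h' y" "poly_rel r g' h'"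
    by (auto simp: adjoin_def)
  show "(a - c, b - d) \<in> adjoin r x y"
    by (rule adjoinI[OF poly_rel_diff[OF *(3,6)]]) (simp_all add: *)
  show "(a * c, b * d) \<in> adjoin r x y"
    by (rule adjoinI[OF poly_rel_mult[OF *(3,6)]]) (simp_all add: *)
next
  fix a b assume "(a, b) \<in> adjoin r x y"
  then show "a = 0 \<longleftrightarrow> b = 0"
    using assms by (auto simp: adjoin_def)
qed

lemma subset_adjoin: "r \<subseteq> adjoin r x y"
  by (auto intro: adjoinI poly_rel_const)

lemma in_adjoin: "(x, y) \<in> adjoin r x y"
  by (rule adjoinI[OF poly_rel_X]) simp_all

text \<open>On both sides only the zero polynomial vanishes at the new element, and corresponding
  polynomials are zero together.\<close>

lemma partial_iso_adjoin_transcendental: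
  assumes "\<not> algebraic_over r x" "\<not> algebraic_over (r\<inverse>) y"
  shows "partial_iso (adjoin r x y)"
proof (rule partial_iso_adjoin)
  fix g h assume gh: "poly_rel r g h"
  then have "poly_rel (r\<inverse>) h g" by (simp add: poly_rel_converse)
  with gh show "poly g x = 0 \<longleftrightarrow> poly h y = 0"
    using assms poly_rel_eq_0_iff[OF gh] unfolding algebraic_over_def by auto
qed

text \<open>A root \<open>y\<close> of the image \<open>m'\<close> of a minimal polynomial \<open>m\<close> of \<open>x\<close> has the same relations as \<open>x\<close>:
  a polynomial relation for \<open>y\<close> of lower degree would yield a factor of \<open>m\<close>.\<close>

lemma partial_iso_adjoin_algebraic:
  assumes m: "poly_rel r m m'" "m \<noteq> 0" "poly m x = 0" "poly m' y = 0"
    and min: "\<And>g h. poly_rel r g h \<Longrightarrow> g \<noteq> 0 \<Longrightarrow> poly g x = 0 \<Longrightarrow> degree m \<le> degree g"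
  shows "partial_iso (adjoin r x y)"
proof (rule partial_iso_adjoin)
  \<comment> \<open>The remainder modulo \<open>m\<close> vanishes at \<open>x\<close> and has
    smaller degree, so it is zero; hence \<open>m'\<close> divides a nonzero multiple of
    \<open>h\<close>.\<close>
  have forward: "poly h y = 0" if gh: "poly_rel r g h" "poly g x = 0" for g h
  proof -
    obtain c c' q q' s s' where *: "(c, c') \<in> r" "c \<noteq> 0" "poly_rel r s s'"
      "smult c g = q * m + s" "smult c' h = q' * m' + s'" "s = 0 \<or> degree s < degree m"
      using poly_rel_pseudo_division[OF m(1,2) gh(1)] by blast
    have "poly s x = 0"
      using arg_cong[OF *(4), of "\<lambda>p. poly p x"] m(3) gh(2) by simp
    then have "s = 0"
      using min[OF *(3)] *(6) by (meson not_less)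
    then have "s' = 0"
      using poly_rel_eq_0_iff[OF *(3)] by simp
    then have "c' * poly h y = 0"
      using arg_cong[OF *(5), of "\<lambda>p. poly p y"] by (simp only: poly_smult poly_add poly_mult m(4) poly_0 mult_zero_right add_0_right)
    then show ?thesis
      using *(2) partial_iso_0_iff[OF r *(1)] by simp
  qed
  have no_smaller: False
    if gh: "poly_rel r g h" "poly h y = 0" "poly g x \<noteq> 0" "degree g < degree m" for g h
    using that
  proof (induction "degree g" arbitrary: g h rule: less_induct)
    case less
    have g0: "g \<noteq> 0" using less.prems(3) by auto
    obtain c c' q q' s s' where *: "(c, c') \<in> r" "c \<noteq> 0" "poly_rel r q q'" "poly_rel r s s'"
      "smult c m = q * g + s" "smult c' m' = q' * h + s'" "s = 0 \<or> degree s < degree g"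
      using poly_rel_pseudo_division[OF less.prems(1) g0 m(1)] by blast
    have "poly s' y = 0"
      using arg_cong[OF *(6), of "\<lambda>p. poly p y"] m(4) less.prems(2) by simp
    have "s = 0"
    proof (rule ccontr)
      assume s: "s \<noteq> 0"
      have "poly s x \<noteq> 0"
        using min[OF *(4) s] less.prems(4) *(7) s by (meson less_trans not_less)
      then show False
        using less.hyps[OF _ *(4) \<open>poly s' y = 0\<close>] *(7) s less.prems(4) by auto
    qed
    \<comment> \<open>Here \<open>g\<close> divides \<open>m\<close> up to a scalar without
      vanishing at \<open>x\<close>, so the cofactor \<open>q\<close> vanishes there. Minimality
      gives \<open>q\<close> the full degree of \<open>m\<close>; hence \<open>g\<close> and
      \<open>h\<close> are constant, and the root \<open>y\<close> forces
      \<open>h = 0\<close>.\<close>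
    then have eq: "smult c m = q * g" using *(5) by simp
    then have "q \<noteq> 0" using *(2) m(2) by auto
    have "poly q x = 0"
      using arg_cong[OF eq, of "\<lambda>p. poly p x"] m(3) less.prems(3) by simp
    then have "degree m \<le> degree q"
      using min[OF *(3) \<open>q \<noteq> 0\<close>] by simp
    moreover have "degree m = degree q + degree g"
      using arg_cong[OF eq, of degree] *(2) \<open>q \<noteq> 0\<close> g0 by (simp add: degree_mult_eq)
    ultimately have "degree g = 0" by simp
    then have "degree h = 0" using poly_rel_degree[OF less.prems(1)] by simp
    then have "h = 0"
      using less.prems(2) by (auto elim!: degree_eq_zeroE)
    then show False using poly_rel_eq_0_iff[OF less.prems(1)] g0 by simp
  qed
  fix g h assume gh: "poly_rel r g h"
  show "poly g x = 0 \<longleftrightarrow> poly h y = 0"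
  proof
    assume h: "poly h y = 0"
    obtain c c' q q' s s' where *: "(c, c') \<in> r" "c \<noteq> 0" "poly_rel r s s'"
      "smult c g = q * m + s" "smult c' h = q' * m' + s'" "s = 0 \<or> degree s < degree m"
      using poly_rel_pseudo_division[OF m(1,2) gh(1)] by blast
    have "poly s' y = 0"
      using arg_cong[OF *(5), of "\<lambda>p. poly p y"] m(4) h by simp
    then have "poly s x = 0"
      using no_smaller[OF *(3)] *(6) by (cases "s = 0") auto
    then show "poly g x = 0"
      using arg_cong[OF *(4), of "\<lambda>p. poly p x"] m(3) *(2) by simp
  qed (rule forward[OF gh])
qed

lemma minimal_polynomial:
  assumes "algebraic_over r x"
  obtains m m' where "poly_rel r m m'" "m \<noteq> 0" "poly m x = 0"
    "\<And>g h. poly_rel r g h \<Longrightarrow> g \<noteq> 0 \<Longrightarrow> poly g x = 0 \<Longrightarrow> degree m \<le> degree g"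
proof -
  define P where "P = (\<lambda>g. \<exists>h. poly_rel r g h \<and> g \<noteq> 0 \<and> poly g x = 0)"
  obtain g where "P g" using assms by (auto simp: P_def algebraic_over_def)
  then have "P (arg_min degree P)" "\<And>g. P g \<Longrightarrow> degree (arg_min degree P) \<le> degree g"
    using arg_min_nat_lemma[of P g degree] by auto
  then show thesis unfolding P_def using that by blast
qed

text \<open>The image of a minimal polynomial has the same positive degree, hence a root since the
  complex numbers are algebraically closed; any such root may serve as the image of
  \<open>x\<close>.\<close>

lemma extend_algebraic:
  assumes "algebraic_over r x"
  shows "\<exists>y. partial_iso (adjoin r x y)"
proof -
  obtain m m' where m: "poly_rel r m m'" "m \<noteq> 0" "poly m x = 0"
    "\<And>g h. poly_rel r g h \<Longrightarrow> g \<noteq> 0 \<Longrightarrow> poly g x = 0 \<Longrightarrow> degree m \<le> degree g"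
    by (rule minimal_polynomial[OF assms]) (rule that)
  have "degree m \<noteq> 0"
  proof
    assume "degree m = 0"
    then show False using m(2,3) by (auto elim!: degree_eq_zeroE)
  qed
  then have "\<not> constant (poly m')"
    using poly_rel_degree[OF m(1)] by (simp add: constant_degree)
  then obtain y where y: "poly m' y = 0"
    using fundamental_theorem_of_algebra by blast
  have "partial_iso (adjoin r x y)"
    by (rule partial_iso_adjoin_algebraic[OF m(1-3) y]) (rule m(4))
  then show ?thesis ..
qed

end

section \<open>Countable partial isomorphisms and the back-and-forth construction\<close>

lemma countable_polys: "countable A \<Longrightarrow> countable {g :: complex poly. \<forall>i. coeff g i \<in> A}"
proof -
  assume A: "countable A"
  have "{g :: complex poly. \<forall>i. coeff g i \<in> A} \<subseteq> Poly ` lists A"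
  proof
    fix g :: "complex poly" assume "g \<in> {g. \<forall>i. coeff g i \<in> A}"
    then have "coeffs g \<in> lists A" by (auto simp: coeffs_def)
    then show "g \<in> Poly ` lists A" by (metis Poly_coeffs imageI)
  qed
  then show ?thesis using A by (meson countable_lists countable_image countable_subset)
qed

lemma poly_rel_coeff: "poly_rel r g h \<Longrightarrow> coeff g i \<in> Domain r" "poly_rel r g h \<Longrightarrow> coeff h i \<in> Range r"
  by (auto simp: poly_rel_def)

lemma countable_Domain: "countable r \<Longrightarrow> countable (Domain r)"
  and countable_Range: "countable r \<Longrightarrow> countable (Range r)"
  by (simp_all add: Domain_fst Range_snd)

lemma countable_adjoin: "countable r \<Longrightarrow> countable (adjoin r x y)"
proof -
  assume r: "countable r"
  have "adjoin r x y \<subseteq> (\<lambda>(g, h). (poly g x, poly h y)) `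
      ({g. \<forall>i. coeff g i \<in> Domain r} \<times> {h. \<forall>i. coeff h i \<in> Range r})"
    unfolding adjoin_def using poly_rel_coeff[of r] by force
  then show ?thesis
    by (rule countable_subset)
      (intro countable_image countable_SIGMA countable_polys countable_Domain countable_Range r)
qed

lemma countable_algebraic: "countable r \<Longrightarrow> countable {x. algebraic_over r x}"
proof -
  assume r: "countable r"
  have "{x. algebraic_over r x} \<subseteq> (\<Union>g\<in>{g. \<forall>i. coeff g i \<in> Domain r} - {0}. {x. poly g x = 0})"
  proof
    fix x assume "x \<in> {x. algebraic_over r x}"
    then obtain g h where g: "poly_rel r g h" "g \<noteq> 0" "poly g x = 0"
      unfolding algebraic_over_def by blast
    then have "g \<in> {g. \<forall>i. coeff g i \<in> Domain r} - {0}"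
      using poly_rel_coeff(1)[OF g(1)] by simp
    with g(3) show "x \<in> (\<Union>g\<in>{g. \<forall>i. coeff g i \<in> Domain r} - {0}. {x. poly g x = 0})"
      by (intro UN_I) simp_all
  qed
  moreover have "countable (\<Union>g\<in>{g. \<forall>i. coeff g i \<in> Domain r} - {0}. {x. poly g x = 0})"
    by (intro countable_UN countable_Diff countable_polys countable_Domain r)
      (auto intro: countable_finite poly_roots_finite)
  ultimately show ?thesis by (rule countable_subset)
qed

lemma countable_converse: "countable r \<Longrightarrow> countable (r\<inverse>)"
  by (rule countable_subset[of _ "prod.swap ` r"]) (force simp: image_iff)+

text \<open>Countability is what provides an image for a transcendental \<open>x\<close>: only
  countably many numbers are algebraic over the range.\<close>

lemma extend_countable:
  assumes "partial_iso r" "countable r"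
  shows "\<exists>y. partial_iso (adjoin r x y)"
proof (cases "algebraic_over r x")
  case True
  then show ?thesis by (rule extend_algebraic[OF assms(1)])
next
  case False
  have "countable {y. algebraic_over (r\<inverse>) y}"
    by (rule countable_algebraic[OF countable_converse[OF assms(2)]])
  then have "{y. algebraic_over (r\<inverse>) y} \<noteq> UNIV"
    using uncountable_UNIV_complex by metis
  then show ?thesis
    using partial_iso_adjoin_transcendental[OF assms(1) False] by blast
qed

lemma partial_iso_Union:
  assumes "C \<noteq> {}" "\<And>r. r \<in> C \<Longrightarrow> partial_iso r"
    and "\<And>r s. r \<in> C \<Longrightarrow> s \<in> C \<Longrightarrow> r \<subseteq> s \<or> s \<subseteq> r"
  shows "partial_iso (\<Union>C)"
  unfolding partial_iso_def
proof (intro conjI allI impI)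
  show "(1, 1) \<in> \<Union>C" using assms(1,2) partial_iso_one by blast
next
  fix a b c d assume "(a, b) \<in> \<Union>C" "(c, d) \<in> \<Union>C"
  then obtain r where "r \<in> C" "(a, b) \<in> r" "(c, d) \<in> r"
    using assms(3) by blast
  then show "(a - c, b - d) \<in> \<Union>C" "(a * c, b * d) \<in> \<Union>C"
    using assms(2) partial_iso_diff partial_iso_mult by blast+
qed (use assms(2) partial_iso_0_iff in blast)+

text \<open>The elements of an enumeration of \<open>A\<close> are adjoined one by one. Countability
  persists at every stage and in the union, so that the construction can be iterated.\<close>

lemma extend_countably:
  assumes "partial_iso r" "countable r" "countable A"
  shows "\<exists>s. r \<subseteq> s \<and> partial_iso s \<and> countable s \<and> A \<subseteq> Domain s"
proof (cases "A = {}")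
  case True
  then show ?thesis using assms by auto
next
  case False
  have "\<exists>f. \<forall>n. (partial_iso (f n) \<and> countable (f n) \<and> r \<subseteq> f n) \<and>
      (f n \<subseteq> f (Suc n) \<and> from_nat_into A n \<in> Domain (f (Suc n)))"
  proof (rule dependent_nat_choice)
    fix s and n :: nat
    assume s: "partial_iso s \<and> countable s \<and> r \<subseteq> s"
    then obtain y where y: "partial_iso (adjoin s (from_nat_into A n) y)"
      using extend_countable[of s] by blast
    have "s \<subseteq> adjoin s (from_nat_into A n) y" "countable (adjoin s (from_nat_into A n) y)"
      "(from_nat_into A n, y) \<in> adjoin s (from_nat_into A n) y"
      using s subset_adjoin in_adjoin countable_adjoin by auto
    with y show "\<exists>t. (partial_iso t \<and> countable t \<and> r \<subseteq> t) \<and> s \<subseteq> t \<and> from_nat_into A n \<in> Domain t"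
      using s by (intro exI[of _ "adjoin s (from_nat_into A n) y"]) blast
  qed (use assms in blast)
  then obtain f where F: "\<forall>n. (partial_iso (f n) \<and> countable (f n) \<and> r \<subseteq> f n) \<and>
      (f n \<subseteq> f (Suc n) \<and> from_nat_into A n \<in> Domain (f (Suc n)))" ..
  have f: "partial_iso (f n)" "countable (f n)" "r \<subseteq> f n" "f n \<subseteq> f (Suc n)"
    "from_nat_into A n \<in> Domain (f (Suc n))" for n
    using spec[OF F, of n] by simp_all
  then have mono: "f m \<subseteq> f n" if "m \<le> n" for m n
    using that lift_Suc_mono_le[of f] by blast
  have "partial_iso (\<Union>(range f))"
    using f(1) mono by (intro partial_iso_Union) (auto, metis nat_le_linear subsetD)
  moreover have "countable (\<Union>(range f))" "r \<subseteq> \<Union>(range f)" using f(2,3) by auto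
  moreover have "A \<subseteq> Domain (\<Union>(range f))"
  proof
    fix x assume "x \<in> A"
    then obtain n where "x = from_nat_into A n"
      using from_nat_into_surj[OF assms(3)] by metis
    then show "x \<in> Domain (\<Union>(range f))" using f(5)[of n] by blast
  qed
  ultimately show ?thesis by blast
qed

text \<open>Every stage puts all elements met so far, on either side, into both the domain and the
  range of the next one; in the union the two therefore coincide.\<close>

lemma back_and_forth:
  assumes "partial_iso r" "countable r"
  shows "\<exists>s. r \<subseteq> s \<and> partial_iso s \<and> Domain s = Range s"
proof -
  have step: "\<exists>t. s \<subseteq> t \<and> partial_iso t \<and> countable t \<and> Field s \<subseteq> Domain t \<and> Field s \<subseteq> Range t"
    if s: "partial_iso s" "countable s" for s
  proof -
    have F: "countable (Field s)"
      using s(2) by (simp add: Field_def countable_Domain countable_Range)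
    from extend_countably[OF s F] obtain t where
      t: "s \<subseteq> t" "partial_iso t" "countable t" "Field s \<subseteq> Domain t" by blast
    \<comment> \<open>The range is enlarged by enlarging the domain of the converse.\<close>
    from extend_countably[OF partial_iso_converse[OF t(2)] countable_converse[OF t(3)] F] obtain u where
      u: "t\<inverse> \<subseteq> u" "partial_iso u" "countable u" "Field s \<subseteq> Domain u" by blast
    have tu: "t \<subseteq> u\<inverse>" using u(1) by auto
    then have "s \<subseteq> u\<inverse>" using t(1) by simp
    moreover have "Field s \<subseteq> Domain (u\<inverse>)" using t(4) Domain_mono[OF tu] by simp
    moreover have "Field s \<subseteq> Range (u\<inverse>)" using u(4) by simp
    ultimately have "s \<subseteq> u\<inverse>" "Field s \<subseteq> Domain (u\<inverse>)" "Field s \<subseteq> Range (u\<inverse>)"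
      by simp_all
    then show ?thesis
      using partial_iso_converse[OF u(2)] countable_converse[OF u(3)] by blast
  qed
  have "\<exists>f. \<forall>n::nat. (partial_iso (f n) \<and> countable (f n) \<and> r \<subseteq> f n) \<and>
      (f n \<subseteq> f (Suc n) \<and> Field (f n) \<subseteq> Domain (f (Suc n)) \<and> Field (f n) \<subseteq> Range (f (Suc n)))"
  proof (rule dependent_nat_choice)
    fix s and n :: nat
    assume s: "partial_iso s \<and> countable s \<and> r \<subseteq> s"
    with step[of s] show "\<exists>t. (partial_iso t \<and> countable t \<and> r \<subseteq> t) \<and>
        s \<subseteq> t \<and> Field s \<subseteq> Domain t \<and> Field s \<subseteq> Range t"
      by blast
  qed (use assms in blast)
  then obtain f where F: "\<forall>n::nat. (partial_iso (f n) \<and> countable (f n) \<and> r \<subseteq> f n) \<and>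
      (f n \<subseteq> f (Suc n) \<and> Field (f n) \<subseteq> Domain (f (Suc n)) \<and> Field (f n) \<subseteq> Range (f (Suc n)))" ..
  have f: "partial_iso (f n)" "r \<subseteq> f n" "f n \<subseteq> f (Suc n)"
    "Field (f n) \<subseteq> Domain (f (Suc n))" "Field (f n) \<subseteq> Range (f (Suc n))" for n
    using spec[OF F, of n] by simp_all
  then have mono: "f m \<subseteq> f n" if "m \<le> n" for m n
    using that lift_Suc_mono_le[of f] by blast
  have "partial_iso (\<Union>(range f))"
    using f(1) mono by (intro partial_iso_Union) (auto, metis nat_le_linear subsetD)
  moreover have "r \<subseteq> \<Union>(range f)" using f(2) by blast
  moreover have "Domain (\<Union>(range f)) = Range (\<Union>(range f))"
  proof (intro equalityI subsetI)
    fix x assume "x \<in> Domain (\<Union>(range f))"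
    then obtain n where "x \<in> Field (f n)" by (auto simp: Field_def)
    then have "x \<in> Range (f (Suc n))" using f(5) by (rule rev_subsetD)
    then show "x \<in> Range (\<Union>(range f))" by auto
  next
    fix x assume "x \<in> Range (\<Union>(range f))"
    then obtain n where "x \<in> Field (f n)" by (auto simp: Field_def)
    then have "x \<in> Domain (f (Suc n))" using f(4) by (rule rev_subsetD)
    then show "x \<in> Domain (\<Union>(range f))" by auto
  qed
  ultimately show ?thesis by blast
qed

section \<open>Extension of partial isomorphisms to automorphisms\<close>

definition field_automorphism :: "(complex \<Rightarrow> complex) \<Rightarrow> bool" where
  "field_automorphism \<sigma> \<longleftrightarrow> bij \<sigma> \<and> \<sigma> 1 = 1 \<and>
     (\<forall>x y. \<sigma> (x + y) = \<sigma> x + \<sigma> y) \<and> (\<forall>x y. \<sigma> (x * y) = \<sigma> x * \<sigma> y)"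

text \<open>The clause on zeros in \<open>partial_iso\<close> makes the chosen image coefficients
  vanish beyond the degree of \<open>g\<close>, so that they form a polynomial.\<close>

lemma poly_rel_partner:
  assumes "partial_iso r" "\<And>i. coeff g i \<in> Domain r"
  shows "\<exists>h. poly_rel r g h"
proof -
  have "\<forall>i. \<exists>y. (coeff g i, y) \<in> r"
    using assms(2) by blast
  then obtain f where "\<forall>i. (coeff g i, f i) \<in> r" by (rule choice[THEN exE])
  then have f: "(coeff g i, f i) \<in> r" for i ..
  have "f i = 0" if "i > degree g" for i
    using partial_iso_0_iff[OF assms(1) f[of i]] coeff_eq_0[OF that] by simp
  then have "coeff (Abs_poly f) = f"
    by (intro Abs_poly_inverse) (auto simp: MOST_nat)
  then have "poly_rel r g (Abs_poly f)" using f by (simp add: poly_rel_def)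
  then show ?thesis ..
qed

text \<open>Zorn's lemma among partial isomorphisms subject to a condition that survives unions. It
  serves once with equality of domain and range and once without a condition.\<close>

lemma maximal_partial_iso:
  assumes "partial_iso r" "P r"
    and "\<And>C. \<forall>s\<in>C. P s \<Longrightarrow> P (\<Union>C)"
  shows "\<exists>s. r \<subseteq> s \<and> partial_iso s \<and> P s \<and> (\<forall>t. s \<subseteq> t \<longrightarrow> partial_iso t \<longrightarrow> P t \<longrightarrow> t = s)"
proof -
  let ?A = "{s. r \<subseteq> s \<and> partial_iso s \<and> P s}"
  have M: "\<exists>M\<in>?A. \<forall>X\<in>?A. M \<subseteq> X \<longrightarrow> X = M"
  proof (rule subset_Zorn_nonempty)
    fix C assume C: "C \<noteq> {}" "subset.chain ?A C"
    then have "partial_iso (\<Union>C)"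
      by (intro partial_iso_Union) (auto simp: subset_chain_def)
    moreover have "P (\<Union>C)" "r \<subseteq> \<Union>C"
      using C assms(3)[of C] unfolding subset_chain_def by blast+
    ultimately show "\<Union>C \<in> ?A" by blast
  qed (use assms in blast)
  obtain s where "s \<in> ?A" "\<forall>t\<in>?A. s \<subseteq> t \<longrightarrow> t = s" using M by (rule bexE)
  then have s: "r \<subseteq> s" "partial_iso s" "P s" and max: "\<forall>t\<in>?A. s \<subseteq> t \<longrightarrow> t = s" by simp_all
  have "t = s" if "s \<subseteq> t" "partial_iso t" "P t" for t
    using max that s(1) by simp
  with s show ?thesis by (intro exI[of _ s]) simp
qed

text \<open>Once \<open>r\<close> has been enlarged such that its domain agrees with its range, every element that is
  transcendental over both may be mapped to itself. This leaves only algebraic elements to be added.\<close>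

theorem extends_to_automorphism:
  assumes "partial_iso r" "countable r"
  shows "\<exists>\<sigma>. field_automorphism \<sigma> \<and> (\<forall>(x, y)\<in>r. \<sigma> x = y)"
proof -
  obtain s0 where s0: "r \<subseteq> s0" "partial_iso s0" "Domain s0 = Range s0"
    using back_and_forth[OF assms] by blast
  have chain: "Domain (\<Union>C) = Range (\<Union>C)" if "\<forall>s\<in>C. Domain s = Range s"
    for C :: "(complex \<times> complex) set set"
    using that by (simp add: Domain_Union Range_Union)
  have "\<exists>s. s0 \<subseteq> s \<and> partial_iso s \<and> Domain s = Range s \<and>
      (\<forall>t. s \<subseteq> t \<longrightarrow> partial_iso t \<longrightarrow> Domain t = Range t \<longrightarrow> t = s)"
    by (rule maximal_partial_iso[OF s0(2)]; (rule s0(3) | rule chain, assumption))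
  then obtain s where s: "s0 \<subseteq> s" "partial_iso s" "Domain s = Range s"
    and s_max: "\<forall>t. s \<subseteq> t \<longrightarrow> partial_iso t \<longrightarrow> Domain t = Range t \<longrightarrow> t = s"
    by (elim exE conjE)
  \<comment> \<open>An \<open>x\<close> that is transcendental over both sides could be sent to
    itself without spoiling the equality of domain and range. By maximality the pair
    \<open>(x, x)\<close> would already belong to \<open>s\<close>, and \<open>x\<close> would be
    algebraic as a root of \<open>[:- x, 1:]\<close>.\<close>
  have alg: "algebraic_over s x \<or> algebraic_over (s\<inverse>) x" for x
  proof (rule ccontr)
    assume x: "\<not> ?thesis"
    let ?t = "adjoin s x x"
    have "partial_iso ?t"
      by (rule partial_iso_adjoin_transcendental[OF s(2)]) (use x in auto)
    moreover have "Domain ?t \<subseteq> Range ?t"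
    proof
      fix z assume "z \<in> Domain ?t"
      then obtain g h where gh: "z = poly g x" "poly_rel s g h" by (auto simp: adjoin_def)
      then have "\<And>i. coeff g i \<in> Domain (s\<inverse>)" using poly_rel_coeff(1)[OF gh(2)] s(3) by auto
      then obtain h' where "poly_rel s h' g"
        using poly_rel_partner[OF partial_iso_converse[OF s(2)]] by (auto simp: poly_rel_converse)
      then show "z \<in> Range ?t" using gh(1) by (auto simp: adjoin_def)
    qed
    moreover have "Range ?t \<subseteq> Domain ?t"
    proof
      fix z assume "z \<in> Range ?t"
      then obtain g h where gh: "z = poly h x" "poly_rel s g h" by (auto simp: adjoin_def)
      then have "\<And>i. coeff h i \<in> Domain s" using poly_rel_coeff(2)[OF gh(2)] s(3) by auto
      then obtain h' where "poly_rel s h h'" using poly_rel_partner[OF s(2)] by blast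
      then show "z \<in> Domain ?t" using gh(1) by (auto simp: adjoin_def)
    qed
    ultimately have "?t = s" using s_max subset_adjoin[OF s(2)] by simp
    then have "(x, x) \<in> s" using in_adjoin[OF s(2), of x x] by simp
    then have "poly_rel s [:- x, 1:] [:- x, 1:]"
      using poly_rel_diff[OF s(2) poly_rel_X[OF s(2)] poly_rel_const[OF s(2)], of x x]
      by simp
    then have "algebraic_over s x" unfolding algebraic_over_def by (intro exI) auto
    then show False using x by blast
  qed
  \<comment> \<open>When domain and range agree, being algebraic over the one or over the other is
    the same.\<close>
  have alg_swap: "algebraic_over (u\<inverse>) x"
    if u: "algebraic_over u x" "Domain u = Range u" "partial_iso u" for u x
  proof -
    obtain g h where g: "poly_rel u g h" "g \<noteq> 0" "poly g x = 0"
      using u(1) unfolding algebraic_over_def by blast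
    then have "\<And>i. coeff g i \<in> Domain (u\<inverse>)" using poly_rel_coeff(1)[OF g(1)] u(2) by auto
    then obtain h' where "poly_rel (u\<inverse>) g h'"
      using poly_rel_partner[OF partial_iso_converse[OF u(3)]] by blast
    then show ?thesis using g unfolding algebraic_over_def by blast
  qed
  \<comment> \<open>Maximal among all partial isomorphisms. Since everything is algebraic over
    \<open>m\<close> and over its converse, an element missing on either side could be adjoined by
    \<open>extend_algebraic\<close>.\<close>
  obtain m where m: "s \<subseteq> m" "partial_iso m"
    and m_max: "\<forall>t. m \<subseteq> t \<longrightarrow> partial_iso t \<longrightarrow> True \<longrightarrow> t = m"
    using maximal_partial_iso[OF s(2), of "\<lambda>_. True", OF TrueI TrueI] by (elim exE conjE)
  have total: "\<exists>y. (x, y) \<in> u"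
    if u: "partial_iso u" "\<And>t. u \<subseteq> t \<Longrightarrow> partial_iso t \<Longrightarrow> t = u" "algebraic_over u x" for x u
  proof -
    obtain y where "partial_iso (adjoin u x y)" using extend_algebraic[OF u(1,3)] by blast
    then have "adjoin u x y = u" by (rule u(2)[OF subset_adjoin[OF u(1)]])
    then show ?thesis using in_adjoin[OF u(1)] by blast
  qed
  have mono: "algebraic_over u x \<Longrightarrow> u \<subseteq> v \<Longrightarrow> algebraic_over v x" for u v x
    unfolding algebraic_over_def poly_rel_def by blast
  have s_conv: "partial_iso (s\<inverse>)" "Domain (s\<inverse>) = Range (s\<inverse>)"
    using s partial_iso_converse by auto
  have alg1: "algebraic_over m x" for x
    using alg[of x] alg_swap[of "s\<inverse>" x] s_conv mono[OF _ m(1)] by auto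
  have alg2: "algebraic_over (m\<inverse>) x" for x
    using alg[of x] alg_swap[of s x] s mono[of "s\<inverse>" x "m\<inverse>"] m(1) by auto
  have m_conv: "t = m\<inverse>" if "m\<inverse> \<subseteq> t" "partial_iso t" for t
  proof -
    have "m \<subseteq> t\<inverse>" using that(1) by auto
    then have "t\<inverse> = m" using m_max partial_iso_converse[OF that(2)] by simp
    then show ?thesis by auto
  qed
  have m_max': "t = m" if "m \<subseteq> t" "partial_iso t" for t
    using m_max that by simp
  have left: "\<exists>y. (x, y) \<in> m" for x
    by (rule total[OF m(2) m_max' alg1])
  have right: "\<exists>y. (y, x) \<in> m" for x
    using total[OF partial_iso_converse[OF m(2)] m_conv alg2] by blast
  define \<sigma> where "\<sigma> = (\<lambda>x. SOME y. (x, y) \<in> m)"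
  have \<sigma>: "(x, \<sigma> x) \<in> m" for x
    unfolding \<sigma>_def by (rule someI_ex[OF left])
  have \<sigma>_eq: "\<sigma> x = y" if "(x, y) \<in> m" for x y
    by (rule partial_iso_unique[OF m(2) \<sigma> that])
  have "inj \<sigma>"
    using partial_iso_unique[OF partial_iso_converse[OF m(2)]] \<sigma> by (metis converseI injI)
  moreover have "surj \<sigma>" using right \<sigma>_eq by (metis surjI)
  ultimately have "field_automorphism \<sigma>"
    unfolding field_automorphism_def
    by (auto simp: bij_def intro!: \<sigma>_eq partial_iso_one partial_iso_add partial_iso_mult m(2) \<sigma>)
  then show ?thesis using \<sigma>_eq s0(1) s(1) m(1) by blast
qed

section \<open>Tuples up to automorphisms\<close>

text \<open>Integral polynomials as syntax: one and the same expression can be evaluated at two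
  tuples, and there are countably many expressions. Different expressions for the same polynomial do
  no harm.\<close>

datatype int_expr = Var nat | Num int | Diff int_expr int_expr | Times int_expr int_expr

instance int_expr :: countable by countable_datatype

primrec expr_value :: "(nat \<Rightarrow> complex) \<Rightarrow> int_expr \<Rightarrow> complex" where
  "expr_value a (Var i) = a i"
| "expr_value a (Num z) = of_int z"
| "expr_value a (Diff e e') = expr_value a e - expr_value a e'"
| "expr_value a (Times e e') = expr_value a e * expr_value a e'"

text \<open>Padding with zeros makes the value of every expression depend on the first
  \<open>k\<close> entries only, whatever variables occur in it.\<close>

definition cut_off :: "nat \<Rightarrow> (nat \<Rightarrow> complex) \<Rightarrow> nat \<Rightarrow> complex" where
  "cut_off k a i = (if i < k then a i else 0)"

text \<open>The candidate for an isomorphism between the rings generated by two tuples that matches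
  entries of equal index.\<close>

definition tuple_rel :: "(nat \<Rightarrow> complex) \<Rightarrow> (nat \<Rightarrow> complex) \<Rightarrow> (complex \<times> complex) set" where
  "tuple_rel a b = {(expr_value a e, expr_value b e) | e. True}"

lemma tuple_relI: "(expr_value a e, expr_value b e) \<in> tuple_rel a b"
  by (auto simp: tuple_rel_def)

lemma countable_tuple_rel: "countable (tuple_rel a b)"
proof -
  have "tuple_rel a b = range (\<lambda>e. (expr_value a e, expr_value b e))"
    by (auto simp: tuple_rel_def)
  then show ?thesis by simp
qed

lemma tuple_rel_converse: "(tuple_rel a b)\<inverse> = tuple_rel b a"
  by (auto simp: tuple_rel_def)

lemma partial_iso_tuple_rel:
  assumes "\<And>e. expr_value a e = 0 \<longleftrightarrow> expr_value b e = 0"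
  shows "partial_iso (tuple_rel a b)"
  unfolding partial_iso_def
proof (intro conjI allI impI)
  show "(1, 1) \<in> tuple_rel a b"
    using tuple_relI[of a "Num 1" b] by simp
next
  fix x y u v assume "(x, y) \<in> tuple_rel a b" "(u, v) \<in> tuple_rel a b"
  then obtain e e' where
    "x = expr_value a e" "y = expr_value b e" "u = expr_value a e'" "v = expr_value b e'"
    by (auto simp: tuple_rel_def)
  then show "(x - u, y - v) \<in> tuple_rel a b" "(x * u, y * v) \<in> tuple_rel a b"
    using tuple_relI[of a "Diff e e'" b] tuple_relI[of a "Times e e'" b] by simp_all
next
  fix x y assume "(x, y) \<in> tuple_rel a b"
  then show "x = 0 \<longleftrightarrow> y = 0" using assms by (auto simp: tuple_rel_def)
qed

text \<open>By induction on expressions the relation is contained in \<open>r\<close>, from which it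
  inherits the clause on zeros.\<close>

lemma partial_iso_tuple_rel_subset:
  assumes "partial_iso r" "\<And>i. (a i, b i) \<in> r"
  shows "partial_iso (tuple_rel a b)"
proof (rule partial_iso_tuple_rel)
  fix e
  have nat: "(of_nat m, of_nat m) \<in> r" for m
    by (induction m) (auto intro: partial_iso_zero partial_iso_one partial_iso_add assms(1))
  have "(expr_value a e, expr_value b e) \<in> r"
  proof (induction e)
    case (Num z)
    show ?case
    proof (cases z)
      case (nonneg m)
      then show ?thesis using nat[of m] by simp
    next
      case (neg m)
      then show ?thesis
        using partial_iso_diff[OF assms(1) partial_iso_zero[OF assms(1)] nat[of "Suc m"]] by simp
    qed
  qed (simp_all add: assms partial_iso_diff partial_iso_mult)
  then show "expr_value a e = 0 \<longleftrightarrow> expr_value b e = 0" by (rule partial_iso_0_iff[OF assms(1)])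
qed

text \<open>The coefficients of a minimal polynomial are recorded as integral expressions in the previous
  entries, of which there are only countably many.\<close>

definition is_min_poly :: "(nat \<Rightarrow> complex) \<Rightarrow> complex \<Rightarrow> int_expr list \<Rightarrow> bool" where
  "is_min_poly a x es \<longleftrightarrow> (let m = Poly (map (expr_value a) es) in m \<noteq> 0 \<and> poly m x = 0 \<and>
     (\<forall>g h. poly_rel (tuple_rel a a) g h \<longrightarrow> g \<noteq> 0 \<longrightarrow> poly g x = 0 \<longrightarrow> degree m \<le> degree g))"

text \<open>\<open>None\<close> marks an entry that is transcendental over the previous ones.
  Otherwise a list is chosen arbitrarily among the possible ones; equality of two such codes says
  that a single list of expressions gives minimal polynomials for both tuples.\<close>

definition entry_code :: "(nat \<Rightarrow> complex) \<Rightarrow> nat \<Rightarrow> int_expr list option" where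
  "entry_code a k = (if algebraic_over (tuple_rel (cut_off k a) (cut_off k a)) (a k)
     then Some (SOME es. is_min_poly (cut_off k a) (a k) es) else None)"

lemma partial_iso_tuple_rel_same: "partial_iso (tuple_rel a a)"
  by (rule partial_iso_tuple_rel) simp

lemma poly_rel_tuple_rel_fst: "poly_rel (tuple_rel a b) g h \<Longrightarrow> poly_rel (tuple_rel a a) g g"
  by (force simp: poly_rel_def tuple_rel_def)

lemma algebraic_over_tuple_rel:
  "algebraic_over (tuple_rel a b) x \<Longrightarrow> algebraic_over (tuple_rel a a) x"
  unfolding algebraic_over_def using poly_rel_tuple_rel_fst by blast

lemma entry_code_is_min_poly:
  assumes "entry_code a k = Some es"
  shows "is_min_poly (cut_off k a) (a k) es"
proof -
  let ?a = "cut_off k a"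
  from assms have alg: "algebraic_over (tuple_rel ?a ?a) (a k)"
    and es: "es = (SOME es. is_min_poly ?a (a k) es)"
    by (auto simp: entry_code_def split: if_splits)
  obtain m m' where m: "poly_rel (tuple_rel ?a ?a) m m'" "m \<noteq> 0" "poly m (a k) = 0"
    "\<And>g h. poly_rel (tuple_rel ?a ?a) g h \<Longrightarrow> g \<noteq> 0 \<Longrightarrow> poly g (a k) = 0 \<Longrightarrow> degree m \<le> degree g"
    by (rule minimal_polynomial[OF partial_iso_tuple_rel_same alg]) (rule that)
  have "\<forall>x\<in>set (coeffs m). \<exists>e. expr_value ?a e = x"
  proof
    fix x assume "x \<in> set (coeffs m)"
    then obtain i where "x = coeff m i" using m(2) by (auto simp: coeffs_def)
    then show "\<exists>e. expr_value ?a e = x" using m(1) by (auto simp: poly_rel_def tuple_rel_def) metis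
  qed
  then have "coeffs m \<in> lists (range (expr_value ?a))" by (auto simp: image_iff in_lists_conv_set)
  then obtain fs where "coeffs m = map (expr_value ?a) fs"
    by (auto simp: lists_image)
  then have "m = Poly (map (expr_value ?a) fs)" by (metis Poly_coeffs)
  then have "is_min_poly ?a (a k) fs"
    unfolding is_min_poly_def Let_def using m(2,3,4) by blast
  then show ?thesis unfolding es by (rule someI)
qed

text \<open>Induction along the tuple. A new entry is either transcendental on both sides, or the
  two entries are roots of polynomials obtained from the same expressions, which therefore
  correspond under the isomorphism constructed so far.\<close>

lemma partial_iso_of_entry_code:
  assumes "\<And>k. k < n \<Longrightarrow> entry_code a k = entry_code b k"
  shows "partial_iso (tuple_rel (cut_off n a) (cut_off n b))"
  using assms
proof (induction n)
  case 0
  have "cut_off 0 a = cut_off 0 b" by (simp add: cut_off_def fun_eq_iff)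
  then show ?case using partial_iso_tuple_rel_same by metis
next
  case (Suc k)
  let ?a = "cut_off k a" and ?b = "cut_off k b"
  let ?r = "tuple_rel ?a ?b"
  have r: "partial_iso ?r" by (rule Suc.IH) (simp add: Suc.prems)
  have eq: "entry_code a k = entry_code b k" by (rule Suc.prems) simp
  have adj: "partial_iso (adjoin ?r (a k) (b k))"
  proof (cases "entry_code a k")
    case None
    then have "\<not> algebraic_over (tuple_rel ?a ?a) (a k)" "\<not> algebraic_over (tuple_rel ?b ?b) (b k)"
      using eq by (auto simp: entry_code_def split: if_splits)
    then have "\<not> algebraic_over ?r (a k)" "\<not> algebraic_over (?r\<inverse>) (b k)"
      unfolding tuple_rel_converse using algebraic_over_tuple_rel by blast+
    then show ?thesis by (rule partial_iso_adjoin_transcendental[OF r])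
  next
    case (Some es)
    let ?m = "Poly (map (expr_value ?a) es)" and ?m' = "Poly (map (expr_value ?b) es)"
    have m: "?m \<noteq> 0" "poly ?m (a k) = 0"
      and min: "\<forall>g h. poly_rel (tuple_rel ?a ?a) g h \<longrightarrow> g \<noteq> 0 \<longrightarrow> poly g (a k) = 0 \<longrightarrow> degree ?m \<le> degree g"
      using entry_code_is_min_poly[OF Some] unfolding is_min_poly_def Let_def by simp_all
    have m': "poly ?m' (b k) = 0"
      using entry_code_is_min_poly[of b k es] Some eq unfolding is_min_poly_def Let_def by simp
    \<comment> \<open>\<open>Num 0\<close> supplies the coefficients beyond the end of the
      list.\<close>
    have "coeff ?m i = expr_value ?a (if i < length es then es ! i else Num 0)"
      "coeff ?m' i = expr_value ?b (if i < length es then es ! i else Num 0)" for i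
      by (auto simp: nth_default_def)
    then have rel: "poly_rel ?r ?m ?m'"
      unfolding poly_rel_def using tuple_relI by simp
    show ?thesis
    proof (rule partial_iso_adjoin_algebraic[OF r rel m m'])
      fix g h assume "poly_rel ?r g h" "g \<noteq> 0" "poly g (a k) = 0"
      then show "degree ?m \<le> degree g" using min poly_rel_tuple_rel_fst by blast
    qed
  qed
  show ?case
  proof (rule partial_iso_tuple_rel_subset[OF adj])
    fix i
    consider "i < k" | "i = k" | "i > k" by linarith
    then show "(cut_off (Suc k) a i, cut_off (Suc k) b i) \<in> adjoin ?r (a k) (b k)"
    proof cases
      case 1
      then have "(cut_off (Suc k) a i, cut_off (Suc k) b i) \<in> ?r"
        using tuple_relI[of ?a "Var i" ?b] by (simp add: cut_off_def)
      then show ?thesis using subset_adjoin[OF r] by (rule rev_subsetD)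
    next
      case 2
      then show ?thesis using in_adjoin[OF r] by (simp add: cut_off_def)
    next
      case 3
      then show ?thesis using partial_iso_zero[OF adj] by (simp add: cut_off_def)
    qed
  qed
qed

lemma automorphism_of_tuple_rel:
  assumes "partial_iso (tuple_rel (cut_off n a) (cut_off n b))"
  shows "\<exists>\<sigma>. field_automorphism \<sigma> \<and> (\<forall>i<n. \<sigma> (a i) = b i)"
proof -
  obtain \<sigma> where \<sigma>: "field_automorphism \<sigma>"
    "\<forall>(x, y)\<in>tuple_rel (cut_off n a) (cut_off n b). \<sigma> x = y"
    using extends_to_automorphism[OF assms countable_tuple_rel] by blast
  have "\<sigma> (a i) = b i" if "i < n" for i
    using bspec[OF \<sigma>(2) tuple_relI[of _ "Var i"]] that by (simp add: cut_off_def)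
  with \<sigma>(1) show ?thesis by blast
qed

text \<open>The values of \<open>c\<close> lie in a countable type, which is how countability of the
  set of orbits is expressed.\<close>

lemma countably_many_automorphism_classes:
  "\<exists>c :: (nat \<Rightarrow> complex) \<Rightarrow> int_expr list option list.
     \<forall>a b. c a = c b \<longrightarrow> (\<exists>\<sigma>. field_automorphism \<sigma> \<and> (\<forall>i<n. \<sigma> (a i) = b i))"
proof (intro exI[of _ "\<lambda>a. map (entry_code a) [0..<n]"] allI impI)
  fix a b assume "map (entry_code a) [0..<n] = map (entry_code b) [0..<n]"
  then have "entry_code a k = entry_code b k" if "k < n" for k
    using that by (simp add: map_eq_conv)
  then show "\<exists>\<sigma>. field_automorphism \<sigma> \<and> (\<forall>i<n. \<sigma> (a i) = b i)"
    by (intro automorphism_of_tuple_rel partial_iso_of_entry_code)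
qed

lemma generic_automorphism:
  assumes "\<And>e. expr_value (cut_off n a) e = 0 \<longleftrightarrow> expr_value (cut_off n b) e = 0"
  shows "\<exists>\<sigma>. field_automorphism \<sigma> \<and> (\<forall>i<n. \<sigma> (a i) = b i)"
  by (intro automorphism_of_tuple_rel partial_iso_tuple_rel assms)

section \<open>Adapted bases of filtered complexes\<close>

lemma field_automorphism_add: "field_automorphism \<tau> \<Longrightarrow> \<tau> (x + y) = \<tau> x + \<tau> y"
  and field_automorphism_mult: "field_automorphism \<tau> \<Longrightarrow> \<tau> (x * y) = \<tau> x * \<tau> y"
  and field_automorphism_one: "field_automorphism \<tau> \<Longrightarrow> \<tau> 1 = 1"
  and field_automorphism_bij: "field_automorphism \<tau> \<Longrightarrow> bij \<tau>"
  by (simp_all add: field_automorphism_def)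

lemma field_automorphism_zero: "field_automorphism \<tau> \<Longrightarrow> \<tau> 0 = 0"
  using field_automorphism_add[of \<tau> 0 0] by simp

lemma field_automorphism_eq_0_iff: "field_automorphism \<tau> \<Longrightarrow> \<tau> x = 0 \<longleftrightarrow> x = 0"
  using field_automorphism_zero[of \<tau>] bij_is_inj[OF field_automorphism_bij[of \<tau>]] by (metis injD)

lemma field_automorphism_minus: "field_automorphism \<tau> \<Longrightarrow> \<tau> (- x) = - \<tau> x"
  using field_automorphism_add[of \<tau> x "- x"] field_automorphism_zero[of \<tau>] by (simp add: eq_neg_iff_add_eq_0 add.commute)

lemma field_automorphism_inv:
  assumes "field_automorphism \<tau>"
  shows "field_automorphism (inv_into UNIV \<tau>)"
  unfolding field_automorphism_def
proof (intro conjI allI)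
  note b = field_automorphism_bij[OF assms]
  note [simp] = bij_is_surj[OF b, THEN surj_f_inv_f] bij_is_inj[OF b, THEN inv_f_f]
  show "bij (inv_into UNIV \<tau>)" by (rule bij_imp_bij_inv[OF b])
  show "inv_into UNIV \<tau> 1 = 1" using field_automorphism_one[OF assms] by (metis inv_f_f bij_is_inj b)
  fix x y
  have "\<tau> (inv_into UNIV \<tau> x + inv_into UNIV \<tau> y) = x + y" "\<tau> (inv_into UNIV \<tau> x * inv_into UNIV \<tau> y) = x * y"
    by (simp_all add: field_automorphism_add[OF assms] field_automorphism_mult[OF assms])
  then show "inv_into UNIV \<tau> (x + y) = inv_into UNIV \<tau> x + inv_into UNIV \<tau> y" "inv_into UNIV \<tau> (x * y) = inv_into UNIV \<tau> x * inv_into UNIV \<tau> y"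
    by (metis inv_f_f bij_is_inj b)+
qed

section \<open>Bases adapted to two filtrations\<close>

locale complex_vector_space = vector_space scale
  for scale :: "complex \<Rightarrow> 'w::ab_group_add \<Rightarrow> 'w" (infixr "\<cdot>" 75)
begin

lemma span_chain_Union:
  assumes C: "C \<noteq> {}" "\<And>A B. A \<in> C \<Longrightarrow> B \<in> C \<Longrightarrow> A \<subseteq> B \<or> B \<subseteq> A" and x: "x \<in> span (\<Union>C)"
  shows "\<exists>A\<in>C. x \<in> span A"
  using x
proof (induction rule: span_induct_alt)
  case base
  then show ?case using C(1) span_zero by blast
next
  case (step c b y)
  then obtain A B where "b \<in> A" "A \<in> C" "B \<in> C" "y \<in> span B" by blast
  then obtain D where D: "D \<in> C" "b \<in> D" "y \<in> span D"
    using C(2)[of A B] span_mono by blast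
  then have "c \<cdot> b + y \<in> span D" by (simp add: span_add span_scale span_base)
  then show ?case using D(1) by blast
qed

definition adapted :: "'w set \<Rightarrow> 'w set \<Rightarrow> bool" where
  "adapted U B \<longleftrightarrow> (\<forall>x\<in>span B \<inter> U. x \<in> span (B \<inter> U))"

text \<open>The last condition says that the vectors were chosen in order of increasing \<open>H\<close>-level.\<close>

definition biadapted :: "'w set \<Rightarrow> (int \<Rightarrow> 'w set) \<Rightarrow> (int \<Rightarrow> 'w set) \<Rightarrow> 'w set \<Rightarrow> bool" where
  "biadapted V G H B \<longleftrightarrow> B \<subseteq> V \<and> independent B \<and> (\<forall>j. adapted (G j) B \<and> adapted (H j) B) \<and>
     (\<forall>b\<in>B. \<forall>j. b \<notin> H j \<longrightarrow> H j \<subseteq> span B)"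

lemma adapted_chain_Union:
  assumes C: "C \<noteq> {}" "\<And>A B. A \<in> C \<Longrightarrow> B \<in> C \<Longrightarrow> A \<subseteq> B \<or> B \<subseteq> A" and "\<And>A. A \<in> C \<Longrightarrow> adapted U A"
  shows "adapted U (\<Union>C)"
  unfolding adapted_def
proof
  fix x assume x: "x \<in> span (\<Union>C) \<inter> U"
  then obtain A where A: "A \<in> C" "x \<in> span A" using span_chain_Union[OF C, of x] by blast
  then have "x \<in> span (A \<inter> U)" using assms(3)[OF A(1)] x by (simp add: adapted_def)
  then show "x \<in> span (\<Union>C \<inter> U)" by (rule rev_subsetD) (use A(1) in \<open>blast intro!: span_mono\<close>)
qed

lemma biadapted_chain_Union:
  assumes C: "C \<noteq> {}" "\<And>A B. A \<in> C \<Longrightarrow> B \<in> C \<Longrightarrow> A \<subseteq> B \<or> B \<subseteq> A"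
    and P: "\<And>A. A \<in> C \<Longrightarrow> biadapted V G H A"
  shows "biadapted V G H (\<Union>C)"
  unfolding biadapted_def
proof (intro conjI allI ballI impI)
  show "\<Union>C \<subseteq> V" using P unfolding biadapted_def by blast
  show "independent (\<Union>C)"
    using C(2) P by (intro independent_Union_directed) (auto simp: biadapted_def)
  show "adapted (G j) (\<Union>C)" "adapted (H j) (\<Union>C)" for j
    using P by (intro adapted_chain_Union[OF C]; simp add: biadapted_def)+
next
  fix b j assume "b \<in> \<Union>C" "b \<notin> H j"
  then obtain A where A: "A \<in> C" "b \<in> A" by blast
  then have "H j \<subseteq> span A" using P[OF A(1)] \<open>b \<notin> H j\<close> by (simp add: biadapted_def)
  also have "\<dots> \<subseteq> span (\<Union>C)" using A(1) by (intro span_mono) blast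
  finally show "H j \<subseteq> span (\<Union>C)" .
qed

lemma least_int:
  fixes P :: "int \<Rightarrow> bool"
  assumes "P k" "\<And>j. P j \<Longrightarrow> j > l"
  shows "\<exists>j. P j \<and> (\<forall>i. P i \<longrightarrow> j \<le> i)"
proof -
  define Q where "Q = (\<lambda>m. P (l + int m))"
  have Q: "Q (nat (j - l))" if "P j" for j using that assms(2)[OF that] by (simp add: Q_def)
  define m where "m = (LEAST m. Q m)"
  have "P (l + int m)" using LeastI[of Q, OF Q[OF assms(1)]] by (simp add: Q_def m_def)
  moreover have "l + int m \<le> i" if "P i" for i
    using Least_le[of Q, OF Q[OF that]] assms(2)[OF that] by (simp add: m_def)
  ultimately show ?thesis by blast
qed

text \<open>Only a vector of \<open>U\<close> with a nonzero coefficient at \<open>x\<close> is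
  critical. Then \<open>x\<close> itself lies in \<open>U\<close> by \<open>down\<close>, and
  subtracting its multiple reduces the claim to adaptedness of \<open>B\<close>.\<close>

lemma adapted_insert:
  assumes U: "subspace U" and B: "adapted U B" and xB: "x \<notin> span B"
    and down: "\<And>y b c. y \<in> U \<Longrightarrow> y = b + c \<cdot> x \<Longrightarrow> b \<in> span B \<Longrightarrow> c \<noteq> 0 \<Longrightarrow> x \<in> U"
  shows "adapted U (insert x B)"
  unfolding adapted_def
proof
  fix y assume y: "y \<in> span (insert x B) \<inter> U"
  then obtain c where c: "y - c \<cdot> x \<in> span B" using span_breakdown_eq by blast
  show "y \<in> span (insert x B \<inter> U)"
  proof (cases "c = 0")
    case True
    then have "y \<in> span (B \<inter> U)" using B c y by (simp add: adapted_def)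
    then show ?thesis by (rule rev_subsetD) (intro span_mono, blast)
  next
    case False
    have x: "x \<in> U" using down[of y "y - c \<cdot> x" c] y c False by simp
    then have "y - c \<cdot> x \<in> U" using y U by (auto intro: subspace_diff subspace_scale)
    then have "y - c \<cdot> x \<in> span (B \<inter> U)" using B c by (simp add: adapted_def)
    then have "y - c \<cdot> x \<in> span (insert x B \<inter> U)" by (rule rev_subsetD) (intro span_mono, blast)
    moreover have "c \<cdot> x \<in> span (insert x B \<inter> U)" using x by (intro span_scale span_base) simp
    ultimately have "(y - c \<cdot> x) + c \<cdot> x \<in> span (insert x B \<inter> U)" by (rule span_add)
    then show ?thesis by simp
  qed
qed

definition filters :: "'w set \<Rightarrow> (int \<Rightarrow> 'w set) \<Rightarrow> bool" where
  "filters V F \<longleftrightarrow> (\<forall>j. subspace (F j) \<and> F j \<subseteq> V) \<and> (\<forall>i j. i \<le> j \<longrightarrow> F i \<subseteq> F j) \<and>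
     (\<exists>l. \<forall>j\<le>l. F j = {0}) \<and> (\<forall>x\<in>V. \<exists>j. x \<in> F j)"

lemma filters_subspace: "filters V F \<Longrightarrow> subspace (F j)"
  and filters_subset: "filters V F \<Longrightarrow> F j \<subseteq> V"
  and filters_mono: "filters V F \<Longrightarrow> x \<in> F i \<Longrightarrow> i \<le> j \<Longrightarrow> x \<in> F j"
  and filters_exhaustive: "filters V F \<Longrightarrow> x \<in> V \<Longrightarrow> \<exists>j. x \<in> F j"
  and filters_bounded: "filters V F \<Longrightarrow> \<exists>l. \<forall>j\<le>l. F j = {0}"
  unfolding filters_def by blast+

text \<open>A greedy choice: the new vector lies outside \<open>span B\<close>, at the lowest
  possible \<open>H\<close>-level, and among such candidates at the lowest possible
  \<open>G\<close>-level. Minimality then provides the condition \<open>down\<close> of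
  \<open>adapted_insert\<close> for both filtrations.\<close>

lemma biadapted_insert:
  assumes V: "subspace V" and G: "filters V G" and H: "filters V H"
    and B: "biadapted V G H B" and "\<not> V \<subseteq> span B"
  shows "\<exists>x. x \<notin> B \<and> biadapted V G H (insert x B)"
proof -
  obtain v where v: "v \<in> V" "v \<notin> span B" using assms(5) by blast
  obtain j0 where j0: "v \<in> H j0" using filters_exhaustive[OF H v(1)] by blast
  obtain l where l: "\<And>j. j \<le> l \<Longrightarrow> H j = {0}" using filters_bounded[OF H] by blast
  have "\<not> H j0 \<subseteq> span B" using j0 v by blast
  moreover have "j > l" if "\<not> H j \<subseteq> span B" for j
    using that l[of j] span_zero by (cases "j \<le> l") auto
  ultimately have "\<exists>j. \<not> H j \<subseteq> span B \<and> (\<forall>i. \<not> H i \<subseteq> span B \<longrightarrow> j \<le> i)"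
    by (rule least_int)
  then obtain j where j: "\<not> H j \<subseteq> span B" and j_min: "\<not> H i \<subseteq> span B \<Longrightarrow> j \<le> i" for i
    by blast
  then obtain w where w: "w \<in> H j" "w \<notin> span B" by blast
  have "w \<in> V" using filters_subset[OF H] w(1) by blast
  then obtain k0 where k0: "w \<in> G k0" using filters_exhaustive[OF G] by blast
  obtain l' where l': "\<And>k. k \<le> l' \<Longrightarrow> G k = {0}" using filters_bounded[OF G] by blast
  have "\<not> H j \<inter> G k0 \<subseteq> span B" using k0 w by blast
  moreover have "k > l'" if "\<not> H j \<inter> G k \<subseteq> span B" for k
    using that l'[of k] span_zero by (cases "k \<le> l'") auto
  ultimately have "\<exists>k. \<not> H j \<inter> G k \<subseteq> span B \<and> (\<forall>i. \<not> H j \<inter> G i \<subseteq> span B \<longrightarrow> k \<le> i)"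
    by (rule least_int)
  then obtain k where k: "\<not> H j \<inter> G k \<subseteq> span B"
    and k_min: "\<not> H j \<inter> G i \<subseteq> span B \<Longrightarrow> k \<le> i" for i
    by blast
  then obtain x where x: "x \<in> H j" "x \<in> G k" "x \<notin> span B" by blast
  \<comment> \<open>By the last condition in \<open>biadapted\<close>, a member of \<open>B\<close>
    outside \<open>H j\<close> would put \<open>H j\<close> into \<open>span B\<close>.\<close>
  have BH: "B \<subseteq> H j" using B j unfolding biadapted_def by blast
  have subH: "subspace (H i)" and subG: "subspace (G i)" for i
    using filters_subspace[OF G] filters_subspace[OF H] by blast+
  have spanBH: "span B \<subseteq> H j" by (rule span_minimal[OF BH subH])
  have notin: "b + c \<cdot> x \<notin> span B" if "b \<in> span B" "c \<noteq> 0" for b c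
  proof
    assume "b + c \<cdot> x \<in> span B"
    then have "(b + c \<cdot> x) - b \<in> span B" by (rule span_diff) (rule that)
    then have "c \<cdot> x \<in> span B" by simp
    then have "inverse c \<cdot> (c \<cdot> x) \<in> span B" by (rule span_scale)
    then show False using x(3) that(2) by simp
  qed
  have "adapted (H i) (insert x B)" for i
  proof (rule adapted_insert[OF subH _ x(3)])
    fix y b c assume "y \<in> H i" "y = b + c \<cdot> x" "b \<in> span B" "c \<noteq> 0"
    then have "\<not> H i \<subseteq> span B" using notin by blast
    then have "j \<le> i" by (rule j_min)
    then show "x \<in> H i" by (rule filters_mono[OF H x(1)])
  qed (use B in \<open>simp add: biadapted_def\<close>)
  moreover have "adapted (G i) (insert x B)" for i
  proof (rule adapted_insert[OF subG _ x(3)])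
    fix y b c assume y: "y \<in> G i" "y = b + c \<cdot> x" "b \<in> span B" "c \<noteq> 0"
    \<comment> \<open>As all of \<open>B\<close> lies in \<open>H j\<close>, so does
      \<open>y\<close>; this is what brings in the minimality of \<open>k\<close>, which concerns
      \<open>H j \<inter> G i\<close> only.\<close>
    then have "y \<in> H j" using spanBH x(1) subH by (auto intro: subspace_add subspace_scale)
    then have "\<not> H j \<inter> G i \<subseteq> span B" using notin y by blast
    then have "k \<le> i" by (rule k_min)
    then show "x \<in> G i" by (rule filters_mono[OF G x(2)])
  qed (use B in \<open>simp add: biadapted_def\<close>)
  moreover have "H i \<subseteq> span (insert x B)" if b: "b \<in> insert x B" "b \<notin> H i" for b i
  proof -
    have "H i \<subseteq> span B"
    proof (cases "b = x")
      case True
      then have "\<not> j \<le> i" using b filters_mono[OF H x(1)] by blast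
      then show ?thesis using j_min by blast
    next
      case False
      then show ?thesis using b B by (simp add: biadapted_def)
    qed
    then show ?thesis using span_mono[of B "insert x B"] by blast
  qed
  moreover have "x \<in> V" using filters_subset[OF H] x(1) by blast
  moreover have "independent (insert x B)"
    using B x(3) by (simp add: biadapted_def independent_insertI)
  ultimately have "biadapted V G H (insert x B)"
    using B by (simp add: biadapted_def)
  moreover have "x \<notin> B" using x(3) span_base by blast
  ultimately show ?thesis by blast
qed

text \<open>A maximal biadapted set spans, since \<open>biadapted_insert\<close> could enlarge it
  otherwise. The given start \<open>B\<close> is what later allows a basis of the boundaries to be
  extended to one of the cycles.\<close>

lemma biadapted_basis_extend:
  assumes V: "subspace V" and G: "filters V G" and H: "filters V H" and B: "biadapted V G H B"
  shows "\<exists>B'. B \<subseteq> B' \<and> biadapted V G H B' \<and> span B' = V"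
proof -
  let ?A = "{B'. B \<subseteq> B' \<and> biadapted V G H B'}"
  have "\<exists>M\<in>?A. \<forall>X\<in>?A. M \<subseteq> X \<longrightarrow> X = M"
  proof (rule subset_Zorn_nonempty)
    fix C assume C: "C \<noteq> {}" "subset.chain ?A C"
    then have "biadapted V G H (\<Union>C)"
      by (intro biadapted_chain_Union) (auto simp: subset_chain_def)
    moreover have "B \<subseteq> \<Union>C" using C unfolding subset_chain_def by blast
    ultimately show "\<Union>C \<in> ?A" by blast
  qed (use B in blast)
  then obtain M where M: "M \<in> ?A" "\<forall>X\<in>?A. M \<subseteq> X \<longrightarrow> X = M" by (rule bexE)
  have "V \<subseteq> span M"
  proof (rule ccontr)
    assume "\<not> V \<subseteq> span M"
    then obtain x where x: "x \<notin> M" "biadapted V G H (insert x M)"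
      using biadapted_insert[OF V G H] M(1) by blast
    then have "insert x M = M" using M by (intro M(2)[rule_format]) auto
    then show False using x(1) by blast
  qed
  moreover have "span M \<subseteq> V" using M(1) by (intro span_minimal V) (simp add: biadapted_def)
  ultimately show ?thesis using M(1) by blast
qed

text \<open>A \<open>\<tau>\<close>-semilinear map is a linear map into the same group with scalars
  acting through \<open>\<tau>\<close>, so the theory of linear maps applies.\<close>

lemma semilinear_extend:
  assumes B: "independent B" and \<tau>: "field_automorphism \<tau>"
  shows "\<exists>f. (\<forall>x y. f (x + y) = f x + f y) \<and> (\<forall>c x. f (c \<cdot> x) = \<tau> c \<cdot> f x) \<and> (\<forall>b\<in>B. f b = g b)"
proof -
  have "vector_space (\<lambda>c. scale (\<tau> c))"
    by unfold_locales
      (simp_all add: scale_right_distrib scale_left_distrib field_automorphism_add[OF \<tau>]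
        field_automorphism_mult[OF \<tau>] field_automorphism_one[OF \<tau>])
  then interpret pair: vector_space_pair scale "\<lambda>c. scale (\<tau> c)"
    by (intro vector_space_pair.intro vector_space_axioms)
  obtain f where f: "Vector_Spaces.linear scale (\<lambda>c. scale (\<tau> c)) f" "\<forall>b\<in>B. f b = g b"
    using pair.linear_independent_extend[OF B] by blast
  interpret f: Vector_Spaces.linear scale "\<lambda>c. scale (\<tau> c)" f by (rule f(1))
  show ?thesis using f.add f.scale f(2) by blast
qed

lemma semilinear_span:
  assumes "\<forall>x y. f (x + y) = f x + f y" "\<forall>c x. f (c \<cdot> x) = \<tau> c \<cdot> f x"
    and "subspace U" "\<And>b. b \<in> B \<Longrightarrow> f b \<in> U" "x \<in> span B"
  shows "f x \<in> U"
  using assms(5)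
proof (induction rule: span_induct_alt)
  case base
  have "f 0 + f 0 = f 0" using assms(1)[rule_format, of 0 0] by simp
  then show ?case using subspace_0[OF assms(3)] by simp
next
  case (step c b y)
  then show ?case using assms(1,2,4) by (auto intro!: subspace_add subspace_scale assms(3))
qed

lemma biadapted_empty: "biadapted V G H {}"
  by (auto simp: biadapted_def adapted_def independent_empty span_zero)

end

section \<open>Semilinear automorphisms of a filtered complex of vector spaces\<close>

locale filtered_vector_complex = complex_vector_space scale
  for scale :: "complex \<Rightarrow> 'b::ab_group_add \<Rightarrow> 'b" (infixr "\<cdot>" 75) +
  fixes W :: "int \<Rightarrow> 'b set" and d :: "int \<Rightarrow> 'b \<Rightarrow> 'b" and F :: "int \<Rightarrow> int \<Rightarrow> 'b set"
  assumes W: "subspace (W i)"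
    and d_closed: "x \<in> W i \<Longrightarrow> d i x \<in> W (i + 1)"
    and d_add: "x \<in> W i \<Longrightarrow> y \<in> W i \<Longrightarrow> d i (x + y) = d i x + d i y"
    and d_scale: "x \<in> W i \<Longrightarrow> d i (c \<cdot> x) = c \<cdot> d i x"
    and d_d: "x \<in> W i \<Longrightarrow> d (i + 1) (d i x) = 0"
    and F: "filters (W i) (F i)"
begin

definition ker :: "int \<Rightarrow> 'b set" where
  "ker i = {x \<in> W i. d i x = 0}"

text \<open>The second filtration on the boundaries, pushed forward from the preceding degree; in
  general it differs from the induced one, \<open>F i j \<inter> ims i\<close>.\<close>

definition im :: "int \<Rightarrow> int \<Rightarrow> 'b set" where
  "im i j = d (i - 1) ` F (i - 1) j"

definition ims :: "int \<Rightarrow> 'b set" where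
  "ims i = d (i - 1) ` W (i - 1)"

lemma d_0: "d i 0 = 0"
  using d_add[of 0 i 0] subspace_0[OF W[of i]] by simp

lemma F_subset: "F i j \<subseteq> W i" and F_subspace: "subspace (F i j)"
  and F_mono: "x \<in> F i j \<Longrightarrow> j \<le> k \<Longrightarrow> x \<in> F i k"
  and F_exhaustive: "x \<in> W i \<Longrightarrow> \<exists>j. x \<in> F i j"
  and F_bounded: "\<exists>l. \<forall>j\<le>l. F i j = {0}"
  using filters_subset[OF F] filters_subspace[OF F] filters_mono[OF F] filters_exhaustive[OF F]
    filters_bounded[OF F] by blast+

lemma d_diff: "x \<in> W i \<Longrightarrow> y \<in> W i \<Longrightarrow> d i (x - y) = d i x - d i y"
  using d_add[of x i "(-1) \<cdot> y"] d_scale[of y i "-1"] subspace_scale[OF W[of i], of y "-1"] by simp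

lemma subspace_image: "subspace U \<Longrightarrow> U \<subseteq> W i \<Longrightarrow> subspace (d i ` U)"
proof (rule subspaceI)
  assume U: "subspace U" "U \<subseteq> W i"
  show "0 \<in> d i ` U" using d_0[of i] subspace_0[OF U(1)] by force
  show "x + y \<in> d i ` U" if xy: "x \<in> d i ` U" "y \<in> d i ` U" for x y
  proof -
    obtain a b where ab: "a \<in> U" "b \<in> U" "x = d i a" "y = d i b" using xy by blast
    then have "x + y = d i (a + b)" using U(2) by (simp add: d_add subsetD)
    then show ?thesis using subspace_add[OF U(1) ab(1,2)] by simp
  qed
  show "c \<cdot> x \<in> d i ` U" if x: "x \<in> d i ` U" for x c
  proof -
    obtain a where a: "a \<in> U" "x = d i a" using x by blast
    then have "c \<cdot> x = d i (c \<cdot> a)" using U(2) by (simp add: d_scale subsetD)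
    then show ?thesis using subspace_scale[OF U(1) a(1)] by simp
  qed
qed

lemma ker_subspace: "subspace (ker i)"
  unfolding ker_def using W[of i]
  by (auto intro!: subspaceI simp: subspace_0 subspace_add subspace_scale d_0 d_add d_scale)

lemma ims_subspace: "subspace (ims i)"
  unfolding ims_def by (rule subspace_image[OF W subset_refl])

lemma ims_subset: "ims i \<subseteq> ker i"
  unfolding ims_def ker_def using d_closed[of _ "i - 1"] d_d[of _ "i - 1"] by auto

lemma filters_im: "filters (ims i) (im i)"
  unfolding filters_def
proof (intro conjI allI impI ballI)
  fix j
  show "subspace (im i j)" unfolding im_def by (rule subspace_image[OF F_subspace F_subset])
  show "im i j \<subseteq> ims i" unfolding im_def ims_def using F_subset by blast
next
  fix j k :: int assume "j \<le> k"
  then show "im i j \<subseteq> im i k" unfolding im_def using F_mono by blast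
next
  obtain l where "\<forall>j\<le>l. F (i - 1) j = {0}" using F_bounded by blast
  then show "\<exists>l. \<forall>j\<le>l. im i j = {0}" unfolding im_def by (intro exI[of _ l]) (simp add: d_0)
next
  fix x assume "x \<in> ims i"
  then obtain y where "y \<in> W (i - 1)" "x = d (i - 1) y" by (auto simp: ims_def)
  then show "\<exists>j. x \<in> im i j" using F_exhaustive[of y "i - 1"] by (auto simp: im_def)
qed

lemma filters_restrict:
  assumes "subspace U" "U \<subseteq> W i"
  shows "filters U (\<lambda>j. F i j \<inter> U)"
  unfolding filters_def
proof (intro conjI allI impI ballI)
  fix j
  show "subspace (F i j \<inter> U)" using assms(1) F_subspace by (simp add: subspace_inter)
next
  fix j k :: int assume "j \<le> k"
  then show "F i j \<inter> U \<subseteq> F i k \<inter> U" using F_mono by blast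
next
  obtain l where "\<forall>j\<le>l. F i j = {0}" using F_bounded by blast
  then show "\<exists>l. \<forall>j\<le>l. F i j \<inter> U = {0}"
    using subspace_0[OF assms(1)] by (intro exI[of _ l]) simp
qed (use assms(2) F_exhaustive in auto)

text \<open>\<open>A\<close> controls the lifting of boundaries to the preceding degree, hence is
  adapted to \<open>im\<close>; \<open>K\<close> controls the cycles, hence is adapted to
  \<open>F\<close>. As \<open>A\<close> is part of \<open>K\<close>, one semilinear map fixing
  \<open>K\<close> serves both purposes.\<close>

definition compatible_bases :: "int \<Rightarrow> 'b set \<Rightarrow> 'b set \<Rightarrow> bool" where
  "compatible_bases i A K \<longleftrightarrow> A \<subseteq> K \<and> independent K \<and> span A = ims i \<and> span K = ker i \<and>
     (\<forall>j. F i j \<inter> ker i \<subseteq> span (K \<inter> F i j)) \<and> (\<forall>j. im i j \<subseteq> span (A \<inter> im i j))"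

lemma compatible_bases_exist: "\<exists>A K. compatible_bases i A K"
proof -
  have ims_W: "ims i \<subseteq> W i" using ims_subset by (auto simp: ker_def)
  obtain A where A: "biadapted (ims i) (\<lambda>j. F i j \<inter> ims i) (im i) A" "span A = ims i"
    using biadapted_basis_extend[OF ims_subspace filters_restrict[OF ims_subspace ims_W] filters_im
        biadapted_empty] by blast
  \<comment> \<open>A filtration with a single jump. The extension from \<open>A\<close> to
    \<open>K\<close> has to respect \<open>F\<close> alone, and this trivial second filtration
    brings it into the form of \<open>biadapted_basis_extend\<close>.\<close>
  define H where "H = (\<lambda>j::int. if j \<ge> 0 then ker i else {0})"
  have A': "biadapted (ker i) (\<lambda>j. F i j \<inter> ker i) H A"
    unfolding biadapted_def
  proof (intro conjI allI ballI impI)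
    show "A \<subseteq> ker i" using A(1) ims_subset by (auto simp: biadapted_def)
    show "independent A" using A(1) by (simp add: biadapted_def)
    fix j
    show "adapted (F i j \<inter> ker i) A"
      unfolding adapted_def
    proof
      fix x assume "x \<in> span A \<inter> (F i j \<inter> ker i)"
      \<comment> \<open>\<open>span A\<close> is all of \<open>ims i\<close>, so for its elements it
        is the same to be in level \<open>j\<close> of the boundaries or of the cycles.\<close>
      then have "x \<in> span (A \<inter> (F i j \<inter> ims i))"
        using A by (auto simp: biadapted_def adapted_def)
      also have "\<dots> \<subseteq> span (A \<inter> (F i j \<inter> ker i))"
        by (intro span_mono) (use ims_subset in blast)
      finally show "x \<in> span (A \<inter> (F i j \<inter> ker i))" .
    qed
    show "adapted (H j) A"
      using \<open>A \<subseteq> ker i\<close> by (auto simp: adapted_def H_def span_zero Int_absorb2)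
    fix b assume "b \<in> A" "b \<notin> H j"
    then show "H j \<subseteq> span A" using \<open>A \<subseteq> ker i\<close> by (auto simp: H_def span_zero split: if_splits)
  qed
  have H: "filters (ker i) H"
    unfolding filters_def
  proof (intro conjI allI impI ballI)
    show "subspace (H j)" for j using ker_subspace by (simp add: H_def subspace_single_0)
    show "H j \<subseteq> ker i" for j using subspace_0[OF ker_subspace] by (simp add: H_def)
    show "H j \<subseteq> H k" if "j \<le> k" for j k
      using that subspace_0[OF ker_subspace] by (auto simp: H_def)
    show "\<exists>l. \<forall>j\<le>l. H j = {0}" by (intro exI[of _ "-1"]) (simp add: H_def)
    show "\<exists>j. x \<in> H j" if "x \<in> ker i" for x using that by (intro exI[of _ 0]) (simp add: H_def)
  qed
  have "filters (ker i) (\<lambda>j. F i j \<inter> ker i)"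
    by (rule filters_restrict[OF ker_subspace]) (auto simp: ker_def)
  from biadapted_basis_extend[OF ker_subspace this H A'] obtain K where K: "A \<subseteq> K" "biadapted (ker i) (\<lambda>j. F i j \<inter> ker i) H K" "span K = ker i"
    by blast
  have "F i j \<inter> ker i \<subseteq> span (K \<inter> F i j)" for j
  proof
    fix x assume "x \<in> F i j \<inter> ker i"
    then have "x \<in> span (K \<inter> (F i j \<inter> ker i))"
      using K(2,3) by (auto simp: biadapted_def adapted_def)
    also have "\<dots> \<subseteq> span (K \<inter> F i j)" by (intro span_mono) blast
    finally show "x \<in> span (K \<inter> F i j)" .
  qed
  moreover have "im i j \<subseteq> span (A \<inter> im i j)" for j
    using A filters_subset[OF filters_im, of i j] unfolding biadapted_def adapted_def by blast
  ultimately have "compatible_bases i A K"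
    using K A by (simp add: compatible_bases_def biadapted_def)
  then show ?thesis by blast
qed

text \<open>Linearity is required on the whole ambient space, while the section property concerns
  boundaries only. The last condition refers to \<open>im\<close>: the boundary of a cochain of
  level \<open>j\<close> is lifted back into level \<open>j\<close>.\<close>

definition filtered_section :: "int \<Rightarrow> ('b \<Rightarrow> 'b) \<Rightarrow> bool" where
  "filtered_section i L \<longleftrightarrow> (\<forall>x y. L (x + y) = L x + L y) \<and> (\<forall>c x. L (c \<cdot> x) = c \<cdot> L x) \<and>
     (\<forall>x\<in>ims (i + 1). L x \<in> W i \<and> d i (L x) = x) \<and> (\<forall>j. \<forall>x\<in>im (i + 1) j. L x \<in> F i j)"

lemma filtered_section_exists:
  assumes A: "compatible_bases (i + 1) A K"
  shows "\<exists>L. filtered_section i L"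
proof -
  have indep: "independent A" using A independent_mono by (auto simp: compatible_bases_def)
  have A_ims: "A \<subseteq> ims (i + 1)" using A span_superset[of A] by (auto simp: compatible_bases_def)
  have "\<exists>y. y \<in> W i \<and> d i y = b \<and> (\<forall>j. b \<in> im (i + 1) j \<longrightarrow> y \<in> F i j)" if b: "b \<in> A" for b
  proof -
    \<comment> \<open>The zero vector lies in every level; only a nonzero vector has a lowest
      one.\<close>
    have "b \<noteq> 0" using indep b dependent_zero by blast
    obtain j0 where j0: "b \<in> im (i + 1) j0"
      using filters_exhaustive[OF filters_im] A_ims b by blast
    obtain l where l: "\<forall>j\<le>l. im (i + 1) j = {0}" using filters_bounded[OF filters_im] by blast
    have "j > l" if "b \<in> im (i + 1) j" for j
      using that l \<open>b \<noteq> 0\<close> by (cases "j \<le> l") auto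
    then obtain j where j: "b \<in> im (i + 1) j" "\<forall>k. b \<in> im (i + 1) k \<longrightarrow> j \<le> k"
      using least_int[of "\<lambda>j. b \<in> im (i + 1) j", OF j0] by blast
    \<comment> \<open>A preimage chosen at the lowest level of \<open>b\<close> lies in all the
      higher ones as well.\<close>
    then obtain y where y: "y \<in> F i j" "b = d i y" by (auto simp: im_def)
    have "y \<in> F i k" if "b \<in> im (i + 1) k" for k
      using F_mono[OF y(1)] j(2) that by blast
    then show ?thesis using y F_subset[of i j] by blast
  qed
  then obtain l where l: "\<forall>b\<in>A. l b \<in> W i \<and> d i (l b) = b \<and> (\<forall>j. b \<in> im (i + 1) j \<longrightarrow> l b \<in> F i j)"
    by metis
  \<comment> \<open>For the identity automorphism \<open>semilinear_extend\<close> yields an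
    ordinary linear map.\<close>
  have "field_automorphism (\<lambda>c. c)" by (auto simp: field_automorphism_def intro: bijI')
  from semilinear_extend[OF indep this] obtain L where
    L: "\<forall>x y. L (x + y) = L x + L y" "\<forall>c x. L (c \<cdot> x) = c \<cdot> L x" "\<forall>b\<in>A. L b = l b" by blast
  have LW: "L x \<in> W i" if "x \<in> ims (i + 1)" for x
    by (rule semilinear_span[OF L(1,2) W, of A]) (use that A L(3) l in \<open>auto simp: compatible_bases_def\<close>)
  have "subspace {x \<in> ims (i + 1). d i (L x) = x}"
  proof (rule subspaceI)
    have "L 0 = 0" using L(2)[rule_format, of 0 0] by simp
    then show "0 \<in> {x \<in> ims (i + 1). d i (L x) = x}"
      using subspace_0[OF ims_subspace] d_0 by simp
  qed (use LW in \<open>auto simp: L(1,2)[rule_format] d_add d_scale ims_subspace subspace_add subspace_scale\<close>)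
  then have "span A \<subseteq> {x \<in> ims (i + 1). d i (L x) = x}"
    by (rule span_minimal[rotated]) (use A_ims L(3) l in auto)
  then have dL: "d i (L x) = x" if "x \<in> ims (i + 1)" for x
    using A that by (auto simp: compatible_bases_def)
  have LF: "L x \<in> F i j" if "x \<in> im (i + 1) j" for x j
  proof (rule semilinear_span[OF L(1,2) F_subspace, of "A \<inter> im (i + 1) j"])
    show "x \<in> span (A \<inter> im (i + 1) j)" using A that by (auto simp: compatible_bases_def)
  qed (use L(3) l in auto)
  have "filtered_section i L"
    unfolding filtered_section_def using L(1,2) LW dL LF by (intro conjI) blast+
  then show ?thesis by blast
qed

definition semilinear_map :: "(complex \<Rightarrow> complex) \<Rightarrow> (int \<Rightarrow> 'b \<Rightarrow> 'b) \<Rightarrow> bool" where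
  "semilinear_map \<tau> f \<longleftrightarrow> (\<forall>i. \<forall>x\<in>W i. f i x \<in> W i \<and> (\<forall>y\<in>W i. f i (x + y) = f i x + f i y) \<and>
     (\<forall>c. f i (c \<cdot> x) = \<tau> c \<cdot> f i x) \<and> f (i + 1) (d i x) = d i (f i x) \<and>
     (\<forall>j. x \<in> F i j \<longrightarrow> f i x \<in> F i j))"

context
  fixes A K L
  assumes AK: "\<And>i. compatible_bases i (A i) (K i)" and L: "\<And>i. filtered_section i (L i)"
begin

text \<open>On the cycles this is the action of \<open>\<tau>\<close> on the coordinates with
  respect to \<open>K i\<close>; elsewhere only semilinearity is prescribed.\<close>

definition basis_map :: "(complex \<Rightarrow> complex) \<Rightarrow> (int \<Rightarrow> 'b \<Rightarrow> 'b) \<Rightarrow> bool" where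
  "basis_map \<tau> g \<longleftrightarrow> (\<forall>i x y. g i (x + y) = g i x + g i y) \<and> (\<forall>i c x. g i (c \<cdot> x) = \<tau> c \<cdot> g i x) \<and>
     (\<forall>i. \<forall>b\<in>K i. g i b = b)"

text \<open>Every cochain is the sum of the cycle \<open>x - L i (d i x)\<close> and the lift
  \<open>L i (d i x)\<close> of its boundary. The map \<open>g\<close> acts on the cycle directly
  and on the lift through the boundary, which makes the result commute with
  \<open>d\<close>.\<close>

definition extended_map :: "(int \<Rightarrow> 'b \<Rightarrow> 'b) \<Rightarrow> int \<Rightarrow> 'b \<Rightarrow> 'b" where
  "extended_map g i x = g i (x - L i (d i x)) + L i (g (i + 1) (d i x))"

lemma basis_map_exists:
  assumes "field_automorphism \<tau>"
  shows "\<exists>g. basis_map \<tau> g"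
proof -
  have "\<forall>i. \<exists>f. (\<forall>x y. f (x + y) = f x + f y) \<and> (\<forall>c x. f (c \<cdot> x) = \<tau> c \<cdot> f x) \<and> (\<forall>b\<in>K i. f b = b)"
    using semilinear_extend[OF _ assms] AK by (simp add: compatible_bases_def)
  from choice[OF this] show ?thesis unfolding basis_map_def by blast
qed

lemma basis_map_span:
  assumes "basis_map \<tau> g" "B \<subseteq> K i" "x \<in> span B"
  shows "g i x \<in> span B"
  by (rule semilinear_span[of "g i" \<tau>, OF _ _ subspace_span _ assms(3)])
    (use assms(1,2) span_base in \<open>auto simp: basis_map_def\<close>)

lemma basis_map_ims: "basis_map \<tau> g \<Longrightarrow> x \<in> ims i \<Longrightarrow> g i x \<in> ims i"
  using basis_map_span[of \<tau> g "A i" i x] AK[of i] by (simp add: compatible_bases_def)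

lemma basis_map_ker: "basis_map \<tau> g \<Longrightarrow> x \<in> ker i \<Longrightarrow> g i x \<in> ker i"
  using basis_map_span[of \<tau> g "K i" i x] AK[of i] by (simp add: compatible_bases_def)

lemma basis_map_im:
  assumes "basis_map \<tau> g" "x \<in> im i j"
  shows "g i x \<in> im i j"
proof -
  have "x \<in> span (A i \<inter> im i j)" using AK[of i] assms(2) by (auto simp: compatible_bases_def)
  then have "g i x \<in> span (A i \<inter> im i j)"
    by (rule basis_map_span[OF assms(1), rotated]) (use AK[of i] in \<open>auto simp: compatible_bases_def\<close>)
  also have "\<dots> \<subseteq> im i j" by (intro span_minimal filters_subspace[OF filters_im]) simp
  finally show ?thesis .
qed

lemma basis_map_F:
  assumes "basis_map \<tau> g" "x \<in> F i j" "x \<in> ker i"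
  shows "g i x \<in> F i j"
proof -
  have "x \<in> span (K i \<inter> F i j)" using AK[of i] assms(2,3) by (auto simp: compatible_bases_def)
  then have "g i x \<in> span (K i \<inter> F i j)"
    by (rule basis_map_span[OF assms(1), rotated]) auto
  also have "\<dots> \<subseteq> F i j" by (intro span_minimal F_subspace) auto
  finally show ?thesis .
qed

lemma basis_map_inverse:
  assumes g: "basis_map \<tau> g" "basis_map \<tau>' g'" and \<tau>: "\<And>c. \<tau>' (\<tau> c) = c" and x: "x \<in> ker i"
  shows "g' i (g i x) = x"
proof -
  have "x \<in> span (K i)" using AK[of i] x by (simp add: compatible_bases_def)
  then show ?thesis
  proof (induction rule: span_induct_alt)
    case base
    have "g i 0 = 0" "g' i 0 = 0" using g unfolding basis_map_def by (metis add_cancel_right_right)+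
    then show ?case by simp
  next
    case (step c b y)
    then show ?case using g \<tau> by (simp add: basis_map_def)
  qed
qed

lemma L_props: "L i (x + y) = L i x + L i y" "L i (c \<cdot> x) = c \<cdot> L i x"
    "x \<in> ims (i + 1) \<Longrightarrow> L i x \<in> W i" "x \<in> ims (i + 1) \<Longrightarrow> d i (L i x) = x"
    "x \<in> im (i + 1) j \<Longrightarrow> L i x \<in> F i j"
  using L[of i] by (auto simp: filtered_section_def)

lemma d_ims: "x \<in> W i \<Longrightarrow> d i x \<in> ims (i + 1)"
  by (auto simp: ims_def)

lemma d_im: "x \<in> F i j \<Longrightarrow> d i x \<in> im (i + 1) j"
  by (auto simp: im_def)

lemma rest_ker: "x \<in> W i \<Longrightarrow> x - L i (d i x) \<in> ker i"
  using L_props(3,4)[OF d_ims] by (simp add: ker_def d_diff subspace_diff[OF W])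

lemma extended_map_props:
  assumes g: "basis_map \<tau> g" and x: "x \<in> W i"
  shows "extended_map g i x \<in> W i" "d i (extended_map g i x) = g (i + 1) (d i x)"
    "extended_map g i x - L i (d i (extended_map g i x)) = g i (x - L i (d i x))"
proof -
  have 1: "g i (x - L i (d i x)) \<in> ker i" by (rule basis_map_ker[OF g rest_ker[OF x]])
  have 2: "g (i + 1) (d i x) \<in> ims (i + 1)" by (rule basis_map_ims[OF g d_ims[OF x]])
  show "extended_map g i x \<in> W i"
    unfolding extended_map_def using 1 L_props(3)[OF 2] by (simp add: ker_def subspace_add[OF W])
  show 3: "d i (extended_map g i x) = g (i + 1) (d i x)"
    unfolding extended_map_def using 1 L_props(3,4)[OF 2] by (simp add: ker_def d_add)
  show "extended_map g i x - L i (d i (extended_map g i x)) = g i (x - L i (d i x))"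
    unfolding 3 by (simp add: extended_map_def)
qed

lemma semilinear_map_extended_map:
  assumes \<tau>: "field_automorphism \<tau>" and g: "basis_map \<tau> g"
  shows "semilinear_map \<tau> (extended_map g)"
  unfolding semilinear_map_def
proof (intro allI ballI conjI impI)
  fix i x assume x: "x \<in> W i"
  note gs = g[unfolded basis_map_def]
  have L_diff: "L i (x - y) = L i x - L i y" for x y
    using L_props(1)[of i x "(-1) \<cdot> y"] L_props(2)[of i "-1" y] by simp
  have g_add: "g k (x + y) = g k x + g k y" for k x y using gs by blast
  have g_scale: "g k (c \<cdot> x) = \<tau> c \<cdot> g k x" for k c x using gs by blast
  show "extended_map g i x \<in> W i" by (rule extended_map_props[OF g x])
  show "extended_map g i (x + y) = extended_map g i x + extended_map g i y" if y: "y \<in> W i" for y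
  proof -
    have "x + y - L i (d i (x + y)) = (x - L i (d i x)) + (y - L i (d i y))"
      by (simp add: d_add[OF x y] L_props(1))
    then show ?thesis
      unfolding extended_map_def by (simp only: g_add d_add[OF x y] L_props(1) ac_simps)
  qed
  show "extended_map g i (c \<cdot> x) = \<tau> c \<cdot> extended_map g i x" for c
  proof -
    have "c \<cdot> x - L i (d i (c \<cdot> x)) = c \<cdot> (x - L i (d i x))"
      by (simp add: d_scale[OF x] L_props(2) scale_right_diff_distrib)
    then show ?thesis
      by (simp add: extended_map_def g_scale d_scale[OF x] L_props(2) scale_right_distrib)
  qed
  have L0: "L k 0 = 0" for k using L_props(2)[of k 0 0] by simp
  have g0: "g k 0 = 0" for k using g_scale[of k 0 0] field_automorphism_zero[OF \<tau>] by simp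
  show "extended_map g (i + 1) (d i x) = d i (extended_map g i x)"
    unfolding extended_map_props(2)[OF g x] using d_d[OF x] by (simp add: extended_map_def L0 g0)
  show "extended_map g i x \<in> F i j" if xF: "x \<in> F i j" for j
  proof -
    \<comment> \<open>Since \<open>L\<close> is filtered, the lift and with it the cycle part of
      \<open>x\<close> lie in level \<open>j\<close>; adaptedness of \<open>K\<close> and
      \<open>A\<close> keeps the images of both there.\<close>
    have "x - L i (d i x) \<in> F i j"
      using L_props(5)[OF d_im[OF xF]] xF by (intro subspace_diff[OF F_subspace])
    then have "g i (x - L i (d i x)) \<in> F i j" by (rule basis_map_F[OF g _ rest_ker[OF x]])
    moreover have "L i (g (i + 1) (d i x)) \<in> F i j"
      by (rule L_props(5)[OF basis_map_im[OF g d_im[OF xF]]])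
    ultimately show ?thesis unfolding extended_map_def by (rule subspace_add[OF F_subspace])
  qed
qed

text \<open>The cycle part and the boundary of \<open>extended_map g i x\<close> are the images
  under \<open>g\<close> of those of \<open>x\<close>, so it suffices that the basis maps are
  inverse to each other on cycles.\<close>

lemma extended_map_inverse:
  assumes g: "basis_map \<tau> g" "basis_map \<tau>' g'" and \<tau>: "\<And>c. \<tau>' (\<tau> c) = c" and x: "x \<in> W i"
  shows "extended_map g' i (extended_map g i x) = x"
proof -
  have "extended_map g' i (extended_map g i x) = g' i (g i (x - L i (d i x))) + L i (g' (i + 1) (g (i + 1) (d i x)))"
    using extended_map_props(2,3)[OF g(1) x] by (subst extended_map_def) simp
  also have "\<dots> = x"
    using basis_map_inverse[OF g \<tau> rest_ker[OF x]]
      basis_map_inverse[OF g \<tau> subsetD[OF ims_subset d_ims[OF x]]] by simp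
  finally show ?thesis .
qed

end

theorem semilinear_automorphism:
  assumes \<tau>: "field_automorphism \<tau>"
  shows "\<exists>f f'. semilinear_map \<tau> f \<and> semilinear_map (inv_into UNIV \<tau>) f' \<and>
    (\<forall>i. \<forall>x\<in>W i. f' i (f i x) = x \<and> f i (f' i x) = x)"
proof -
  let ?\<tau>' = "inv_into UNIV \<tau>"
  have \<tau>': "field_automorphism ?\<tau>'" by (rule field_automorphism_inv[OF \<tau>])
  have inverse: "?\<tau>' (\<tau> c) = c" "\<tau> (?\<tau>' c) = c" for c
    using field_automorphism_bij[OF \<tau>] by (auto simp: bij_def surj_f_inv_f)
  have "\<forall>i. \<exists>p. compatible_bases i (fst p) (snd p)" using compatible_bases_exist by simp
  then obtain p where p: "\<And>i. compatible_bases i (fst (p i)) (snd (p i))" by metis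
  have "\<forall>i. \<exists>L. filtered_section i L" using filtered_section_exists[OF p] by blast
  then obtain L where L: "\<And>i. filtered_section i (L i)" by metis
  obtain g g' where g: "basis_map (\<lambda>i. snd (p i)) \<tau> g" "basis_map (\<lambda>i. snd (p i)) ?\<tau>' g'"
    using basis_map_exists[OF p L \<tau>] basis_map_exists[OF p L \<tau>'] by blast
  show ?thesis
    using semilinear_map_extended_map[OF p L \<tau> g(1)] semilinear_map_extended_map[OF p L \<tau>' g(2)]
      extended_map_inverse[OF p L g inverse(1)] extended_map_inverse[OF p L g(2,1) inverse(2)]
    by blast
qed

end

section \<open>Semilinear isomorphisms of filtered complexes\<close>

definition semilinear_cochain_map ::
    "(complex \<Rightarrow> complex) \<Rightarrow> 'a filtered_complex \<Rightarrow> 'c filtered_complex \<Rightarrow> (int \<Rightarrow> 'a \<Rightarrow> 'c) \<Rightarrow> bool" where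
  "semilinear_cochain_map \<tau> C C' f \<longleftrightarrow> (\<forall>i. \<forall>x\<in>carrier (cochains C i).
     f i x \<in> carrier (cochains C' i) \<and>
     (\<forall>y\<in>carrier (cochains C i). f i (x \<oplus>\<^bsub>cochains C i\<^esub> y) = f i x \<oplus>\<^bsub>cochains C' i\<^esub> f i y) \<and>
     (\<forall>c. f i (c \<odot>\<^bsub>cochains C i\<^esub> x) = \<tau> c \<odot>\<^bsub>cochains C' i\<^esub> f i x) \<and>
     f (i + 1) (differential C i x) = differential C' i (f i x) \<and>
     (\<forall>j. x \<in> filtration C i j \<longrightarrow> f i x \<in> filtration C' i j))"

lemma semilinear_cochain_mapD:
  assumes "semilinear_cochain_map \<tau> C C' f" "x \<in> carrier (cochains C i)"
  shows "f i x \<in> carrier (cochains C' i)"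
    "y \<in> carrier (cochains C i) \<Longrightarrow> f i (x \<oplus>\<^bsub>cochains C i\<^esub> y) = f i x \<oplus>\<^bsub>cochains C' i\<^esub> f i y"
    "f i (c \<odot>\<^bsub>cochains C i\<^esub> x) = \<tau> c \<odot>\<^bsub>cochains C' i\<^esub> f i x"
    "f (i + 1) (differential C i x) = differential C' i (f i x)"
    "x \<in> filtration C i j \<Longrightarrow> f i x \<in> filtration C' i j"
  using assms unfolding semilinear_cochain_map_def by blast+

lemma semilinear_cochain_map_comp:
  assumes f: "semilinear_cochain_map \<tau> C C' f" and g: "semilinear_cochain_map \<tau>' C' C'' g"
  shows "semilinear_cochain_map (\<lambda>c. \<tau>' (\<tau> c)) C C'' (\<lambda>i x. g i (f i x))"
  unfolding semilinear_cochain_map_def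
  using semilinear_cochain_mapD[OF f] semilinear_cochain_mapD[OF g] by simp

text \<open>A complex whose cochains are classes, described by vectors: \<open>\<kappa> i\<close>
  sends a representative in \<open>Z i\<close> to its class, and \<open>N i\<close> tells which
  representatives are identified. The differential lives on representatives and squares to zero
  there. This moves the linear algebra from module records to a type with addition.\<close>

locale presented_complex = complex_vector_space scale
  for scale :: "complex \<Rightarrow> 'b::ab_group_add \<Rightarrow> 'b" (infixr "\<cdot>" 75) +
  fixes C :: "'a filtered_complex" and Z N :: "int \<Rightarrow> 'b set" and D :: "int \<Rightarrow> 'b \<Rightarrow> 'b"
    and F :: "int \<Rightarrow> int \<Rightarrow> 'b set" and \<kappa> :: "int \<Rightarrow> 'b \<Rightarrow> 'a"
  assumes Z: "subspace (Z i)" and N: "subspace (N i)"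
    and carrier_eq: "carrier (cochains C i) = \<kappa> i ` Z i"
    and \<kappa>_add: "x \<in> Z i \<Longrightarrow> y \<in> Z i \<Longrightarrow> \<kappa> i (x + y) = \<kappa> i x \<oplus>\<^bsub>cochains C i\<^esub> \<kappa> i y"
    and \<kappa>_scale: "x \<in> Z i \<Longrightarrow> \<kappa> i (c \<cdot> x) = c \<odot>\<^bsub>cochains C i\<^esub> \<kappa> i x"
    and \<kappa>_eq_iff: "x \<in> Z i \<Longrightarrow> y \<in> Z i \<Longrightarrow> \<kappa> i x = \<kappa> i y \<longleftrightarrow> x - y \<in> N i"
    and D_closed: "x \<in> Z i \<Longrightarrow> D i x \<in> Z (i + 1)"
    and D_add: "x \<in> Z i \<Longrightarrow> y \<in> Z i \<Longrightarrow> D i (x + y) = D i x + D i y"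
    and D_scale: "x \<in> Z i \<Longrightarrow> D i (c \<cdot> x) = c \<cdot> D i x"
    and D_N: "x \<in> Z i \<Longrightarrow> x \<in> N i \<Longrightarrow> D i x \<in> N (i + 1)"
    and D_D: "x \<in> Z i \<Longrightarrow> D (i + 1) (D i x) = 0"
    and differential_eq: "x \<in> Z i \<Longrightarrow> differential C i (\<kappa> i x) = \<kappa> (i + 1) (D i x)"
    and filters_F: "filters (Z i) (F i)"
    and filtration_eq: "filtration C i j = \<kappa> i ` F i j"
begin

lemma F_subset: "F i j \<subseteq> Z i"
  by (rule filters_subset[OF filters_F])

lemma Z_0: "0 \<in> Z i" by (rule subspace_0[OF Z])

lemma D_0: "D i 0 = 0"
  using D_add[OF Z_0 Z_0, of i] by simp

lemma D_diff: "x \<in> Z i \<Longrightarrow> y \<in> Z i \<Longrightarrow> D i (x - y) = D i x - D i y"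
  using D_add[of x i "(-1) \<cdot> y"] D_scale[of y i "-1"] subspace_scale[OF Z[of i], of y "-1"] by simp

text \<open>The quotient by \<open>N i\<close> is realized inside the ambient space: for a linear
  projection \<open>g\<close> onto \<open>N i\<close>, the map \<open>x - g x\<close> has kernel
  exactly \<open>N i\<close>. Classes thus become vectors, to which
  \<open>filtered_vector_complex\<close> applies.\<close>

lemma projection_exists:
  "\<exists>\<rho>. (\<forall>x y. \<rho> (x + y) = \<rho> x + \<rho> y) \<and> (\<forall>c x. \<rho> (c \<cdot> x) = c \<cdot> \<rho> x) \<and> (\<forall>x. \<rho> x = 0 \<longleftrightarrow> x \<in> N i)"
proof -
  interpret pair: vector_space_pair scale scale
    by (intro vector_space_pair.intro vector_space_axioms)
  have "Vector_Spaces.linear scale scale (\<lambda>x. x)" by (rule linear_ident)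
  then obtain g where g: "g ` UNIV \<subseteq> N i" "Vector_Spaces.linear scale scale g" "\<forall>v\<in>N i. g v = v"
    using pair.linear_exists_left_inverse_on[of "\<lambda>x. x" "N i"] N[of i] by auto
  interpret g: Vector_Spaces.linear scale scale g by (rule g(2))
  have "x - g x = 0 \<longleftrightarrow> x \<in> N i" for x
    using g(1,3) by (metis eq_iff_diff_eq_0 rangeI subsetD)
  moreover have "x + y - g (x + y) = (x - g x) + (y - g y)" for x y
    by (simp add: g.add)
  moreover have "c \<cdot> x - g (c \<cdot> x) = c \<cdot> (x - g x)" for c x
    by (simp add: g.scale scale_right_diff_distrib)
  ultimately show ?thesis by (intro exI[of _ "\<lambda>x. x - g x"]) simp
qed

definition \<rho> :: "int \<Rightarrow> 'b \<Rightarrow> 'b" where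
  "\<rho> i = (SOME \<rho>. (\<forall>x y. \<rho> (x + y) = \<rho> x + \<rho> y) \<and> (\<forall>c x. \<rho> (c \<cdot> x) = c \<cdot> \<rho> x) \<and>
     (\<forall>x. \<rho> x = 0 \<longleftrightarrow> x \<in> N i))"

lemma \<rho>_add: "\<rho> i (x + y) = \<rho> i x + \<rho> i y" and \<rho>_scale: "\<rho> i (c \<cdot> x) = c \<cdot> \<rho> i x"
  and \<rho>_eq_0_iff: "\<rho> i x = 0 \<longleftrightarrow> x \<in> N i"
  using someI_ex[OF projection_exists[of i]] unfolding \<rho>_def[symmetric] by blast+

lemma \<rho>_diff: "\<rho> i (x - y) = \<rho> i x - \<rho> i y"
  using \<rho>_add[of i x "(-1) \<cdot> y"] \<rho>_scale[of i "-1" y] by simp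

lemma \<rho>_eq_iff: "\<rho> i x = \<rho> i y \<longleftrightarrow> x - y \<in> N i"
  using \<rho>_diff[of i x y] \<rho>_eq_0_iff[of i "x - y"] by simp

lemma \<rho>_eq_iff_\<kappa>: "x \<in> Z i \<Longrightarrow> y \<in> Z i \<Longrightarrow> \<rho> i x = \<rho> i y \<longleftrightarrow> \<kappa> i x = \<kappa> i y"
  by (simp add: \<rho>_eq_iff \<kappa>_eq_iff)

definition lift :: "int \<Rightarrow> 'b \<Rightarrow> 'b" where
  "lift i w = (SOME z. z \<in> Z i \<and> \<rho> i z = w)"

lemma lift: "w \<in> \<rho> i ` Z i \<Longrightarrow> lift i w \<in> Z i" "w \<in> \<rho> i ` Z i \<Longrightarrow> \<rho> i (lift i w) = w"
proof -
  assume "w \<in> \<rho> i ` Z i"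
  then have "\<exists>z. z \<in> Z i \<and> \<rho> i z = w" by blast
  from someI_ex[OF this] show "lift i w \<in> Z i" "\<rho> i (lift i w) = w"
    unfolding lift_def by simp_all
qed

definition d :: "int \<Rightarrow> 'b \<Rightarrow> 'b" where
  "d i w = \<rho> (i + 1) (D i (lift i w))"

lemma d_\<rho>: "z \<in> Z i \<Longrightarrow> d i (\<rho> i z) = \<rho> (i + 1) (D i z)"
proof -
  assume z: "z \<in> Z i"
  have l: "lift i (\<rho> i z) \<in> Z i" "\<rho> i (lift i (\<rho> i z)) = \<rho> i z" using lift z by blast+
  then have "lift i (\<rho> i z) - z \<in> N i" by (simp add: \<rho>_eq_iff)
  moreover have "lift i (\<rho> i z) - z \<in> Z i" by (rule subspace_diff[OF Z l(1) z])
  ultimately have "D i (lift i (\<rho> i z) - z) \<in> N (i + 1)" by (intro D_N)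
  then show ?thesis by (simp add: d_def \<rho>_eq_iff D_diff[OF l(1) z])
qed

lemma \<rho>_subspace: "subspace U \<Longrightarrow> subspace (\<rho> i ` U)"
proof (rule subspaceI)
  assume U: "subspace U"
  have "\<rho> i 0 = 0" using subspace_0[OF N] by (simp add: \<rho>_eq_0_iff)
  then show "0 \<in> \<rho> i ` U" using subspace_0[OF U] by force
  show "x + y \<in> \<rho> i ` U" if "x \<in> \<rho> i ` U" "y \<in> \<rho> i ` U" for x y
    using that by (auto simp: \<rho>_add[symmetric] intro!: imageI subspace_add[OF U])
  show "c \<cdot> x \<in> \<rho> i ` U" if "x \<in> \<rho> i ` U" for c x
    using that by (auto simp: \<rho>_scale[symmetric] intro!: imageI subspace_scale[OF U])
qed

sublocale reduced: filtered_vector_complex scale "\<lambda>i. \<rho> i ` Z i" d "\<lambda>i j. \<rho> i ` F i j"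
proof
  fix i :: int
  show "subspace (\<rho> i ` Z i)" by (rule \<rho>_subspace[OF Z])
  show "filters (\<rho> i ` Z i) (\<lambda>j. \<rho> i ` F i j)"
    unfolding filters_def
  proof (intro conjI allI impI ballI)
    fix j show "subspace (\<rho> i ` F i j)" by (rule \<rho>_subspace[OF filters_subspace[OF filters_F]])
    show "\<rho> i ` F i j \<subseteq> \<rho> i ` Z i" by (rule image_mono[OF F_subset])
  next
    fix j k :: int assume "j \<le> k"
    then show "\<rho> i ` F i j \<subseteq> \<rho> i ` F i k" using filters_mono[OF filters_F] by blast
  next
    have "\<rho> i 0 = 0" using subspace_0[OF N] by (simp add: \<rho>_eq_0_iff)
    moreover obtain l where "\<forall>j\<le>l. F i j = {0}" using filters_bounded[OF filters_F] by blast
    ultimately show "\<exists>l. \<forall>j\<le>l. \<rho> i ` F i j = {0}" by (intro exI[of _ l]) simp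
  next
    fix x assume "x \<in> \<rho> i ` Z i"
    then obtain z where z: "z \<in> Z i" "x = \<rho> i z" by blast
    obtain j where "z \<in> F i j" using filters_exhaustive[OF filters_F z(1)] by blast
    then show "\<exists>j. x \<in> \<rho> i ` F i j" using z(2) by blast
  qed
next
  fix x i assume "x \<in> \<rho> i ` Z i"
  then obtain z where z: "z \<in> Z i" "x = \<rho> i z" by blast
  show "d i x \<in> \<rho> (i + 1) ` Z (i + 1)" unfolding z(2) d_\<rho>[OF z(1)] using D_closed[OF z(1)] by blast
  show "d (i + 1) (d i x) = 0"
    unfolding z(2) d_\<rho>[OF z(1)] d_\<rho>[OF D_closed[OF z(1)]] D_D[OF z(1)]
    using subspace_0[OF N] by (simp add: \<rho>_eq_0_iff)
  show "d i (c \<cdot> x) = c \<cdot> d i x" for c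
    using d_\<rho>[OF subspace_scale[OF Z z(1)], of c]
    by (simp add: z(2) d_\<rho>[OF z(1)] \<rho>_scale D_scale[OF z(1)])
next
  fix x i y assume "x \<in> \<rho> i ` Z i" "y \<in> \<rho> i ` Z i"
  then obtain z w where z: "z \<in> Z i" "x = \<rho> i z" "w \<in> Z i" "y = \<rho> i w" by blast
  show "d i (x + y) = d i x + d i y"
    using d_\<rho>[OF subspace_add[OF Z z(1,3)]]
    by (simp add: z(2,4) d_\<rho>[OF z(1)] d_\<rho>[OF z(3)] \<rho>_add D_add[OF z(1,3)])
qed

definition rep :: "int \<Rightarrow> 'a \<Rightarrow> 'b" where
  "rep i x = (SOME z. z \<in> Z i \<and> \<kappa> i z = x)"

lemma rep: "x \<in> carrier (cochains C i) \<Longrightarrow> rep i x \<in> Z i"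
    "x \<in> carrier (cochains C i) \<Longrightarrow> \<kappa> i (rep i x) = x"
proof -
  assume "x \<in> carrier (cochains C i)"
  then have "\<exists>z. z \<in> Z i \<and> \<kappa> i z = x" unfolding carrier_eq by blast
  from someI_ex[OF this] show "rep i x \<in> Z i" "\<kappa> i (rep i x) = x"
    unfolding rep_def by simp_all
qed

lemma rep_\<kappa>: "z \<in> Z i \<Longrightarrow> rep i (\<kappa> i z) - z \<in> N i"
  using rep[of "\<kappa> i z" i] by (simp add: carrier_eq \<kappa>_eq_iff)

lemma carrierE:
  assumes "x \<in> carrier (cochains C i)" obtains z where "z \<in> Z i" "x = \<kappa> i z"
  using assms unfolding carrier_eq by blast

lemma filtration_subset: "filtration C i j \<subseteq> carrier (cochains C i)"
  unfolding filtration_eq carrier_eq by (rule image_mono[OF F_subset])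

text \<open>Carries a map of the reduced complex back to the original cochains by way of
  representatives; \<open>transport_\<kappa>\<close> shows that their choice does not
  matter.\<close>

definition transport :: "(int \<Rightarrow> 'b \<Rightarrow> 'b) \<Rightarrow> int \<Rightarrow> 'a \<Rightarrow> 'a" where
  "transport f i x = \<kappa> i (lift i (f i (\<rho> i (rep i x))))"

lemma \<rho>_rep: "z \<in> Z i \<Longrightarrow> \<rho> i (rep i (\<kappa> i z)) = \<rho> i z"
  using rep_\<kappa> by (simp add: \<rho>_eq_iff)

lemma transport_\<kappa>:
  assumes f: "reduced.semilinear_map \<tau> f" and z: "z \<in> Z i" "w \<in> Z i" "\<rho> i w = f i (\<rho> i z)"
  shows "transport f i (\<kappa> i z) = \<kappa> i w"
proof -
  have "f i (\<rho> i z) \<in> \<rho> i ` Z i" unfolding z(3)[symmetric] using z(2) by (rule imageI)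
  note l = lift[OF this]
  have "\<kappa> i (lift i (f i (\<rho> i z))) = \<kappa> i w"
    using l(2) z(3) \<rho>_eq_iff_\<kappa>[OF l(1) z(2)] by simp
  then show ?thesis unfolding transport_def \<rho>_rep[OF z(1)] .
qed

lemma semilinear_map_lift:
  assumes f: "reduced.semilinear_map \<tau> f" and z: "z \<in> Z i"
  shows "\<exists>w\<in>Z i. \<rho> i w = f i (\<rho> i z)"
  using f z unfolding reduced.semilinear_map_def by (metis imageE imageI)

lemma semilinear_cochain_map_transport:
  assumes f: "reduced.semilinear_map \<tau> f"
  shows "semilinear_cochain_map \<tau> C C (transport f)"
  unfolding semilinear_cochain_map_def
proof (intro allI ballI conjI impI)
  fix i x assume "x \<in> carrier (cochains C i)"
  then obtain z where z: "z \<in> Z i" "x = \<kappa> i z" by (rule carrierE)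
  obtain w where w: "w \<in> Z i" "\<rho> i w = f i (\<rho> i z)" using semilinear_map_lift[OF f z(1)] by blast
  note tz = transport_\<kappa>[OF f z(1) w]
  note fs = f[unfolded reduced.semilinear_map_def, rule_format, OF imageI[OF z(1)]]
  show "transport f i x \<in> carrier (cochains C i)"
    unfolding z(2) tz carrier_eq using w(1) by blast
  show "transport f i (c \<odot>\<^bsub>cochains C i\<^esub> x) = \<tau> c \<odot>\<^bsub>cochains C i\<^esub> transport f i x" for c
  proof -
    have "transport f i (\<kappa> i (c \<cdot> z)) = \<kappa> i (\<tau> c \<cdot> w)"
      using fs by (intro transport_\<kappa>[OF f] subspace_scale[OF Z] z(1) w(1)) (simp add: \<rho>_scale w(2))
    then show ?thesis using z w(1) tz by (simp add: \<kappa>_scale)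
  qed
  show "transport f (i + 1) (differential C i x) = differential C i (transport f i x)"
  proof -
    have "transport f (i + 1) (\<kappa> (i + 1) (D i z)) = \<kappa> (i + 1) (D i w)"
    proof (rule transport_\<kappa>[OF f D_closed[OF z(1)] D_closed[OF w(1)]])
      have "\<rho> (i + 1) (D i w) = d i (f i (\<rho> i z))" using d_\<rho>[OF w(1)] w(2) by simp
      also have "\<dots> = f (i + 1) (\<rho> (i + 1) (D i z))" using fs d_\<rho>[OF z(1)] by simp
      finally show "\<rho> (i + 1) (D i w) = f (i + 1) (\<rho> (i + 1) (D i z))" .
    qed
    then show ?thesis using z w(1) tz by (simp add: differential_eq)
  qed
  show "transport f i (x \<oplus>\<^bsub>cochains C i\<^esub> y) = transport f i x \<oplus>\<^bsub>cochains C i\<^esub> transport f i y"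
    if "y \<in> carrier (cochains C i)" for y
  proof -
    from that obtain z' where z': "z' \<in> Z i" "y = \<kappa> i z'" by (rule carrierE)
    obtain w' where w': "w' \<in> Z i" "\<rho> i w' = f i (\<rho> i z')" using semilinear_map_lift[OF f z'(1)] by blast
    have "transport f i (\<kappa> i (z + z')) = \<kappa> i (w + w')"
      using fs z'(1)
      by (intro transport_\<kappa>[OF f] subspace_add[OF Z] z(1) w(1) z'(1) w'(1)) (simp add: \<rho>_add w(2) w'(2))
    then show ?thesis using z w(1) tz z' w'(1) transport_\<kappa>[OF f z'(1) w'] by (simp add: \<kappa>_add)
  qed
  show "transport f i x \<in> filtration C i j" if xF: "x \<in> filtration C i j" for j
  proof -
    from xF obtain u where u: "u \<in> F i j" "x = \<kappa> i u" unfolding filtration_eq by blast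
    have uZ: "u \<in> Z i" using u(1) F_subset by blast
    have "f i (\<rho> i u) \<in> \<rho> i ` F i j"
      using f[unfolded reduced.semilinear_map_def, rule_format, OF imageI[OF uZ]] u(1) by blast
    then obtain v where v: "v \<in> F i j" "\<rho> i v = f i (\<rho> i u)" by (metis imageE)
    have "v \<in> Z i" using v(1) F_subset by blast
    from transport_\<kappa>[OF f uZ this v(2)] show ?thesis unfolding u(2) filtration_eq using v(1) by simp
  qed
qed

lemma semilinear_self_map:
  assumes \<tau>: "field_automorphism \<tau>"
  shows "\<exists>f f'. semilinear_cochain_map \<tau> C C f \<and> semilinear_cochain_map (inv_into UNIV \<tau>) C C f' \<and>
    (\<forall>i. \<forall>x\<in>carrier (cochains C i). f' i (f i x) = x \<and> f i (f' i x) = x)"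
proof -
  obtain f f' where f: "reduced.semilinear_map \<tau> f" "reduced.semilinear_map (inv_into UNIV \<tau>) f'"
    "\<forall>i. \<forall>x\<in>\<rho> i ` Z i. f' i (f i x) = x \<and> f i (f' i x) = x"
    using reduced.semilinear_automorphism[OF \<tau>] by blast
  have inverse: "transport h' i (transport h i x) = x"
    if h: "reduced.semilinear_map t h" "reduced.semilinear_map t' h'"
      and inv: "\<forall>x\<in>\<rho> i ` Z i. h' i (h i x) = x" and x: "x \<in> carrier (cochains C i)" for t t' h h' i x
  proof -
    obtain z where z: "z \<in> Z i" "x = \<kappa> i z" using x by (rule carrierE)
    obtain w where w: "w \<in> Z i" "\<rho> i w = h i (\<rho> i z)" using semilinear_map_lift[OF h(1) z(1)] by blast
    have "\<rho> i z = h' i (\<rho> i w)" using w(2) inv z(1) by simp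
    then have "transport h' i (\<kappa> i w) = \<kappa> i z" by (rule transport_\<kappa>[OF h(2) w(1) z(1)])
    then show ?thesis using transport_\<kappa>[OF h(1) z(1) w] z(2) by simp
  qed
  show ?thesis
    using semilinear_cochain_map_transport[OF f(1)] semilinear_cochain_map_transport[OF f(2)]
      inverse[OF f(1,2)] inverse[OF f(2,1)] f(3)
    by (intro exI[of _ "transport f"] exI[of _ "transport f'"]) blast
qed

lemma filtered_homotopic_identity:
  assumes "\<And>i x. x \<in> carrier (cochains C i) \<Longrightarrow> f i x = x"
  shows "filtered_homotopic C C f (\<lambda>i x. x)"
  unfolding filtered_homotopic_def
\<comment> \<open>The cochains are known through \<open>\<kappa>\<close> only, so the zero homotopy
  is written as the class of 0.\<close>
proof (intro bexI[of _ "\<lambda>i x. \<kappa> (i - 1) 0"] allI ballI)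
  fix i x assume "x \<in> carrier (cochains C i)"
  then obtain z where z: "z \<in> Z i" "x = \<kappa> i z" by (rule carrierE)
  have "differential C (i - 1) (\<kappa> (i - 1) 0) = \<kappa> i 0"
    using differential_eq[OF Z_0, of "i - 1"] D_0 by simp
  then show "f i x = x \<oplus>\<^bsub>cochains C i\<^esub> (differential C (i - 1) (\<kappa> (i - 1) 0) \<oplus>\<^bsub>cochains C i\<^esub> \<kappa> (i + 1 - 1) 0)"
    using assms[OF \<open>x \<in> carrier (cochains C i)\<close>] \<kappa>_add[OF Z_0 Z_0, of i] \<kappa>_add[OF z(1) Z_0] z(2) by simp
next
  show "(\<lambda>i x. \<kappa> (i - 1) 0) \<in> filtered_maps C C (- 1)"
    unfolding filtered_maps_def linear_maps_def
    using \<kappa>_add[OF Z_0 Z_0] \<kappa>_scale[OF Z_0] Z_0 subspace_0[OF filters_subspace[OF filters_F]]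
    by (auto simp: carrier_eq filtration_eq)
qed

end

section \<open>Filtered isomorphisms and homotopy equivalences\<close>

lemma filtered_cochain_maps_semilinear:
  assumes f: "semilinear_cochain_map (\<lambda>c. c) C C' f"
    and filt: "\<And>i j. filtration C i j \<subseteq> carrier (cochains C i)"
  shows "f \<in> filtered_cochain_maps C C'"
proof -
  have "f i ` filtration C i j \<subseteq> filtration C' i j" for i j
    using semilinear_cochain_mapD(5)[OF f] subsetD[OF filt] by (simp add: image_subset_iff)
  then show ?thesis
    unfolding filtered_cochain_maps_def filtered_maps_def linear_maps_def
    using semilinear_cochain_mapD(1-4)[OF f] by simp
qed

definition filtered_isomorphic :: "'a filtered_complex \<Rightarrow> 'c filtered_complex \<Rightarrow> bool" where
  "filtered_isomorphic C C' \<longleftrightarrow> (\<exists>f g.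
     semilinear_cochain_map (\<lambda>c. c) C C' f \<and> semilinear_cochain_map (\<lambda>c. c) C' C g \<and>
     (\<forall>i. \<forall>x\<in>carrier (cochains C i). g i (f i x) = x) \<and>
     (\<forall>i. \<forall>x\<in>carrier (cochains C' i). f i (g i x) = x))"

lemma homotopy_equivalent_of_isomorphic:
  assumes C: "presented_complex scale C Z N D F \<kappa>" and C': "presented_complex scale C' Z' N' D' F' \<kappa>'"
    and "filtered_isomorphic C C'"
  shows "filtered_homotopy_equivalent C C'"
proof -
  obtain f g where f: "semilinear_cochain_map (\<lambda>c. c) C C' f" and g: "semilinear_cochain_map (\<lambda>c. c) C' C g"
    and gf: "\<forall>i. \<forall>x\<in>carrier (cochains C i). g i (f i x) = x"
    and fg: "\<forall>i. \<forall>x\<in>carrier (cochains C' i). f i (g i x) = x"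
    using assms(3) unfolding filtered_isomorphic_def by blast
  show ?thesis
    unfolding filtered_homotopy_equivalent_def
  proof (intro bexI[of _ f] bexI[of _ g] conjI)
    show "f \<in> filtered_cochain_maps C C'" "g \<in> filtered_cochain_maps C' C"
      by (intro filtered_cochain_maps_semilinear f g presented_complex.filtration_subset[OF C]
          presented_complex.filtration_subset[OF C'])+
    show "filtered_homotopic C C (\<lambda>i. g i \<circ> f i) (\<lambda>i x. x)"
      by (rule presented_complex.filtered_homotopic_identity[OF C]) (simp add: gf)
    show "filtered_homotopic C' C' (\<lambda>i. f i \<circ> g i) (\<lambda>i x. x)"
      by (rule presented_complex.filtered_homotopic_identity[OF C']) (simp add: fg)
  qed
qed

lemma filtered_maps_comp:
  "f \<in> filtered_maps C C' 0 \<Longrightarrow> g \<in> filtered_maps C' C'' s \<Longrightarrow> (\<lambda>i x. g i (f i x)) \<in> filtered_maps C C'' s"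
  "f \<in> filtered_maps C C' s \<Longrightarrow> g \<in> filtered_maps C' C'' 0 \<Longrightarrow> (\<lambda>i x. g (i + s) (f i x)) \<in> filtered_maps C C'' s"
  unfolding filtered_maps_def linear_maps_def
  by (auto simp: Pi_iff image_subset_iff; blast)+

lemma filtered_mapsD:
  assumes "f \<in> filtered_maps C C' s" "x \<in> carrier (cochains C i)"
  shows "f i x \<in> carrier (cochains C' (i + s))"
    "y \<in> carrier (cochains C i) \<Longrightarrow> f i (x \<oplus>\<^bsub>cochains C i\<^esub> y) = f i x \<oplus>\<^bsub>cochains C' (i + s)\<^esub> f i y"
  using assms by (auto simp: filtered_maps_def linear_maps_def Pi_iff)

text \<open>Used to pass from one member of a class to another: the complexes \<open>E\<close> that
  are homotopy equivalent to a given one stay the same when the latter is replaced by an isomorphic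
  one. The maps are composed with the isomorphism, and the homotopy is conjugated by it.\<close>

lemma homotopy_equivalent_transfer:
  assumes C: "presented_complex scale C Z N D F \<kappa>" and C': "presented_complex scale C' Z' N' D' F' \<kappa>'"
    and iso: "filtered_isomorphic C C'" and E: "filtered_homotopy_equivalent C E"
  shows "filtered_homotopy_equivalent C' E"
proof -
  interpret C: presented_complex scale C Z N D F \<kappa> by (rule C)
  interpret C': presented_complex scale C' Z' N' D' F' \<kappa>' by (rule C')
  obtain u v where u: "semilinear_cochain_map (\<lambda>c. c) C C' u" and v: "semilinear_cochain_map (\<lambda>c. c) C' C v"
    and vu: "\<forall>i. \<forall>x\<in>carrier (cochains C i). v i (u i x) = x"
    and uv: "\<forall>i. \<forall>x\<in>carrier (cochains C' i). u i (v i x) = x"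
    using iso unfolding filtered_isomorphic_def by blast
  note um = filtered_cochain_maps_semilinear[OF u C.filtration_subset]
  note vm = filtered_cochain_maps_semilinear[OF v C'.filtration_subset]
  have uf: "u \<in> filtered_maps C C' 0" and vf: "v \<in> filtered_maps C' C 0"
    using um vm by (simp_all add: filtered_cochain_maps_def)
  obtain f g where f: "f \<in> filtered_cochain_maps C E" and g: "g \<in> filtered_cochain_maps E C"
    and gf: "filtered_homotopic C C (\<lambda>i. g i \<circ> f i) (\<lambda>i x. x)"
    and fg: "filtered_homotopic E E (\<lambda>i. f i \<circ> g i) (\<lambda>i x. x)"
    using E unfolding filtered_homotopy_equivalent_def by blast
  have ff: "f \<in> filtered_maps C E 0" and gf': "g \<in> filtered_maps E C 0"
    using f g by (simp_all add: filtered_cochain_maps_def)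
  have f_d: "f (i + 1) (differential C i x) = differential E i (f i x)" if "x \<in> carrier (cochains C i)" for i x
    using f that by (simp add: filtered_cochain_maps_def)
  have g_d: "g (i + 1) (differential E i x) = differential C i (g i x)" if "x \<in> carrier (cochains E i)" for i x
    using g that by (simp add: filtered_cochain_maps_def)
  have u_carr: "u i x \<in> carrier (cochains C' i)" if "x \<in> carrier (cochains C i)" for i x
    by (rule semilinear_cochain_mapD(1)[OF u that])
  have v_carr: "v i x \<in> carrier (cochains C i)" if "x \<in> carrier (cochains C' i)" for i x
    by (rule semilinear_cochain_mapD(1)[OF v that])
  have g_carr: "g i x \<in> carrier (cochains C i)" if "x \<in> carrier (cochains E i)" for i x
    using filtered_mapsD(1)[OF gf' that] by simp
  have d_carr: "differential C i x \<in> carrier (cochains C (i + 1))" if "x \<in> carrier (cochains C i)" for i x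
    using that by (rule C.carrierE) (auto simp: C.differential_eq C.carrier_eq intro: C.D_closed)
  define f' where "f' = (\<lambda>i x. f i (v i x))"
  define g' where "g' = (\<lambda>i x. u i (g i x))"
  have f': "f' \<in> filtered_cochain_maps C' E"
    using filtered_maps_comp(1)[OF vf ff] f_d[OF v_carr] semilinear_cochain_mapD(4)[OF v]
    by (simp add: filtered_cochain_maps_def f'_def)
  have g': "g' \<in> filtered_cochain_maps E C'"
    using filtered_maps_comp(1)[OF gf' uf] g_d semilinear_cochain_mapD(4)[OF u g_carr]
    by (simp add: filtered_cochain_maps_def g'_def)
  have "filtered_homotopic E E (\<lambda>i. f' i \<circ> g' i) (\<lambda>i x. x)"
    using fg vu g_carr unfolding filtered_homotopic_def by (simp add: f'_def g'_def)
  moreover have "filtered_homotopic C' C' (\<lambda>i. g' i \<circ> f' i) (\<lambda>i x. x)"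
  proof -
    obtain h where h: "h \<in> filtered_maps C C (- 1)" and h_eq: "\<forall>i. \<forall>x\<in>carrier (cochains C i).
        (g i \<circ> f i) x = x \<oplus>\<^bsub>cochains C i\<^esub> (differential C (i - 1) (h i x) \<oplus>\<^bsub>cochains C i\<^esub> h (i + 1) (differential C i x))"
      using gf unfolding filtered_homotopic_def by blast
    \<comment> \<open>The homotopy on \<open>C'\<close> is \<open>v\<close> followed by
      \<open>h\<close> and \<open>u\<close>, where \<open>u\<close> is taken in the target degree
      \<open>i + - 1\<close> of \<open>h\<close>.\<close>
    have k: "(\<lambda>i x. u (i + - 1) (h i (v i x))) \<in> filtered_maps C' C' (- 1)"
      by (rule filtered_maps_comp(2)[OF filtered_maps_comp(1)[OF vf h] uf])
    show ?thesis
      unfolding filtered_homotopic_def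
    proof (intro bexI[OF _ k] allI ballI)
      fix i x assume x: "x \<in> carrier (cochains C' i)"
      let ?y = "v i x"
      have y: "?y \<in> carrier (cochains C i)" by (rule v_carr[OF x])
      have hy: "h i ?y \<in> carrier (cochains C (i - 1))" using filtered_mapsD(1)[OF h y] by simp
      have dhy: "differential C (i - 1) (h i ?y) \<in> carrier (cochains C i)" using d_carr[OF hy] by simp
      have hdy: "h (i + 1) (differential C i ?y) \<in> carrier (cochains C i)"
        using filtered_mapsD(1)[OF h d_carr[OF y]] by simp
      have sum: "differential C (i - 1) (h i ?y) \<oplus>\<^bsub>cochains C i\<^esub> h (i + 1) (differential C i ?y) \<in> carrier (cochains C i)"
        using dhy hdy unfolding C.carrier_eq
        by (auto simp: C.\<kappa>_add[symmetric] intro!: imageI C.subspace_add[OF C.Z])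
      have "(g' i \<circ> f' i) x = u i (?y \<oplus>\<^bsub>cochains C i\<^esub>
          (differential C (i - 1) (h i ?y) \<oplus>\<^bsub>cochains C i\<^esub> h (i + 1) (differential C i ?y)))"
        using h_eq y by (simp add: f'_def g'_def)
      also have "\<dots> = u i ?y \<oplus>\<^bsub>cochains C' i\<^esub> (u i (differential C (i - 1) (h i ?y)) \<oplus>\<^bsub>cochains C' i\<^esub>
          u i (h (i + 1) (differential C i ?y)))"
        by (simp only: semilinear_cochain_mapD(2)[OF u y sum] semilinear_cochain_mapD(2)[OF u dhy hdy])
      also have "u i ?y = x" using uv x by blast
      also have "u i (differential C (i - 1) (h i ?y)) = differential C' (i - 1) (u (i - 1) (h i ?y))"
        using semilinear_cochain_mapD(4)[OF u hy] by simp
      also have "differential C i ?y = v (i + 1) (differential C' i x)"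
        using semilinear_cochain_mapD(4)[OF v x] by simp
      finally show "(g' i \<circ> f' i) x = x \<oplus>\<^bsub>cochains C' i\<^esub>
          (differential C' (i - 1) (u (i + - 1) (h i (v i x))) \<oplus>\<^bsub>cochains C' i\<^esub>
            u (i + 1 + - 1) (h (i + 1) (v (i + 1) (differential C' i x))))"
        by simp
    qed
  qed
  ultimately show ?thesis
    unfolding filtered_homotopy_equivalent_def using f' g' by blast
qed

text \<open>A single map \<open>s\<close> of representatives, the same in all degrees, descends to
  classes because it respects the subspaces \<open>N i\<close>.\<close>

lemma semilinear_cochain_map_induced:
  assumes C: "presented_complex scale C Z N D F \<kappa>" and C': "presented_complex scale C' Z' N' D' F' \<kappa>'"
    and s: "\<And>i x. x \<in> Z i \<Longrightarrow> s x \<in> Z' i" "\<And>i x. x \<in> N i \<Longrightarrow> s x \<in> N' i"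
      "\<And>i j x. x \<in> F i j \<Longrightarrow> s x \<in> F' i j"
    and s_add: "\<And>x y. s (x + y) = s x + s y" and s_scale: "\<And>c x. s (scale c x) = scale (\<tau> c) (s x)"
    and s_D: "\<And>i x. x \<in> Z i \<Longrightarrow> s (D i x) = D' i (s x)"
  shows "\<exists>f. semilinear_cochain_map \<tau> C C' f \<and> (\<forall>i. \<forall>z\<in>Z i. f i (\<kappa> i z) = \<kappa>' i (s z))"
proof -
  interpret C: presented_complex scale C Z N D F \<kappa> by (rule C)
  interpret C': presented_complex scale C' Z' N' D' F' \<kappa>' by (rule C')
  define f where "f = (\<lambda>i x. \<kappa>' i (s (C.rep i x)))"
  have s_diff: "s (x - y) = s x - s y" for x y using s_add[of "x - y" y] by (simp add: algebra_simps)
  have f: "f i (\<kappa> i z) = \<kappa>' i (s z)" if z: "z \<in> Z i" for i z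
  proof -
    have "C.rep i (\<kappa> i z) \<in> Z i" using C.rep(1) z by (simp add: C.carrier_eq)
    then show ?thesis
      using s(2)[OF C.rep_\<kappa>[OF z]] s(1) z by (simp add: f_def C'.\<kappa>_eq_iff s_diff)
  qed
  have "semilinear_cochain_map \<tau> C C' f"
    unfolding semilinear_cochain_map_def
  proof (intro allI ballI conjI impI)
    fix i x assume "x \<in> carrier (cochains C i)"
    then obtain z where z: "z \<in> Z i" "x = \<kappa> i z" by (rule C.carrierE)
    show "f i x \<in> carrier (cochains C' i)" using f[OF z(1)] z s(1) by (simp add: C'.carrier_eq)
    show "f i (c \<odot>\<^bsub>cochains C i\<^esub> x) = \<tau> c \<odot>\<^bsub>cochains C' i\<^esub> f i x" for c
      using f[OF C.subspace_scale[OF C.Z z(1)], of c] f[OF z(1)] z s(1)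
      by (simp add: C.\<kappa>_scale C'.\<kappa>_scale s_scale)
    show "f (i + 1) (differential C i x) = differential C' i (f i x)"
      using f[OF C.D_closed[OF z(1)]] f[OF z(1)] z s(1)
      by (simp add: C.differential_eq C'.differential_eq s_D)
    show "f i (x \<oplus>\<^bsub>cochains C i\<^esub> y) = f i x \<oplus>\<^bsub>cochains C' i\<^esub> f i y"
      if "y \<in> carrier (cochains C i)" for y
    proof -
      from that obtain w where w: "w \<in> Z i" "y = \<kappa> i w" by (rule C.carrierE)
      show ?thesis
        using f[OF C.subspace_add[OF C.Z z(1) w(1)]] f[OF z(1)] f[OF w(1)] z w s(1)
        by (simp add: C.\<kappa>_add C'.\<kappa>_add s_add)
    qed
    show "f i x \<in> filtration C' i j" if "x \<in> filtration C i j" for j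
    proof -
      from that obtain u where u: "u \<in> F i j" "x = \<kappa> i u" unfolding C.filtration_eq by blast
      have "u \<in> Z i" using u(1) C.F_subset by blast
      then show ?thesis using f s(3)[OF u(1)] u(2) by (simp add: C'.filtration_eq)
    qed
  qed
  with f show ?thesis by blast
qed

text \<open>The self-map of \<open>C\<close> for the inverse of \<open>\<tau>\<close> is applied
  before the map induced by \<open>s\<close>, so that the composite is linear. Its inverse is the
  map induced by \<open>s'\<close> followed by the self-map for \<open>\<tau>\<close>.\<close>

theorem isomorphic_of_semilinear:
  assumes C: "presented_complex scale C Z N D F \<kappa>" and C': "presented_complex scale C' Z' N' D' F' \<kappa>'"
    and \<tau>: "field_automorphism \<tau>"
    and s: "\<And>i x. x \<in> Z i \<Longrightarrow> s x \<in> Z' i" "\<And>i x. x \<in> N i \<Longrightarrow> s x \<in> N' i"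
      "\<And>i j x. x \<in> F i j \<Longrightarrow> s x \<in> F' i j"
      "\<And>x y. s (x + y) = s x + s y" "\<And>c x. s (scale c x) = scale (\<tau> c) (s x)"
      "\<And>i x. x \<in> Z i \<Longrightarrow> s (D i x) = D' i (s x)"
    and s': "\<And>i x. x \<in> Z' i \<Longrightarrow> s' x \<in> Z i" "\<And>i x. x \<in> N' i \<Longrightarrow> s' x \<in> N i"
      "\<And>i j x. x \<in> F' i j \<Longrightarrow> s' x \<in> F i j"
      "\<And>x y. s' (x + y) = s' x + s' y" "\<And>c x. s' (scale c x) = scale (inv_into UNIV \<tau> c) (s' x)"
      "\<And>i x. x \<in> Z' i \<Longrightarrow> s' (D' i x) = D i (s' x)"
    and s's: "\<And>x. s' (s x) = x" and ss': "\<And>x. s (s' x) = x"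
  shows "filtered_isomorphic C C'"
proof -
  interpret C: presented_complex scale C Z N D F \<kappa> by (rule C)
  interpret C': presented_complex scale C' Z' N' D' F' \<kappa>' by (rule C')
  let ?\<tau>' = "inv_into UNIV \<tau>"
  have inverse: "?\<tau>' (\<tau> c) = c" "\<tau> (?\<tau>' c) = c" for c
    using field_automorphism_bij[OF \<tau>] by (auto simp: bij_def surj_f_inv_f)
  obtain f where f: "semilinear_cochain_map \<tau> C C' f" "\<forall>i. \<forall>z\<in>Z i. f i (\<kappa> i z) = \<kappa>' i (s z)"
    using semilinear_cochain_map_induced[where s = s and \<tau> = \<tau>, OF C C' s] by blast
  obtain f' where f': "semilinear_cochain_map ?\<tau>' C' C f'" "\<forall>i. \<forall>z\<in>Z' i. f' i (\<kappa>' i z) = \<kappa> i (s' z)"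
    using semilinear_cochain_map_induced[where s = s' and \<tau> = ?\<tau>', OF C' C s'] by blast
  obtain g g' where g: "semilinear_cochain_map \<tau> C C g" "semilinear_cochain_map ?\<tau>' C C g'"
    "\<forall>i. \<forall>x\<in>carrier (cochains C i). g' i (g i x) = x \<and> g i (g' i x) = x"
    using C.semilinear_self_map[OF \<tau>] by blast
  have f'f: "f' i (f i x) = x" if x: "x \<in> carrier (cochains C i)" for i x
    using x by (rule C.carrierE) (simp add: f(2) f'(2) s(1) s's)
  have ff': "f i (f' i x) = x" if x: "x \<in> carrier (cochains C' i)" for i x
    using x by (rule C'.carrierE) (simp add: f(2) f'(2) s'(1) ss')
  have "semilinear_cochain_map (\<lambda>c. c) C C' (\<lambda>i x. f i (g' i x))"
    using semilinear_cochain_map_comp[OF g(2) f(1)] by (simp add: inverse)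
  moreover have "semilinear_cochain_map (\<lambda>c. c) C' C (\<lambda>i x. g i (f' i x))"
    using semilinear_cochain_map_comp[OF f'(1) g(1)] by (simp add: inverse)
  moreover have "g i (f' i (f i (g' i x))) = x" if x: "x \<in> carrier (cochains C i)" for i x
    using f'f[OF semilinear_cochain_mapD(1)[OF g(2) x]] g(3) x by simp
  moreover have "f i (g' i (g i (f' i x))) = x" if x: "x \<in> carrier (cochains C' i)" for i x
    using ff'[OF x] g(3) semilinear_cochain_mapD(1)[OF f'(1) x] by simp
  ultimately show ?thesis unfolding filtered_isomorphic_def by blast
qed

section \<open>Polynomials in several variables\<close>

text \<open>Common ground for evaluation, substitution and conjugation of coefficients, whose
  structure maps are the identity, \<open>Const\<close>, and \<open>Const\<close> after a field
  automorphism.\<close>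

definition coeff_hom :: "(complex \<Rightarrow> 'a::comm_ring_1) \<Rightarrow> bool" where
  "coeff_hom \<iota> \<longleftrightarrow> \<iota> 0 = 0 \<and> \<iota> 1 = 1 \<and> (\<forall>x y. \<iota> (x + y) = \<iota> x + \<iota> y) \<and> (\<forall>x y. \<iota> (x * y) = \<iota> x * \<iota> y)"

lemma coeff_homD:
  assumes "coeff_hom \<iota>"
  shows "\<iota> 0 = 0" "\<iota> 1 = 1" "\<iota> (x + y) = \<iota> x + \<iota> y" "\<iota> (x * y) = \<iota> x * \<iota> y"
  using assms by (simp_all add: coeff_hom_def)

lemma mpoly_value_superset:
  assumes "\<iota> 0 = 0" "finite A" "Poly_Mapping.keys f \<subseteq> A"
  shows "mpoly_value \<iota> a f = (\<Sum>m\<in>A. \<iota> (Poly_Mapping.lookup f m) * monomial_value a m)"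
  unfolding mpoly_value_def
  by (rule sum.mono_neutral_left) (use assms in \<open>auto simp: in_keys_iff\<close>)

lemma monomial_value_zero [simp]: "monomial_value a 0 = 1"
  by (simp add: monomial_value_def)

context
  fixes \<iota> :: "complex \<Rightarrow> 'a::comm_ring_1" assumes \<iota>: "coeff_hom \<iota>"
begin

lemma mpoly_value_zero: "mpoly_value \<iota> a 0 = 0"
  by (simp add: mpoly_value_def)

lemma mpoly_value_single: "mpoly_value \<iota> a (Poly_Mapping.single m c) = \<iota> c * monomial_value a m"
  by (cases "c = 0") (simp_all add: mpoly_value_def coeff_homD(1)[OF \<iota>])

lemma mpoly_value_one: "mpoly_value \<iota> a 1 = 1"
  using mpoly_value_single[of a 0 1] by (simp add: coeff_homD[OF \<iota>])

lemma mpoly_value_add: "mpoly_value \<iota> a (f + g) = mpoly_value \<iota> a f + mpoly_value \<iota> a g"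
proof -
  let ?A = "Poly_Mapping.keys f \<union> Poly_Mapping.keys g"
  have "mpoly_value \<iota> a (f + g) = (\<Sum>m\<in>?A. \<iota> (Poly_Mapping.lookup (f + g) m) * monomial_value a m)"
    by (rule mpoly_value_superset[of \<iota>, OF coeff_homD(1)[OF \<iota>]]) (auto dest: subsetD[OF keys_add])
  also have "\<dots> = mpoly_value \<iota> a f + mpoly_value \<iota> a g"
    using mpoly_value_superset[of \<iota>, OF coeff_homD(1)[OF \<iota>], of ?A f a]
      mpoly_value_superset[of \<iota>, OF coeff_homD(1)[OF \<iota>], of ?A g a]
    by (simp add: lookup_add distrib_right sum.distrib coeff_homD[OF \<iota>])
  finally show ?thesis .
qed

lemma mpoly_value_mult: "mpoly_value \<iota> a (f * g) = mpoly_value \<iota> a f * mpoly_value \<iota> a g"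
proof (induction f rule: mpoly_induct)
  case (add_single f m c)
  have "mpoly_value \<iota> a (Poly_Mapping.single m c * g) = \<iota> c * monomial_value a m * mpoly_value \<iota> a g"
  proof (induction g rule: mpoly_induct)
    case (add_single g m' c')
    then show ?case
      by (simp add: distrib_left mpoly_value_add mpoly_value_single mult_single monomial_value_add
          coeff_homD[OF \<iota>])
  qed (simp add: mpoly_value_zero)
  then show ?case
    using add_single by (simp add: distrib_right mpoly_value_add mpoly_value_single)
qed (simp add: mpoly_value_zero)

lemma mpoly_value_diff: "mpoly_value \<iota> a (f - g) = mpoly_value \<iota> a f - mpoly_value \<iota> a g"
  using mpoly_value_add[of a "f - g" g] by simp

lemma mpoly_value_uminus: "mpoly_value \<iota> a (- f) = - mpoly_value \<iota> a f"
  using mpoly_value_diff[of a 0 f] by (simp add: mpoly_value_zero)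

lemma mpoly_value_sum: "mpoly_value \<iota> a (sum f A) = (\<Sum>x\<in>A. mpoly_value \<iota> a (f x))"
  by (induction A rule: infinite_finite_induct) (simp_all add: mpoly_value_zero mpoly_value_add)

lemma mpoly_value_power: "mpoly_value \<iota> a (f ^ k) = mpoly_value \<iota> a f ^ k"
  by (induction k) (simp_all add: mpoly_value_one mpoly_value_mult)

lemma mpoly_value_Const: "mpoly_value \<iota> a (Const c) = \<iota> c"
  by (simp add: Const_def mpoly_value_single)

lemma mpoly_value_X: "mpoly_value \<iota> a (X i) = a i"
  by (simp add: X_def mpoly_value_single monomial_value_def coeff_homD[OF \<iota>])

lemmas mpoly_value_simps = mpoly_value_zero mpoly_value_one mpoly_value_add mpoly_value_mult mpoly_value_diff
  mpoly_value_uminus mpoly_value_sum mpoly_value_power mpoly_value_Const mpoly_value_X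

end

lemma Const_simps: "Const 0 = 0" "Const 1 = 1" "Const (x + y) = Const x + Const y" "Const (x * y) = Const x * Const y"
  by (simp_all add: Const_def single_add mult_single)

lemma coeff_hom_Const: "coeff_hom Const"
  by (simp add: coeff_hom_def Const_simps)

lemma coeff_hom_id: "coeff_hom (\<lambda>c. c)"
  by (simp add: coeff_hom_def)

lemmas substitute_simps = mpoly_value_simps[OF coeff_hom_Const]
lemmas eval_at_simps = mpoly_value_simps[OF coeff_hom_id]

lemma single_eq: "Poly_Mapping.single m c = Const c * (\<Prod>i\<in>Poly_Mapping.keys m. X i ^ Poly_Mapping.lookup m i)"
proof -
  have pow: "X i ^ k = Poly_Mapping.single (Poly_Mapping.single i k) 1" for i k
    by (induction k) (simp_all add: X_def mult_single single_add[symmetric])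
  have "(\<Prod>i\<in>A. X i ^ Poly_Mapping.lookup m i) =
      Poly_Mapping.single (\<Sum>i\<in>A. Poly_Mapping.single i (Poly_Mapping.lookup m i)) 1" for A
    by (induction A rule: infinite_finite_induct) (simp_all add: pow mult_single)
  moreover have "(\<Sum>i\<in>Poly_Mapping.keys m. Poly_Mapping.single i (Poly_Mapping.lookup m i)) = m"
    by (rule poly_mapping_eqI) (simp add: lookup_sum lookup_single when_def in_keys_iff)
  ultimately show ?thesis by (simp add: Const_def mult_single)
qed

lemma mpoly_ring_induct [case_names Const X add mult]:
  assumes Const: "\<And>c. P (Const c)" and X: "\<And>i. P (X i)"
    and add: "\<And>f g. P f \<Longrightarrow> P g \<Longrightarrow> P (f + g)" and mult: "\<And>f g. P f \<Longrightarrow> P g \<Longrightarrow> P (f * g)"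
  shows "P f"
proof (induction f rule: mpoly_induct)
  case zero
  show ?case using Const[of 0] by (simp add: Const_simps)
next
  case (add_single f m c)
  have one: "P 1" using Const[of 1] by (simp add: Const_simps)
  have pow: "P (X i ^ k)" for i k by (induction k) (auto intro: one mult X)
  have "P (\<Prod>i\<in>A. X i ^ Poly_Mapping.lookup m i)" for A
    by (induction A rule: infinite_finite_induct) (auto intro: one mult pow)
  then show ?case unfolding single_eq by (intro add add_single mult Const)
qed

lemma mpoly_value_substitute:
  assumes \<iota>: "coeff_hom \<iota>"
  shows "mpoly_value \<iota> a (substitute b f) = mpoly_value \<iota> (\<lambda>i. mpoly_value \<iota> a (b i)) f"
  by (induction f rule: mpoly_ring_induct)
    (simp_all add: substitute_simps mpoly_value_simps[OF \<iota>])

lemma substitute_substitute: "substitute a (substitute b f) = substitute (\<lambda>i. substitute a (b i)) f"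
  by (rule mpoly_value_substitute[OF coeff_hom_Const])

lemma substitute_X: "substitute X f = f"
  by (induction f rule: mpoly_ring_induct) (simp_all add: substitute_simps)

lemma mpoly_value_cong_vars:
  assumes "\<And>i. i \<in> vars f \<Longrightarrow> a i = b i"
  shows "mpoly_value \<iota> a f = mpoly_value \<iota> b f"
proof -
  have "monomial_value a m = monomial_value b m" if "m \<in> Poly_Mapping.keys f" for m
    unfolding monomial_value_def
  proof (rule prod.cong[OF refl])
    fix i assume "i \<in> Poly_Mapping.keys m"
    then have "i \<in> vars f" using that by (auto simp: vars_def)
    then show "a i ^ Poly_Mapping.lookup m i = b i ^ Poly_Mapping.lookup m i" by (simp add: assms)
  qed
  then show ?thesis unfolding mpoly_value_def by (intro sum.cong refl) simp
qed

lemma vars_zero: "vars 0 = {}" by (simp add: vars_def)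

lemma vars_Const: "vars (Const c) = {}"
  by (simp add: vars_def Const_def)

lemma vars_X: "vars (X i) = {i}"
  by (simp add: vars_def X_def)

lemma vars_add: "vars (f + g) \<subseteq> vars f \<union> vars g"
  unfolding vars_def using keys_add[of f g] by blast

lemma vars_uminus: "vars (- f) = vars f"
  by (simp add: vars_def)

lemma vars_diff: "vars (f - g) \<subseteq> vars f \<union> vars g"
  using vars_add[of f "- g"] by (simp add: vars_uminus)

lemma vars_substitute: "(\<And>i. vars (b i) \<subseteq> E) \<Longrightarrow> vars (substitute b f) \<subseteq> E"
proof (induction f rule: mpoly_ring_induct)
  case (add f g)
  then show ?case using vars_add[of "substitute b f" "substitute b g"] by (auto simp: substitute_simps)
next
  case (mult f g)
  then show ?case using vars_mult[of "substitute b f" "substitute b g"] by (auto simp: substitute_simps)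
qed (auto simp: substitute_simps vars_Const)

text \<open>The factor theorem in several variables, from which the quotients in
  \<open>u1_poly\<close>, \<open>u2_poly\<close> and \<open>chi_poly\<close> get their existence.
  Products are handled by writing \<open>f g - f' g'\<close> as
  \<open>f (g - g') + (f - f') g'\<close>.\<close>

lemma substitute_dvd_diff:
  assumes "\<And>i. d dvd a i - b i"
  shows "d dvd substitute a f - substitute b f"
proof (induction f rule: mpoly_ring_induct)
  case (add f g)
  then have "d dvd (substitute a f - substitute b f) + (substitute a g - substitute b g)" by (rule dvd_add)
  then show ?case by (simp add: substitute_simps algebra_simps)
next
  case (mult f g)
  then have "d dvd substitute a f * (substitute a g - substitute b g) + (substitute a f - substitute b f) * substitute b g"
    by (intro dvd_add dvd_mult dvd_mult2)
  then show ?case by (simp add: substitute_simps algebra_simps)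
qed (simp_all add: substitute_simps assms)

lemma map_poly_Const_pCons: "map_poly Const (pCons a p) = pCons (Const a) (map_poly Const p)"
  by (rule map_poly_pCons) (rule Const_simps)

lemma poly_in_pCons: "poly_in (pCons a p) f = Const a + f * poly_in p f"
  by (simp_all add: map_poly_Const_pCons)

lemma substitute_poly_in: "substitute b (poly_in p f) = poly_in p (substitute b f)"
  by (induction p) (simp_all add: poly_in_pCons substitute_simps del: poly_pCons)

lemma poly_in_dvd_diff: "d dvd f - g \<Longrightarrow> d dvd poly_in p f - poly_in p g"
proof (induction p)
  case (pCons a p)
  then have "d dvd f * (poly_in p f - poly_in p g) + (f - g) * poly_in p g"
    by (intro dvd_add dvd_mult dvd_mult2) auto
  then show ?case by (simp add: poly_in_pCons algebra_simps)
qed simp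

section \<open>Existence and uniqueness of the polynomials in the matrix factorizations\<close>

lemma exact_quotient_eqI: "g \<noteq> 0 \<Longrightarrow> f = q * g \<Longrightarrow> exact_quotient f g = q"
  unfolding exact_quotient_def by (rule the_equality) auto

lemma exact_quotient_mult: "g \<noteq> 0 \<Longrightarrow> g dvd f \<Longrightarrow> f = exact_quotient f g * g"
  using exact_quotient_eqI by (metis dvd_def mult.commute)

lemma primitive_unique_exists:
  fixes p :: "complex poly"
  shows "\<exists>!w. pderiv w = Polynomial.smult (of_nat (degree p + 1)) p \<and> coeff w 0 = 0"
proof (rule ex_ex1I)
  let ?p = "Polynomial.smult (of_nat (degree p + 1)) p"
  have ex: "\<exists>w. pderiv w = q" for q :: "complex poly"
  proof -
    define w where "w = (\<Sum>k\<le>degree q. monom (coeff q k / of_nat (Suc k)) (Suc k))"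
    have "pderiv w = (\<Sum>k\<le>degree q. monom (coeff q k) k)"
      unfolding w_def higher_pderiv_sum[of 1, simplified]
      by (intro sum.cong refl) (simp add: pderiv_monom del: of_nat_Suc)
    also have "\<dots> = q" by (rule poly_as_sum_of_monoms)
    finally show ?thesis ..
  qed
  obtain w where w: "pderiv w = ?p" using ex[of ?p] by (rule exE)
  then have "pderiv (w - [:coeff w 0:]) = ?p \<and> coeff (w - [:coeff w 0:]) 0 = 0"
    by (simp add: pderiv_diff pderiv_pCons)
  then show "\<exists>w. pderiv w = ?p \<and> coeff w 0 = 0" by blast
next
  fix v w
  assume v: "pderiv v = Polynomial.smult (of_nat (degree p + 1)) p \<and> coeff v 0 = 0"
    and w: "pderiv w = Polynomial.smult (of_nat (degree p + 1)) p \<and> coeff w 0 = 0"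
  then have "pderiv (v - w) = 0" by (simp add: pderiv_diff)
  then obtain c where "v - w = [:c:]" by (auto simp: pderiv_eq_0_iff elim: degree_eq_zeroE)
  moreover have "coeff (v - w) 0 = 0" using v w by simp
  ultimately show "v = w" by simp
qed

lemma primitive: "pderiv (primitive p) = Polynomial.smult (of_nat (degree p + 1)) p" "coeff (primitive p) 0 = 0"
  using theI'[OF primitive_unique_exists[of p]] unfolding primitive_def by blast+

lemma primitive_eqI:
  "pderiv w = Polynomial.smult (of_nat (degree p + 1)) p \<Longrightarrow> coeff w 0 = 0 \<Longrightarrow> primitive p = w"
  unfolding primitive_def by (rule the1_equality[OF primitive_unique_exists]) simp

abbreviation elementary :: "nat \<Rightarrow> mpoly" where
  "elementary \<equiv> \<lambda>i. if i = 1 then X 1 + X 2 else X 1 * X 2"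

lemma eval_at_substitute: "eval_at a (substitute b f) = eval_at (\<lambda>i. eval_at a (b i)) f"
  by (rule mpoly_value_substitute[OF coeff_hom_id])

text \<open>Substituting \<open>t\<close> and \<open>t ^ N\<close>, with \<open>N\<close> large, separates the monomials.\<close>

lemma zero_of_eval_two_variables:
  assumes f: "vars f \<subseteq> {1, 2}" and zero: "\<And>a. eval_at a f = 0"
  shows "f = 0"
proof (rule ccontr)
  assume "f \<noteq> 0"
  then obtain m0 where m0: "m0 \<in> Poly_Mapping.keys f" using keys_eq_empty[of f] by blast
  \<comment> \<open>\<open>N\<close> exceeds every exponent of the first variable in
    \<open>f\<close>, so the two exponents of a monomial are the remainder and the quotient of
    \<open>e m\<close> by \<open>N\<close>.\<close>
  define N where "N = Suc (\<Sum>m\<in>Poly_Mapping.keys f. Poly_Mapping.lookup m (1::nat))"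
  define e where "e = (\<lambda>m. Poly_Mapping.lookup m (1::nat) + N * Poly_Mapping.lookup m 2)"
  have less: "Poly_Mapping.lookup m (1::nat) < N" if "m \<in> Poly_Mapping.keys f" for m
    unfolding N_def less_Suc_eq_le using that by (rule member_le_sum) simp_all
  have inj: "m = m'" if m: "m \<in> Poly_Mapping.keys f" "m' \<in> Poly_Mapping.keys f" and eq: "e m = e m'" for m m'
  proof -
    have "e m mod N = e m' mod N" "e m div N = e m' div N" using eq by simp_all
    then have *: "Poly_Mapping.lookup m 1 = Poly_Mapping.lookup m' 1"
      "Poly_Mapping.lookup m 2 = Poly_Mapping.lookup m' 2"
      using less[OF m(1)] less[OF m(2)] unfolding e_def by simp_all
    have outside: "Poly_Mapping.lookup k i = 0" if "k \<in> Poly_Mapping.keys f" "i \<notin> {1, 2}" for k i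
    proof -
      have "i \<notin> Poly_Mapping.keys k" using f that unfolding vars_def by blast
      then show ?thesis by (simp add: in_keys_iff)
    qed
    show ?thesis
    proof (rule poly_mapping_eqI)
      fix i
      show "Poly_Mapping.lookup m i = Poly_Mapping.lookup m' i"
        using * outside[OF m(1), of i] outside[OF m(2), of i] by (cases "i \<in> {1, 2}") auto
    qed
  qed
  define P where "P = (\<Sum>m\<in>Poly_Mapping.keys f. monom (Poly_Mapping.lookup f m) (e m))"
  have "poly P t = 0" for t
  proof -
    have "eval_at (\<lambda>i. if i = 1 then t else t ^ N) f =
        (\<Sum>m\<in>Poly_Mapping.keys f. Poly_Mapping.lookup f m * t ^ e m)"
      unfolding mpoly_value_def
    proof (intro sum.cong refl)
      fix m assume m: "m \<in> Poly_Mapping.keys f"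
      then have "Poly_Mapping.keys m \<subseteq> {1, 2}" using f by (auto simp: vars_def)
      then have "monomial_value (\<lambda>i. if i = 1 then t else t ^ N) m = t ^ e m"
        by (subst monomial_value_superset[of "{1, 2}"]) (simp_all add: e_def power_add power_mult)
      then show "Poly_Mapping.lookup f m * monomial_value (\<lambda>i. if i = 1 then t else t ^ N) m =
          Poly_Mapping.lookup f m * t ^ e m" by simp
    qed
    then show ?thesis using zero by (simp add: P_def poly_sum poly_monom)
  qed
  then have "P = 0" using poly_all_0_iff_0 by blast
  then have "0 = coeff P (e m0)" by simp
  also have "\<dots> = (\<Sum>m\<in>Poly_Mapping.keys f. if m = m0 then Poly_Mapping.lookup f m else 0)"
    unfolding P_def coeff_sum using inj m0 by (intro sum.cong refl) auto
  also have "\<dots> = Poly_Mapping.lookup f m0" using m0 by simp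
  finally show False using m0 by (simp add: in_keys_iff)
qed

text \<open>Every pair of complex numbers is the sum and the product of two numbers, namely of the
  roots of a quadratic polynomial. Hence \<open>f\<close> vanishes at all points.\<close>

lemma elementary_independent:
  assumes f: "vars f \<subseteq> {1, 2}" and zero: "substitute elementary f = 0"
  shows "f = 0"
proof (rule zero_of_eval_two_variables[OF f])
  fix a :: "nat \<Rightarrow> complex"
  define r where "r = csqrt ((a 1)\<^sup>2 - 4 * a 2)"
  have r: "r\<^sup>2 = (a 1)\<^sup>2 - 4 * a 2" by (simp add: r_def)
  define b where "b = (\<lambda>i::nat. if i = 1 then (a 1 + r) / 2 else (a 1 - r) / 2)"
  have "b 1 + b 2 = a 1" by (simp add: b_def field_simps)
  moreover have "b 1 * b 2 = a 2"
    using r by (simp add: b_def field_simps power2_eq_square)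
  ultimately have "eval_at a f = eval_at (\<lambda>i. eval_at b (elementary i)) f"
    by (intro mpoly_value_cong_vars) (use f in \<open>auto simp: eval_at_simps\<close>)
  also have "\<dots> = 0" using zero by (simp add: eval_at_substitute[symmetric])
  finally show "eval_at a f = 0" .
qed

text \<open>Newton's recursion: the power sum of order \<open>k\<close> is \<open>x + y\<close>
  times the one of order \<open>k - 1\<close> minus \<open>x y\<close> times the one of order
  \<open>k - 2\<close>.\<close>

lemma power_sum_elementary:
  "\<exists>g. vars g \<subseteq> {1, 2} \<and> substitute elementary g = X 1 ^ k + X 2 ^ k"
proof (induction k rule: less_induct)
  case (less k)
  consider "k = 0" | "k = 1" | j where "k = Suc (Suc j)" by (metis One_nat_def nat.exhaust)
  then show ?case
  proof cases
    case 1
    have "vars (Const 1 + Const 1) \<subseteq> {1, 2}"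
      using vars_add[of "Const 1" "Const 1"] by (simp add: vars_Const)
    moreover have "substitute elementary (Const 1 + Const 1) = X 1 ^ k + X 2 ^ k"
      by (simp only: 1 substitute_simps(2,3,9) Const_simps(2) power_0)
    ultimately show ?thesis by blast
  next
    case 2
    then show ?thesis by (intro exI[of _ "X 1"]) (auto simp: vars_X substitute_simps)
  next
    case 3
    obtain g h where g: "vars g \<subseteq> {1, 2}" "substitute elementary g = X 1 ^ Suc j + X 2 ^ Suc j"
      and h: "vars h \<subseteq> {1, 2}" "substitute elementary h = X 1 ^ j + X 2 ^ j"
      using less[of "Suc j"] less[of j] 3 by auto
    have "vars (X 1 * g) \<subseteq> {1, 2}" "vars (X 2 * h) \<subseteq> {1, 2}"
      using vars_mult[of "X 1" g] vars_mult[of "X 2" h] g(1) h(1) unfolding vars_X by blast+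
    then have "vars (X 1 * g - X 2 * h) \<subseteq> {1, 2}"
      using vars_diff[of "X 1 * g" "X 2 * h"] by blast
    moreover have "substitute elementary (X 1 * g - X 2 * h) = X 1 ^ k + X 2 ^ k"
      by (simp only: substitute_simps g(2) h(2) 3) (simp add: algebra_simps)
    ultimately show ?thesis by blast
  qed
qed

lemma g_poly_unique_exists:
  "\<exists>!g. vars g \<subseteq> {1, 2} \<and> substitute elementary g = poly_in w (X 1) + poly_in w (X 2)"
proof (rule ex_ex1I)
  \<comment> \<open>The powers \<open>X 1 ^ k\<close> and \<open>X 2 ^ k\<close> make the induction
    on \<open>w\<close> work, as splitting off the constant coefficient leaves a polynomial
    multiplied by the variable.\<close>
  have "\<exists>g. vars g \<subseteq> {1, 2} \<and> substitute elementary g = X 1 ^ k * poly_in w (X 1) + X 2 ^ k * poly_in w (X 2)" for k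
  proof (induction w arbitrary: k)
    case 0
    show ?case by (intro exI[of _ 0]) (simp add: vars_zero substitute_simps)
  next
    case (pCons a w)
    obtain g where g: "vars g \<subseteq> {1, 2}" "substitute elementary g = X 1 ^ k + X 2 ^ k"
      using power_sum_elementary by blast
    obtain h where h: "vars h \<subseteq> {1, 2}"
      "substitute elementary h = X 1 ^ Suc k * poly_in w (X 1) + X 2 ^ Suc k * poly_in w (X 2)"
      using pCons.IH by blast
    have "vars (Const a * g + h) \<subseteq> {1, 2}"
      using vars_add[of "Const a * g" h] vars_mult[of "Const a" g] g(1) h(1) by (auto simp: vars_Const)
    moreover have "substitute elementary (Const a * g + h) =
        X 1 ^ k * poly_in (pCons a w) (X 1) + X 2 ^ k * poly_in (pCons a w) (X 2)"
      by (simp only: substitute_simps g(2) h(2) poly_in_pCons) (simp add: algebra_simps)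
    ultimately show ?case by blast
  qed
  from this[of 0] show "\<exists>g. vars g \<subseteq> {1, 2} \<and> substitute elementary g = poly_in w (X 1) + poly_in w (X 2)"
    by simp
next
  fix g h
  assume "vars g \<subseteq> {1, 2} \<and> substitute elementary g = poly_in w (X 1) + poly_in w (X 2)"
    "vars h \<subseteq> {1, 2} \<and> substitute elementary h = poly_in w (X 1) + poly_in w (X 2)"
  then have "vars (g - h) \<subseteq> {1, 2}" "substitute elementary (g - h) = 0"
    using vars_diff[of g h] by (auto simp: substitute_simps)
  then have "g - h = 0" by (rule elementary_independent)
  then show "g = h" by simp
qed

lemma g_poly: "vars (g_poly p) \<subseteq> {1, 2}"
    "substitute elementary (g_poly p) = poly_in (primitive p) (X 1) + poly_in (primitive p) (X 2)"
  using theI'[OF g_poly_unique_exists[of "primitive p"]] unfolding g_poly_def Let_def by blast+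

lemma g_poly_eqI:
  "vars g \<subseteq> {1, 2} \<Longrightarrow> substitute elementary g = poly_in (primitive p) (X 1) + poly_in (primitive p) (X 2) \<Longrightarrow>
    g_poly p = g"
  unfolding g_poly_def Let_def by (rule the1_equality[OF g_poly_unique_exists]) simp

lemma g_at_symmetric:
  "g_at p (X i + X j) (X i * X j) = poly_in (primitive p) (X i) + poly_in (primitive p) (X j)"
proof -
  let ?b = "\<lambda>k. if k = 1 then X i else X j"
  have "substitute ?b (substitute elementary (g_poly p)) = g_at p (X i + X j) (X i * X j)"
    unfolding substitute_substitute g_at_def
    by (intro arg_cong[of _ _ "\<lambda>b. substitute b _"] ext) (simp add: substitute_simps)
  then show ?thesis unfolding g_poly(2) by (simp add: substitute_simps substitute_poly_in)
qed

lemma substitute_g_at: "substitute b (g_at p s t) = g_at p (substitute b s) (substitute b t)"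
  unfolding g_at_def substitute_substitute
  by (intro arg_cong[of _ _ "\<lambda>b. substitute b _"] ext) simp

lemma nonzero_of_eval: "eval_at a f \<noteq> 0 \<Longrightarrow> f \<noteq> 0"
  by auto

lemma X_diff_nonzero: "i \<noteq> j \<Longrightarrow> X i - X j \<noteq> 0"
  by (rule nonzero_of_eval[of "\<lambda>k. if k = i then 1 else 0"]) (simp add: eval_at_simps)

lemma u1_denominator_nonzero: "X 1 + X 2 - X 3 - X 4 \<noteq> 0"
  by (rule nonzero_of_eval[of "\<lambda>k. if k = 1 then 1 else 0"]) (simp add: eval_at_simps)

lemma u2_denominator_nonzero: "X 1 * X 2 - X 3 * X 4 \<noteq> 0"
  by (rule nonzero_of_eval[of "\<lambda>k. if k \<in> {1, 2} then 1 else 0"]) (simp add: eval_at_simps)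

lemma arc_poly_dvd: "X 1 - X 2 dvd poly_in w (X 1) - poly_in w (X 2)"
  by (rule poly_in_dvd_diff) simp

lemma u1_poly_dvd: "X 1 + X 2 - X 3 - X 4 dvd g_at p (X 1 + X 2) (X 1 * X 2) - g_at p (X 3 + X 4) (X 1 * X 2)"
  unfolding g_at_def by (rule substitute_dvd_diff) (simp add: algebra_simps)

lemma u2_poly_dvd: "X 1 * X 2 - X 3 * X 4 dvd g_at p (X 3 + X 4) (X 1 * X 2) - g_at p (X 3 + X 4) (X 3 * X 4)"
  unfolding g_at_def by (rule substitute_dvd_diff) simp

lemma arc_poly: "poly_in (primitive p) (X 1) - poly_in (primitive p) (X 2) = arc_poly p * (X 1 - X 2)"
  unfolding arc_poly_def Let_def by (rule exact_quotient_mult[OF X_diff_nonzero arc_poly_dvd]) simp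

lemma u1_poly: "g_at p (X 1 + X 2) (X 1 * X 2) - g_at p (X 3 + X 4) (X 1 * X 2) =
    u1_poly p * (X 1 + X 2 - X 3 - X 4)"
  unfolding u1_poly_def by (rule exact_quotient_mult[OF u1_denominator_nonzero u1_poly_dvd])

lemma u2_poly: "g_at p (X 3 + X 4) (X 1 * X 2) - g_at p (X 3 + X 4) (X 3 * X 4) =
    u2_poly p * (X 1 * X 2 - X 3 * X 4)"
  unfolding u2_poly_def by (rule exact_quotient_mult[OF u2_denominator_nonzero u2_poly_dvd])

lemma arc_at: "poly_in (primitive p) (X i) - poly_in (primitive p) (X j) = arc_at p i j * (X i - X j)"
  using arg_cong[OF arc_poly[of p], of "substitute (\<lambda>k. if k = 1 then X i else X j)"]
  by (simp add: substitute_simps substitute_poly_in arc_at_def)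

text \<open>Modulo \<open>x\<^sub>2 - x\<^sub>3\<close> both sides of \<open>a\<^sub>0 = u\<^sub>1 + x\<^sub>3 u\<^sub>2\<close> become \<open>w(x\<^sub>1) - w(x\<^sub>4)\<close> after multiplication by \<open>x\<^sub>1 - x\<^sub>4\<close>.\<close>

lemma chi_poly_dvd: "X 2 - X 3 dvd arc_at p 1 4 - u1_poly p - X 3 * u2_poly p"
proof -
  let ?f = "arc_at p 1 4 - u1_poly p - X 3 * u2_poly p" and ?w = "primitive p"
  \<comment> \<open>The substitution identifies the variables 2 and 3. It turns out to kill
    \<open>?f\<close>, and \<open>?f\<close> differs from its image under \<open>b\<close> by a
    multiple of \<open>X 2 - X 3\<close>.\<close>
  define b where "b = (\<lambda>i::nat. if i = 2 then X 3 else X i)"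
  note s = substitute_simps substitute_poly_in substitute_g_at b_def
  have e1: "poly_in ?w (X 1) - poly_in ?w (X 4) = substitute b (arc_at p 1 4) * (X 1 - X 4)"
    using arg_cong[OF arc_at[of p 1 4], of "substitute b"] by (simp add: s)
  have e2: "g_at p (X 1 + X 3) (X 1 * X 3) - g_at p (X 3 + X 4) (X 1 * X 3) =
      substitute b (u1_poly p) * (X 1 - X 4)"
    using arg_cong[OF u1_poly[of p], of "substitute b"] by (simp add: s)
  have e3: "g_at p (X 3 + X 4) (X 1 * X 3) - g_at p (X 3 + X 4) (X 3 * X 4) =
      X 3 * substitute b (u2_poly p) * (X 1 - X 4)"
    using arg_cong[OF u2_poly[of p], of "substitute b"] by (simp add: s algebra_simps)
  have "substitute b ?f * (X 1 - X 4) = substitute b (arc_at p 1 4) * (X 1 - X 4) -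
      substitute b (u1_poly p) * (X 1 - X 4) - X 3 * substitute b (u2_poly p) * (X 1 - X 4)"
    by (simp add: s algebra_simps)
  also have "\<dots> = 0"
    unfolding e1[symmetric] e2[symmetric] e3[symmetric] g_at_symmetric by simp
  finally have "substitute b ?f * (X 1 - X 4) = 0" .
  then have "substitute b ?f = 0" using X_diff_nonzero[of 1 4] by simp
  moreover have "X 2 - X 3 dvd X i - b i" for i by (simp add: b_def)
  then have "X 2 - X 3 dvd substitute X ?f - substitute b ?f" by (rule substitute_dvd_diff)
  ultimately show ?thesis by (simp add: substitute_X)
qed

lemma chi_poly0: "arc_at p 1 4 = u1_poly p + X 3 * u2_poly p + chi_poly p * (X 2 - X 3)"
  using exact_quotient_mult[OF X_diff_nonzero chi_poly_dvd[of p]] unfolding chi_poly_def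
  by (simp add: algebra_simps)

text \<open>The thick edge and the two arcs factorize the same polynomial
  \<open>w(x1) + w(x2) - w(x3) - w(x4)\<close>. Inserting \<open>chi_poly0\<close> into this
  equality leaves a common factor \<open>X 2 - X 3\<close>, which is cancelled.\<close>

lemma chi_poly1: "arc_at p 2 3 = u1_poly p + X 1 * u2_poly p - chi_poly p * (X 1 - X 4)"
proof -
  let ?w = "\<lambda>i. poly_in (primitive p) (X i)" and ?g = "g_at p (X 3 + X 4) (X 1 * X 2)"
  have "arc_at p 2 3 * (X 2 - X 3) =
      (?w 1 + ?w 2 - ?g) + (?g - (?w 3 + ?w 4)) - (?w 1 - ?w 4)"
    unfolding arc_at[symmetric] by simp
  also have "\<dots> = u1_poly p * (X 1 + X 2 - X 3 - X 4) + u2_poly p * (X 1 * X 2 - X 3 * X 4) -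
      arc_at p 1 4 * (X 1 - X 4)"
    using u1_poly[of p] u2_poly[of p] by (simp only: g_at_symmetric arc_at)
  also have "\<dots> = (u1_poly p + X 1 * u2_poly p - chi_poly p * (X 1 - X 4)) * (X 2 - X 3)"
    unfolding chi_poly0 by (simp add: algebra_simps)
  finally have "(X 2 - X 3) * (arc_at p 2 3 - (u1_poly p + X 1 * u2_poly p - chi_poly p * (X 1 - X 4))) = 0"
    by (simp add: algebra_simps)
  then show ?thesis using X_diff_nonzero[of 2 3] by simp
qed

section \<open>Conjugation of coefficients\<close>

definition conjugate :: "(complex \<Rightarrow> complex) \<Rightarrow> mpoly \<Rightarrow> mpoly" where
  "conjugate \<sigma> = mpoly_value (\<lambda>c. Const (\<sigma> c)) X"

context
  fixes \<sigma> assumes \<sigma>: "field_automorphism \<sigma>"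
begin

lemma coeff_hom_conjugate: "coeff_hom (\<lambda>c. Const (\<sigma> c))"
  by (simp add: coeff_hom_def Const_simps field_automorphism_zero[OF \<sigma>] field_automorphism_one[OF \<sigma>]
      field_automorphism_add[OF \<sigma>] field_automorphism_mult[OF \<sigma>])

lemmas conjugate_simps = mpoly_value_simps[OF coeff_hom_conjugate, of X, folded conjugate_def]

lemma monomial_value_X: "monomial_value X m = Poly_Mapping.single m 1"
  using single_eq[of m 1] by (simp add: monomial_value_def Const_simps)

lemma conjugate_single: "conjugate \<sigma> (Poly_Mapping.single m c) = Poly_Mapping.single m (\<sigma> c)"
  unfolding conjugate_def mpoly_value_single[OF coeff_hom_conjugate] monomial_value_X
  by (simp add: Const_def mult_single)

lemma lookup_conjugate: "Poly_Mapping.lookup (conjugate \<sigma> f) m = \<sigma> (Poly_Mapping.lookup f m)"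
proof (induction f rule: mpoly_induct)
  case zero
  show ?case by (simp add: conjugate_simps(1) field_automorphism_zero[OF \<sigma>])
next
  case (add_single f k c)
  then show ?case
    by (simp add: conjugate_simps(3) conjugate_single lookup_add lookup_single when_def
        field_automorphism_add[OF \<sigma>] field_automorphism_zero[OF \<sigma>])
qed

lemma keys_conjugate: "Poly_Mapping.keys (conjugate \<sigma> f) = Poly_Mapping.keys f"
  by (auto simp: in_keys_iff lookup_conjugate field_automorphism_eq_0_iff[OF \<sigma>])

lemma vars_conjugate: "vars (conjugate \<sigma> f) = vars f"
  by (simp add: vars_def keys_conjugate)

lemma conjugate_eq_0_iff: "conjugate \<sigma> f = 0 \<longleftrightarrow> f = 0"
  using keys_conjugate[of f] by (metis keys_eq_empty)

lemma conjugate_substitute: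
  "conjugate \<sigma> (substitute b f) = substitute (\<lambda>i. conjugate \<sigma> (b i)) (conjugate \<sigma> f)"
  by (induction f rule: mpoly_ring_induct) (simp_all add: substitute_simps conjugate_simps)

lemma conjugate_poly_in: "conjugate \<sigma> (poly_in p f) = poly_in (map_poly \<sigma> p) (conjugate \<sigma> f)"
proof (induction p)
  case 0
  show ?case by (simp add: conjugate_simps(1))
next
  case (pCons a p)
  have "map_poly \<sigma> (pCons a p) = pCons (\<sigma> a) (map_poly \<sigma> p)"
    by (rule map_poly_pCons) (rule field_automorphism_zero[OF \<sigma>])
  then show ?case using pCons by (simp only: poly_in_pCons conjugate_simps)
qed

text \<open>Conjugating the equation that characterizes the quotient gives the one for the
  conjugates, and quotients are unique.\<close>

lemma conjugate_exact_quotient: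
  assumes "g \<noteq> 0" "g dvd f"
  shows "conjugate \<sigma> (exact_quotient f g) = exact_quotient (conjugate \<sigma> f) (conjugate \<sigma> g)"
  using assms(1) arg_cong[OF exact_quotient_mult[OF assms], of "conjugate \<sigma>"]
  by (intro exact_quotient_eqI[symmetric]) (simp_all add: conjugate_eq_0_iff conjugate_simps(4))

lemma degree_map_poly_automorphism: "degree (map_poly \<sigma> p) = degree p"
  by (rule degree_map_poly) (simp add: field_automorphism_eq_0_iff[OF \<sigma>])

lemma field_automorphism_of_nat: "\<sigma> (of_nat k) = of_nat k"
  by (induction k) (simp_all add: field_automorphism_zero[OF \<sigma>] field_automorphism_one[OF \<sigma>]
      field_automorphism_add[OF \<sigma>])

text \<open>Besides the potential, the equation defining the primitive contains only the integer
  \<open>degree p + 1\<close>, which \<open>\<sigma>\<close> fixes.\<close>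

lemma primitive_map_poly: "primitive (map_poly \<sigma> p) = map_poly \<sigma> (primitive p)"
proof (rule primitive_eqI)
  note c = coeff_map_poly[of \<sigma>, OF field_automorphism_zero[OF \<sigma>]]
  show "pderiv (map_poly \<sigma> (primitive p)) =
      Polynomial.smult (of_nat (degree (map_poly \<sigma> p) + 1)) (map_poly \<sigma> p)"
  proof (rule poly_eqI)
    fix k
    have "coeff (pderiv (map_poly \<sigma> (primitive p))) k = \<sigma> (of_nat (Suc k) * coeff (primitive p) (Suc k))"
      by (simp only: coeff_pderiv c field_automorphism_mult[OF \<sigma>] field_automorphism_of_nat)
    also have "\<dots> = \<sigma> (coeff (Polynomial.smult (of_nat (degree p + 1)) p) k)"
      by (simp only: primitive(1)[symmetric] coeff_pderiv)
    also have "\<dots> = coeff (Polynomial.smult (of_nat (degree (map_poly \<sigma> p) + 1)) (map_poly \<sigma> p)) k"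
      by (simp only: coeff_smult c field_automorphism_mult[OF \<sigma>] field_automorphism_of_nat
          degree_map_poly_automorphism)
    finally show "coeff (pderiv (map_poly \<sigma> (primitive p))) k =
        coeff (Polynomial.smult (of_nat (degree (map_poly \<sigma> p) + 1)) (map_poly \<sigma> p)) k" .
  qed
  show "coeff (map_poly \<sigma> (primitive p)) 0 = 0"
    by (simp add: c primitive(2) field_automorphism_zero[OF \<sigma>])
qed

lemma arc_poly_map_poly: "arc_poly (map_poly \<sigma> p) = conjugate \<sigma> (arc_poly p)"
  unfolding arc_poly_def Let_def primitive_map_poly
  by (subst conjugate_exact_quotient[OF X_diff_nonzero arc_poly_dvd])
    (simp_all add: conjugate_simps conjugate_poly_in)

lemma g_poly_map_poly: "g_poly (map_poly \<sigma> p) = conjugate \<sigma> (g_poly p)"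
proof (rule g_poly_eqI)
  have "substitute elementary (conjugate \<sigma> (g_poly p)) = conjugate \<sigma> (substitute elementary (g_poly p))"
    unfolding conjugate_substitute
    by (intro arg_cong[of _ _ "\<lambda>b. substitute b _"] ext) (simp add: conjugate_simps)
  also have "\<dots> = poly_in (primitive (map_poly \<sigma> p)) (X 1) + poly_in (primitive (map_poly \<sigma> p)) (X 2)"
    unfolding g_poly(2) by (simp only: conjugate_simps conjugate_poly_in primitive_map_poly)
  finally show "substitute elementary (conjugate \<sigma> (g_poly p)) =
      poly_in (primitive (map_poly \<sigma> p)) (X 1) + poly_in (primitive (map_poly \<sigma> p)) (X 2)" .
  show "vars (conjugate \<sigma> (g_poly p)) \<subseteq> {1, 2}" unfolding vars_conjugate by (rule g_poly(1))
qed

lemma conjugate_g_at: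
  "conjugate \<sigma> (g_at p s t) = g_at (map_poly \<sigma> p) (conjugate \<sigma> s) (conjugate \<sigma> t)"
  unfolding g_at_def g_poly_map_poly conjugate_substitute
  by (intro arg_cong[of _ _ "\<lambda>b. substitute b _"] ext) simp

lemma u1_poly_map_poly: "u1_poly (map_poly \<sigma> p) = conjugate \<sigma> (u1_poly p)"
  unfolding u1_poly_def
  by (subst conjugate_exact_quotient[OF u1_denominator_nonzero u1_poly_dvd])
    (simp add: conjugate_simps conjugate_g_at)

lemma u2_poly_map_poly: "u2_poly (map_poly \<sigma> p) = conjugate \<sigma> (u2_poly p)"
  unfolding u2_poly_def
  by (subst conjugate_exact_quotient[OF u2_denominator_nonzero u2_poly_dvd])
    (simp add: conjugate_simps conjugate_g_at)

lemma conjugate_substitute_vars: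
  "conjugate \<sigma> (substitute (\<lambda>i. X (h i)) f) = substitute (\<lambda>i. X (h i)) (conjugate \<sigma> f)"
  unfolding conjugate_substitute by (simp add: conjugate_simps)

lemma arc_at_map_poly: "arc_at (map_poly \<sigma> p) i j = conjugate \<sigma> (arc_at p i j)"
  unfolding arc_at_def arc_poly_map_poly conjugate_substitute
  by (intro arg_cong[of _ _ "\<lambda>b. substitute b _"] ext) (simp add: conjugate_simps)

lemma chi_poly_map_poly: "chi_poly (map_poly \<sigma> p) = conjugate \<sigma> (chi_poly p)"
  unfolding chi_poly_def
  by (subst conjugate_exact_quotient[OF X_diff_nonzero chi_poly_dvd])
    (simp_all add: conjugate_simps arc_at_map_poly u1_poly_map_poly u2_poly_map_poly)

lemma conjugate_at_crossing: "conjugate \<sigma> (at_crossing c f) = at_crossing c (conjugate \<sigma> f)"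
  unfolding at_crossing_def by (rule conjugate_substitute_vars)

end

lemma conjugate_inverse:
  assumes "field_automorphism \<sigma>" "field_automorphism \<tau>" "\<And>c. \<tau> (\<sigma> c) = c"
  shows "conjugate \<tau> (conjugate \<sigma> f) = f"
  by (rule poly_mapping_eqI) (simp add: lookup_conjugate assms)

section \<open>The Khovanov--Rozansky maps\<close>

text \<open>The subsets that index basis elements are read as bit vectors with one bit per factor:
  the differential flips single bits, and the maps at a crossing rewrite two adjacent ones.\<close>

definition put_bit :: "nat \<Rightarrow> bool \<Rightarrow> nat set \<Rightarrow> nat set" where
  "put_bit m a S = (if a then insert m S else S - {m})"

definition flip :: "nat \<Rightarrow> nat set \<Rightarrow> nat set" where
  "flip m S = put_bit m (m \<notin> S) S"

definition koszul_sign :: "nat \<Rightarrow> nat set \<Rightarrow> 'a::comm_ring_1" where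
  "koszul_sign m S = (-1) ^ card {j \<in> S. j < m}"

definition factor_coeff :: "factor \<Rightarrow> bool \<Rightarrow> mpoly" where
  "factor_coeff f a = (if a then fst f else fst (snd f))"

lemma put_bit_commute: "m \<noteq> k \<Longrightarrow> put_bit m a (put_bit k b S) = put_bit k b (put_bit m a S)"
  by (auto simp: put_bit_def)

lemma put_bit_put_bit: "put_bit m a (put_bit m b S) = put_bit m a S"
  by (auto simp: put_bit_def)

lemma in_put_bit: "j \<in> put_bit m a S \<longleftrightarrow> (if j = m then a else j \<in> S)"
  by (auto simp: put_bit_def)

lemma mf_differential_eq:
  "mf_differential fs x S =
     (\<Sum>m<length fs. koszul_sign m S * (factor_coeff (fs ! m) (m \<in> S) * x (flip m S)))"
  unfolding mf_differential_def
  by (intro sum.cong refl)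
    (auto simp: koszul_sign_def factor_coeff_def flip_def put_bit_def split: prod.splits)

text \<open>In \<open>M \<alpha> \<beta> a b\<close> the bits \<open>\<alpha>, \<beta>\<close> index the output and \<open>a, b\<close> the input.\<close>

definition local_op :: "(bool \<Rightarrow> bool \<Rightarrow> bool \<Rightarrow> bool \<Rightarrow> mpoly) \<Rightarrow> nat \<Rightarrow> mf \<Rightarrow> mf" where
  "local_op M A x S = (\<Sum>a\<in>UNIV. \<Sum>b\<in>UNIV.
     M (A \<in> S) (Suc A \<in> S) a b * x (put_bit A a (put_bit (Suc A) b S)))"

text \<open>The condition under which an operator on two adjacent factors passes the differentials
  of the other factors without a sign.\<close>

definition parity_preserving :: "(bool \<Rightarrow> bool \<Rightarrow> bool \<Rightarrow> bool \<Rightarrow> mpoly) \<Rightarrow> bool" where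
  "parity_preserving M \<longleftrightarrow> (\<forall>\<alpha> \<beta> a b. (\<alpha> = \<beta>) \<noteq> (a = b) \<longrightarrow> M \<alpha> \<beta> a b = 0)"

definition local_differential :: "factor \<Rightarrow> factor \<Rightarrow> (bool \<Rightarrow> bool \<Rightarrow> mpoly) \<Rightarrow> bool \<Rightarrow> bool \<Rightarrow> mpoly" where
  "local_differential f g y \<alpha> \<beta> = factor_coeff f \<alpha> * y (\<not> \<alpha>) \<beta> +
     (if \<alpha> then -1 else 1) * (factor_coeff g \<beta> * y \<alpha> (\<not> \<beta>))"

definition local_matrix :: "(bool \<Rightarrow> bool \<Rightarrow> bool \<Rightarrow> bool \<Rightarrow> mpoly) \<Rightarrow> (bool \<Rightarrow> bool \<Rightarrow> mpoly) \<Rightarrow> bool \<Rightarrow> bool \<Rightarrow> mpoly" where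
  "local_matrix M y \<alpha> \<beta> = (\<Sum>a\<in>UNIV. \<Sum>b\<in>UNIV. M \<alpha> \<beta> a b * y a b)"

text \<open>Rewriting the bits at \<open>A\<close> and \<open>Suc A\<close> without changing their
  parity alters the number of bits set below \<open>m\<close> by an even number, since either both
  positions lie below \<open>m\<close> or neither does.\<close>

lemma koszul_sign_far:
  assumes "m \<noteq> A" "m \<noteq> Suc A" "(A \<in> S) = (Suc A \<in> S) \<longleftrightarrow> a = b"
  shows "koszul_sign m (put_bit A a (put_bit (Suc A) b S)) = koszul_sign m S"
proof (cases "m < A")
  case True
  then have "{j \<in> put_bit A a (put_bit (Suc A) b S). j < m} = {j \<in> S. j < m}"
    by (auto simp: in_put_bit)
  then show ?thesis by (simp add: koszul_sign_def)
next
  case False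
  define T where "T = {j \<in> S. j < m \<and> j \<noteq> A \<and> j \<noteq> Suc A}"
  have T: "finite T" "A \<notin> T" "Suc A \<notin> T" by (auto simp: T_def)
  have card: "card {j \<in> U. j < m} = card T + of_bool (A \<in> U) + of_bool (Suc A \<in> U)"
    if U: "\<And>j. j \<noteq> A \<Longrightarrow> j \<noteq> Suc A \<Longrightarrow> j \<in> U \<longleftrightarrow> j \<in> S" for U
  proof -
    have "{j \<in> U. j < m} = T \<union> ((if A \<in> U then {A} else {}) \<union> (if Suc A \<in> U then {Suc A} else {}))"
    proof (rule Set.set_eqI)
      fix x
      show "x \<in> {j \<in> U. j < m} \<longleftrightarrow>
          x \<in> T \<union> ((if A \<in> U then {A} else {}) \<union> (if Suc A \<in> U then {Suc A} else {}))"
        using False assms(1,2) U[of x] unfolding T_def by (cases "x = A"; cases "x = Suc A") auto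
    qed
    also have "card \<dots> = card T + of_bool (A \<in> U) + of_bool (Suc A \<in> U)"
      using T by auto
    finally show ?thesis .
  qed
  show ?thesis
    unfolding koszul_sign_def using assms(3)
    by (subst (1 2) card) (auto simp: in_put_bit power_add split: if_splits)
qed

lemma koszul_sign_near:
  "koszul_sign A (put_bit A a (put_bit (Suc A) b S)) = koszul_sign A S"
  "koszul_sign (Suc A) (put_bit A a (put_bit (Suc A) b S)) = koszul_sign A S * (if a then -1 else 1)"
proof -
  have "{j \<in> put_bit A a (put_bit (Suc A) b S). j < A} = {j \<in> S. j < A}"
    by (auto simp: in_put_bit)
  then show "koszul_sign A (put_bit A a (put_bit (Suc A) b S)) = koszul_sign A S"
    by (simp add: koszul_sign_def)
  have "{j \<in> put_bit A a (put_bit (Suc A) b S). j < Suc A} = (if a then {A} else {}) \<union> {j \<in> S. j < A}"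
    by (auto simp: in_put_bit less_Suc_eq)
  then show "koszul_sign (Suc A) (put_bit A a (put_bit (Suc A) b S)) = koszul_sign A S * (if a then -1 else 1)"
    by (simp add: koszul_sign_def)
qed

lemma local_op_eq_local_matrix:
  "local_op M A x (put_bit A \<alpha> (put_bit (Suc A) \<beta> S)) =
     local_matrix M (\<lambda>a b. x (put_bit A a (put_bit (Suc A) b S))) \<alpha> \<beta>"
  unfolding local_op_def local_matrix_def
  by (simp add: in_put_bit put_bit_put_bit put_bit_commute[of "Suc A" A])

text \<open>The differential splits into the terms at \<open>A\<close> and \<open>Suc A\<close> and
  the rest. The former are treated by \<open>near\<close>, up to the common sign
  \<open>koszul_sign A S\<close>. The rest commute with the operator because its matrix depends on
  the two local bits only and preserves parity.\<close>

lemma local_op_chain_map: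
  assumes len: "length fs' = length fs" "Suc A < length fs"
    and far: "\<And>m. m < length fs \<Longrightarrow> m \<noteq> A \<Longrightarrow> m \<noteq> Suc A \<Longrightarrow> fs' ! m = fs ! m"
    and par: "parity_preserving M"
    and near: "\<And>y \<alpha> \<beta>. local_differential (fs' ! A) (fs' ! Suc A) (local_matrix M y) \<alpha> \<beta> =
      local_matrix M (local_differential (fs ! A) (fs ! Suc A) y) \<alpha> \<beta>"
  shows "mf_differential fs' (local_op M A x) S = local_op M A (mf_differential fs x) S"
proof -
  define R where "R = {..<length fs} - {A, Suc A}"
  have split: "(\<Sum>m<length fs. h m) = (h A + h (Suc A)) + (\<Sum>m\<in>R. h m)" for h :: "nat \<Rightarrow> mpoly"
  proof -
    have "{..<length fs} = insert A (insert (Suc A) R)" using len(2) unfolding R_def by auto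
    moreover have "finite R" "A \<notin> R" "Suc A \<notin> R" by (auto simp: R_def)
    ultimately show ?thesis by (simp add: add.assoc)
  qed
  let ?B = "Suc A"
  define \<alpha> \<beta> where "\<alpha> = (A \<in> S)" and "\<beta> = (?B \<in> S)"
  let ?S = "\<lambda>a b. put_bit A a (put_bit ?B b S)"
  have S: "?S \<alpha> \<beta> = S" by (auto simp: in_put_bit \<alpha>_def \<beta>_def split: if_splits)
  have flip_near: "flip A (?S a b) = ?S (\<not> a) b" "flip ?B (?S a b) = ?S a (\<not> b)" for a b
    by (auto simp: flip_def in_put_bit put_bit_put_bit put_bit_commute[of A ?B])
  define y where "y = (\<lambda>a b. x (?S a b))"
  have near_sum: "koszul_sign A (?S a b) * (factor_coeff (gs ! A) (A \<in> ?S a b) * z (flip A (?S a b))) +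
      koszul_sign ?B (?S a b) * (factor_coeff (gs ! ?B) (?B \<in> ?S a b) * z (flip ?B (?S a b))) =
      koszul_sign A S * local_differential (gs ! A) (gs ! ?B) (\<lambda>a b. z (?S a b)) a b" for gs z a b
    unfolding flip_near koszul_sign_near local_differential_def
    by (simp add: in_put_bit algebra_simps)
  \<comment> \<open>If the parities of the output and input bits differ, both sides vanish with the
    matrix entry; otherwise the signs agree by \<open>koszul_sign_far\<close>.\<close>
  have far_sum: "M \<alpha> \<beta> a b * (koszul_sign m (?S a b) * (factor_coeff (fs ! m) (m \<in> ?S a b) * x (flip m (?S a b)))) =
      koszul_sign m S * (factor_coeff (fs' ! m) (m \<in> S) *
        (M \<alpha> \<beta> a b * x (put_bit A a (put_bit ?B b (flip m S)))))" if "m \<in> R" for m a b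
  proof (cases "(\<alpha> = \<beta>) = (a = b)")
    case True
    have m: "m < length fs" "m \<noteq> A" "m \<noteq> ?B" using that by (auto simp: R_def)
    have "koszul_sign m (?S a b) = (koszul_sign m S :: mpoly)"
      by (rule koszul_sign_far[OF m(2,3)]) (use True in \<open>simp add: \<alpha>_def \<beta>_def\<close>)
    moreover have "flip m (?S a b) = put_bit A a (put_bit ?B b (flip m S))"
      using m by (auto simp: flip_def in_put_bit split: if_splits)
    moreover have "m \<in> ?S a b \<longleftrightarrow> m \<in> S" using m by (simp add: in_put_bit)
    ultimately show ?thesis using far[OF m] by (simp add: algebra_simps)
  next
    case False
    then have "M \<alpha> \<beta> a b = 0"
      using par[unfolded parity_preserving_def, THEN spec, THEN spec, THEN spec, THEN spec, of \<alpha> \<beta> a b] by simp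
    then show ?thesis by simp
  qed
  have full: "mf_differential gs z (?S a b) =
      koszul_sign A S * local_differential (gs ! A) (gs ! ?B) (\<lambda>a b. z (?S a b)) a b +
      (\<Sum>m\<in>R. koszul_sign m (?S a b) * (factor_coeff (gs ! m) (m \<in> ?S a b) * z (flip m (?S a b))))"
    if "length gs = length fs" for gs z a b
    unfolding mf_differential_eq that split by (rule arg_cong2[where f = "(+)", OF near_sum refl])
  have "mf_differential fs' (local_op M A x) S =
      koszul_sign A S * local_differential (fs' ! A) (fs' ! ?B) (local_matrix M y) \<alpha> \<beta> +
      (\<Sum>m\<in>R. koszul_sign m S * (factor_coeff (fs' ! m) (m \<in> S) * local_op M A x (flip m S)))"
    using full[OF len(1), of "local_op M A x" \<alpha> \<beta>] unfolding S local_op_eq_local_matrix y_def .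
  also have "(\<Sum>m\<in>R. koszul_sign m S * (factor_coeff (fs' ! m) (m \<in> S) * local_op M A x (flip m S))) =
      (\<Sum>m\<in>R. \<Sum>a\<in>UNIV. \<Sum>b\<in>UNIV. koszul_sign m S * (factor_coeff (fs' ! m) (m \<in> S) *
        (M \<alpha> \<beta> a b * x (put_bit A a (put_bit ?B b (flip m S))))))"
  proof (intro sum.cong refl)
    fix m assume "m \<in> R"
    then have "A \<in> flip m S \<longleftrightarrow> \<alpha>" "?B \<in> flip m S \<longleftrightarrow> \<beta>"
      by (auto simp: R_def flip_def in_put_bit \<alpha>_def \<beta>_def)
    then show "koszul_sign m S * (factor_coeff (fs' ! m) (m \<in> S) * local_op M A x (flip m S)) =
      (\<Sum>a\<in>UNIV. \<Sum>b\<in>UNIV. koszul_sign m S * (factor_coeff (fs' ! m) (m \<in> S) *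
        (M \<alpha> \<beta> a b * x (put_bit A a (put_bit ?B b (flip m S))))))"
      by (simp add: local_op_def sum_distrib_left)
  qed
  also have "\<dots> = (\<Sum>m\<in>R. \<Sum>a\<in>UNIV. \<Sum>b\<in>UNIV. M \<alpha> \<beta> a b *
      (koszul_sign m (?S a b) * (factor_coeff (fs ! m) (m \<in> ?S a b) * x (flip m (?S a b)))))"
    by (intro sum.cong refl) (simp add: far_sum)
  also have "\<dots> = (\<Sum>a\<in>UNIV. \<Sum>b\<in>UNIV. M \<alpha> \<beta> a b * (\<Sum>m\<in>R.
      koszul_sign m (?S a b) * (factor_coeff (fs ! m) (m \<in> ?S a b) * x (flip m (?S a b)))))"
    unfolding sum_distrib_left by (subst sum.swap) (intro sum.cong refl sum.swap)
  also have "koszul_sign A S * local_differential (fs' ! A) (fs' ! ?B) (local_matrix M y) \<alpha> \<beta> =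
      (\<Sum>a\<in>UNIV. \<Sum>b\<in>UNIV. M \<alpha> \<beta> a b * (koszul_sign A S * local_differential (fs ! A) (fs ! ?B) y a b))"
    unfolding near by (simp add: local_matrix_def sum_distrib_left mult.left_commute)
  finally have "mf_differential fs' (local_op M A x) S =
      (\<Sum>a\<in>UNIV. \<Sum>b\<in>UNIV. M \<alpha> \<beta> a b * (koszul_sign A S * local_differential (fs ! A) (fs ! ?B) y a b)) +
      (\<Sum>a\<in>UNIV. \<Sum>b\<in>UNIV. M \<alpha> \<beta> a b * (\<Sum>m\<in>R.
        koszul_sign m (?S a b) * (factor_coeff (fs ! m) (m \<in> ?S a b) * x (flip m (?S a b)))))" .
  also have "\<dots> = (\<Sum>a\<in>UNIV. \<Sum>b\<in>UNIV. M \<alpha> \<beta> a b * mf_differential fs x (?S a b))"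
    unfolding full[OF refl] y_def by (simp add: sum.distrib distrib_left)
  also have "\<dots> = local_op M A (mf_differential fs x) S"
    by (simp add: local_op_def \<alpha>_def \<beta>_def)
  finally show ?thesis .
qed

text \<open>The two operators read and change disjoint pairs of bits, and their entries lie in a
  commutative ring.\<close>

lemma local_op_commute:
  assumes "A \<noteq> A'" "A \<noteq> Suc A'" "Suc A \<noteq> A'"
  shows "local_op M A (local_op M' A' x) S = local_op M' A' (local_op M A x) S"
proof -
  let ?U = "\<lambda>a b. put_bit A a (put_bit (Suc A) b S)" and ?U' = "\<lambda>a b. put_bit A' a (put_bit (Suc A') b S)"
  have comm: "put_bit A' a' (put_bit (Suc A') b' (?U a b)) = put_bit A a (put_bit (Suc A) b (?U' a' b'))"
    for a b a' b'
    using assms by (auto simp: in_put_bit split: if_splits)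
  have "local_op M A (local_op M' A' x) S = (\<Sum>a\<in>UNIV. \<Sum>b\<in>UNIV. \<Sum>a'\<in>UNIV. \<Sum>b'\<in>UNIV.
      M (A \<in> S) (Suc A \<in> S) a b * M' (A' \<in> S) (Suc A' \<in> S) a' b' * x (put_bit A a (put_bit (Suc A) b (?U' a' b'))))"
    unfolding local_op_def comm sum_distrib_left using assms
    by (simp add: in_put_bit mult.assoc)
  also have "\<dots> = local_op M' A' (local_op M A x) S"
    unfolding local_op_def sum_distrib_left using assms
    by (simp add: UNIV_bool in_put_bit algebra_simps)
  finally show ?thesis .
qed

lemma local_op_add: "local_op M A (x + y) = local_op M A x + local_op M A y"
  by (rule ext) (simp add: local_op_def distrib_left sum.distrib)

lemma local_op_scale: "local_op M A (\<lambda>S. c * x S) = (\<lambda>S. c * local_op M A x S)"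
  by (rule ext) (simp add: local_op_def sum_distrib_left mult.left_commute)

fun chi0_matrix :: "mpoly \<Rightarrow> mpoly \<Rightarrow> mpoly \<Rightarrow> bool \<Rightarrow> bool \<Rightarrow> bool \<Rightarrow> bool \<Rightarrow> mpoly" where
  "chi0_matrix x1 x3 c False False False False = x1 - x3"
| "chi0_matrix x1 x3 c True False True False = x1"
| "chi0_matrix x1 x3 c True False False True = - x3"
| "chi0_matrix x1 x3 c False True False True = 1"
| "chi0_matrix x1 x3 c False True True False = - 1"
| "chi0_matrix x1 x3 c True True True True = 1"
| "chi0_matrix x1 x3 c True True False False = - c"
| "chi0_matrix x1 x3 c _ _ _ _ = 0"

fun chi1_matrix :: "mpoly \<Rightarrow> mpoly \<Rightarrow> mpoly \<Rightarrow> bool \<Rightarrow> bool \<Rightarrow> bool \<Rightarrow> bool \<Rightarrow> mpoly" where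
  "chi1_matrix x1 x3 c False False False False = 1"
| "chi1_matrix x1 x3 c True False True False = 1"
| "chi1_matrix x1 x3 c True False False True = x3"
| "chi1_matrix x1 x3 c False True True False = 1"
| "chi1_matrix x1 x3 c False True False True = x1"
| "chi1_matrix x1 x3 c True True True True = x1 - x3"
| "chi1_matrix x1 x3 c True True False False = c"
| "chi1_matrix x1 x3 c _ _ _ _ = 0"

lemma parity_chi: "parity_preserving (chi0_matrix x1 x3 c)" "parity_preserving (chi1_matrix x1 x3 c)"
  unfolding parity_preserving_def by (simp_all add: all_bool_eq)

lemma chi0_eq: "chi0 p D k = local_op (chi0_matrix (X (e1 (crossings D ! k))) (X (e3 (crossings D ! k)))
    (at_crossing (crossings D ! k) (chi_poly p))) (2 * k)"
proof (intro ext)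
  fix x S
  let ?A = "2 * k" and ?B = "Suc (2 * k)"
  have "put_bit ?A a (put_bit ?B b S) = S - {?A, ?B} \<union> ((if a then {?A} else {}) \<union> (if b then {?B} else {}))" for a b
    by (auto simp: put_bit_def)
  then show "chi0 p D k x S = local_op (chi0_matrix (X (e1 (crossings D ! k))) (X (e3 (crossings D ! k)))
    (at_crossing (crossings D ! k) (chi_poly p))) (2 * k) x S"
    unfolding chi0_def local_op_def Let_def
    by (cases "?A \<in> S"; cases "?B \<in> S") (simp_all add: UNIV_bool insert_commute)
qed

lemma chi1_eq: "chi1 p D k = local_op (chi1_matrix (X (e1 (crossings D ! k))) (X (e3 (crossings D ! k)))
    (at_crossing (crossings D ! k) (chi_poly p))) (2 * k)"
proof (intro ext)
  fix x S
  let ?A = "2 * k" and ?B = "Suc (2 * k)"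
  have "put_bit ?A a (put_bit ?B b S) = S - {?A, ?B} \<union> ((if a then {?A} else {}) \<union> (if b then {?B} else {}))" for a b
    by (auto simp: put_bit_def)
  then show "chi1 p D k x S = local_op (chi1_matrix (X (e1 (crossings D ! k))) (X (e3 (crossings D ! k)))
    (at_crossing (crossings D ! k) (chi_poly p))) (2 * k) x S"
    unfolding chi1_def local_op_def Let_def
    by (cases "?A \<in> S"; cases "?B \<in> S") (simp_all add: UNIV_bool insert_commute)
qed

text \<open>A check over the four values of the output bits. The assumptions are the relations
  \<open>chi_poly0\<close> and \<open>chi_poly1\<close>, which \<open>arc_at_crossing\<close>
  provides at every crossing.\<close>

lemma chi0_local_chain_map:
  assumes "a0 = u1 + x3 * u2 + c * (x2 - x3)" "a1 = u1 + x1 * u2 - c * (x1 - x4)"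
  shows "local_differential (u1, x1 + x2 - x3 - x4, s) (u2, x1 * x2 - x3 * x4, s')
      (local_matrix (chi0_matrix x1 x3 c) y) \<alpha> \<beta> =
    local_matrix (chi0_matrix x1 x3 c)
      (local_differential (a0, x1 - x4, t) (a1, x2 - x3, t') y) \<alpha> \<beta>"
  unfolding local_differential_def local_matrix_def assms
  by (cases \<alpha>; cases \<beta>) (simp_all add: UNIV_bool factor_coeff_def algebra_simps)

lemma chi1_local_chain_map:
  assumes "a0 = u1 + x3 * u2 + c * (x2 - x3)" "a1 = u1 + x1 * u2 - c * (x1 - x4)"
  shows "local_differential (a0, x1 - x4, t) (a1, x2 - x3, t')
      (local_matrix (chi1_matrix x1 x3 c) y) \<alpha> \<beta> =
    local_matrix (chi1_matrix x1 x3 c)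
      (local_differential (u1, x1 + x2 - x3 - x4, s) (u2, x1 * x2 - x3 * x4, s') y) \<alpha> \<beta>"
  unfolding local_differential_def local_matrix_def assms
  by (cases \<alpha>; cases \<beta>) (simp_all add: UNIV_bool factor_coeff_def algebra_simps)

section \<open>Cycles and boundaries of the resolutions\<close>

definition mf_scale :: "complex \<Rightarrow> mf \<Rightarrow> mf" where
  "mf_scale c x = (\<lambda>S. Const c * x S)"

lemma complex_vector_space_mf_scale: "complex_vector_space mf_scale"
  by unfold_locales (auto simp: mf_scale_def fun_eq_iff Const_simps algebra_simps)

interpretation mf: complex_vector_space mf_scale by (rule complex_vector_space_mf_scale)

lemma mf_differential_add: "mf_differential fs (x + y) = mf_differential fs x + mf_differential fs y"
  by (rule ext) (simp add: mf_differential_eq sum.distrib distrib_left)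

lemma mf_differential_scale: "mf_differential fs (mf_scale c x) = mf_scale c (mf_differential fs x)"
  by (rule ext) (simp add: mf_differential_eq mf_scale_def sum_distrib_left mult.left_commute)

lemma length_concat_pairs: "(\<And>k. length (f k) = 2) \<Longrightarrow> length (concat (map f [0..<n])) = 2 * n"
  by (induction n) simp_all

lemma concat_pairs_nth:
  assumes f: "\<And>k. length (f k) = 2"
  shows "k < n \<Longrightarrow> r < 2 \<Longrightarrow> concat (map f [0..<n]) ! (2 * k + r) = f k ! r"
proof (induction n)
  case (Suc n)
  show ?case
  proof (cases "k = n")
    case True
    then show ?thesis using Suc.prems length_concat_pairs[of f n, OF f] by (simp add: nth_append)
  next
    case False
    then have "2 * k + r < 2 * n" using Suc.prems by simp
    then show ?thesis using Suc False length_concat_pairs[of f n, OF f] by (simp add: nth_append)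
  qed
qed simp

definition num_factors :: "diagram \<Rightarrow> nat" where
  "num_factors D = 2 * length (crossings D) + length (circles D)"

lemma length_crossing_factors: "length (crossing_factors p t c) = 2"
  by (simp add: crossing_factors_def)

lemma length_graph_factors: "length (graph_factors p D V) = num_factors D"
  by (simp add: graph_factors_def num_factors_def length_concat_pairs length_crossing_factors)

lemma graph_factors_nth:
  assumes "k < length (crossings D)" "r < 2"
  shows "graph_factors p D V ! (2 * k + r) = crossing_factors p (k \<in> V) (crossings D ! k) ! r"
proof -
  let ?f = "\<lambda>k. crossing_factors p (k \<in> V) (crossings D ! k)"
  have "2 * k + r < 2 * length (crossings D)" using assms by simp
  then show ?thesis
    using concat_pairs_nth[of ?f, OF length_crossing_factors assms]
    by (simp add: graph_factors_def nth_append length_concat_pairs length_crossing_factors)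
qed

lemma graph_factors_far:
  assumes "\<And>j. j \<noteq> k \<Longrightarrow> j \<in> V \<longleftrightarrow> j \<in> W" "m \<noteq> 2 * k" "m \<noteq> Suc (2 * k)"
  shows "graph_factors p D V ! m = graph_factors p D W ! m"
proof (cases "m < 2 * length (crossings D)")
  case True
  have eq: "m = 2 * (m div 2) + m mod 2" "m mod 2 < 2" by simp_all
  have "m div 2 < length (crossings D)" using True by simp
  moreover have "m div 2 \<noteq> k" using assms(2,3) by (metis eq mod2_eq_if add.right_neutral add_Suc_right One_nat_def)
  ultimately show ?thesis
    using graph_factors_nth[of "m div 2" D "m mod 2" p V] graph_factors_nth[of "m div 2" D "m mod 2" p W]
      assms(1)[of "m div 2"] eq by simp
next
  case False
  then show ?thesis
    by (simp add: graph_factors_def nth_append length_concat_pairs length_crossing_factors)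
qed

lemma at_crossing_simps:
  "at_crossing c (f + g) = at_crossing c f + at_crossing c g"
  "at_crossing c (f - g) = at_crossing c f - at_crossing c g"
  "at_crossing c (f * g) = at_crossing c f * at_crossing c g"
  "at_crossing c (X 1) = X (e1 c)" "at_crossing c (X 2) = X (e2 c)"
  "at_crossing c (X 3) = X (e3 c)" "at_crossing c (X 4) = X (e4 c)"
  by (simp_all add: at_crossing_def substitute_simps)

lemma at_crossing_arc_at:
  "at_crossing c (arc_at p 1 4) = arc_at p (e1 c) (e4 c)"
  "at_crossing c (arc_at p 2 3) = arc_at p (e2 c) (e3 c)"
  unfolding at_crossing_def arc_at_def substitute_substitute
  by (intro arg_cong[of _ _ "\<lambda>b. substitute b _"] ext; simp add: substitute_simps)+

lemma arc_at_crossing: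
  "arc_at p (e1 c) (e4 c) = at_crossing c (u1_poly p) + X (e3 c) * at_crossing c (u2_poly p) +
     at_crossing c (chi_poly p) * (X (e2 c) - X (e3 c))"
  "arc_at p (e2 c) (e3 c) = at_crossing c (u1_poly p) + X (e1 c) * at_crossing c (u2_poly p) -
     at_crossing c (chi_poly p) * (X (e1 c) - X (e4 c))"
  using arg_cong[OF chi_poly0[of p], of "at_crossing c"] arg_cong[OF chi_poly1[of p], of "at_crossing c"]
  by (simp_all only: at_crossing_arc_at at_crossing_simps)

lemma chi0_chain_map:
  assumes "k < length (crossings D)" "k \<in> W"
  shows "mf_differential (graph_factors p D W) (chi0 p D k x) =
    chi0 p D k (mf_differential (graph_factors p D (flip k W)) x)"
proof (rule ext)
  fix S
  have V: "k \<notin> flip k W" "\<And>j. j \<noteq> k \<Longrightarrow> j \<in> W \<longleftrightarrow> j \<in> flip k W"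
    using assms(2) by (auto simp: flip_def in_put_bit)
  show "mf_differential (graph_factors p D W) (chi0 p D k x) S =
    chi0 p D k (mf_differential (graph_factors p D (flip k W)) x) S"
    unfolding chi0_eq
  proof (rule local_op_chain_map)
    show "Suc (2 * k) < length (graph_factors p D (flip k W))"
      using assms(1) by (simp add: length_graph_factors num_factors_def)
    fix y \<alpha> \<beta>
    show "local_differential (graph_factors p D W ! (2 * k)) (graph_factors p D W ! Suc (2 * k))
        (local_matrix (chi0_matrix (X (e1 (crossings D ! k))) (X (e3 (crossings D ! k)))
          (at_crossing (crossings D ! k) (chi_poly p))) y) \<alpha> \<beta> =
      local_matrix (chi0_matrix (X (e1 (crossings D ! k))) (X (e3 (crossings D ! k)))
          (at_crossing (crossings D ! k) (chi_poly p)))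
        (local_differential (graph_factors p D (flip k W) ! (2 * k)) (graph_factors p D (flip k W) ! Suc (2 * k)) y) \<alpha> \<beta>"
      using graph_factors_nth[OF assms(1), of 0 p] graph_factors_nth[OF assms(1), of 1 p] assms(2) V(1)
      by (simp add: crossing_factors_def arc_factor_def chi0_local_chain_map[OF arc_at_crossing])
  qed (simp_all add: length_graph_factors parity_chi graph_factors_far[OF V(2)])
qed

lemma chi1_chain_map:
  assumes "k < length (crossings D)" "k \<notin> W"
  shows "mf_differential (graph_factors p D W) (chi1 p D k x) =
    chi1 p D k (mf_differential (graph_factors p D (flip k W)) x)"
proof (rule ext)
  fix S
  have V: "k \<in> flip k W" "\<And>j. j \<noteq> k \<Longrightarrow> j \<in> W \<longleftrightarrow> j \<in> flip k W"
    using assms(2) by (auto simp: flip_def in_put_bit)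
  show "mf_differential (graph_factors p D W) (chi1 p D k x) S =
    chi1 p D k (mf_differential (graph_factors p D (flip k W)) x) S"
    unfolding chi1_eq
  proof (rule local_op_chain_map)
    show "Suc (2 * k) < length (graph_factors p D (flip k W))"
      using assms(1) by (simp add: length_graph_factors num_factors_def)
    fix y \<alpha> \<beta>
    show "local_differential (graph_factors p D W ! (2 * k)) (graph_factors p D W ! Suc (2 * k))
        (local_matrix (chi1_matrix (X (e1 (crossings D ! k))) (X (e3 (crossings D ! k)))
          (at_crossing (crossings D ! k) (chi_poly p))) y) \<alpha> \<beta> =
      local_matrix (chi1_matrix (X (e1 (crossings D ! k))) (X (e3 (crossings D ! k)))
          (at_crossing (crossings D ! k) (chi_poly p)))
        (local_differential (graph_factors p D (flip k W) ! (2 * k)) (graph_factors p D (flip k W) ! Suc (2 * k)) y) \<alpha> \<beta>"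
      using graph_factors_nth[OF assms(1), of 0 p] graph_factors_nth[OF assms(1), of 1 p] assms(2) V(1)
      by (simp add: crossing_factors_def arc_factor_def chi1_local_chain_map[OF arc_at_crossing])
  qed (simp_all add: length_graph_factors parity_chi graph_factors_far[OF V(2)])
qed

definition crossing_map :: "complex poly \<Rightarrow> diagram \<Rightarrow> nat \<Rightarrow> mf \<Rightarrow> mf" where
  "crossing_map p D k = (if positive (crossings D ! k) then chi0 p D k else chi1 p D k)"

text \<open>The crossings whose edges of the cube end at \<open>W\<close>.\<close>

definition incoming :: "diagram \<Rightarrow> nat set \<Rightarrow> nat set" where
  "incoming D W = {k. k < length (crossings D) \<and> (positive (crossings D ! k) \<longleftrightarrow> k \<in> W)}"

lemma crossing_map_chain_map:
  "k \<in> incoming D W \<Longrightarrow> mf_differential (graph_factors p D W) (crossing_map p D k x) =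
    crossing_map p D k (mf_differential (graph_factors p D (flip k W)) x)"
  using chi0_chain_map[of k D W p x] chi1_chain_map[of k D W p x]
  by (auto simp: incoming_def crossing_map_def)

lemma crossing_map_local: "\<exists>M. crossing_map p D k = local_op M (2 * k)"
  unfolding crossing_map_def chi0_eq chi1_eq by auto

lemma crossing_map_add: "crossing_map p D k (x + y) = crossing_map p D k x + crossing_map p D k y"
  using crossing_map_local[of p D k] local_op_add by auto

lemma crossing_map_scale: "crossing_map p D k (mf_scale c x) = mf_scale c (crossing_map p D k x)"
  using crossing_map_local[of p D k] local_op_scale unfolding mf_scale_def by auto

lemma crossing_map_zero: "crossing_map p D k 0 = 0"
  using crossing_map_add[of p D k 0 0] by simp

lemma crossing_map_sum: "crossing_map p D k (\<Sum>i\<in>A. x i) = (\<Sum>i\<in>A. crossing_map p D k (x i))"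
  by (induction A rule: infinite_finite_induct)
    (simp_all only: sum.infinite sum.empty sum.insert not_False_eq_True crossing_map_zero crossing_map_add)

lemma crossing_map_commute:
  assumes "k \<noteq> l"
  shows "crossing_map p D k (crossing_map p D l x) = crossing_map p D l (crossing_map p D k x)"
proof -
  obtain M M' where M: "crossing_map p D k = local_op M (2 * k)" "crossing_map p D l = local_op M' (2 * l)"
    using crossing_map_local by metis
  have "2 * k \<noteq> Suc (2 * l)" "Suc (2 * k) \<noteq> 2 * l" by presburger+
  then show ?thesis unfolding M using assms by (intro ext local_op_commute) simp_all
qed

text \<open>The carrier of \<open>mf_module\<close> depends on a resolution only through its number
  of factors, which is the same for all resolutions and potentials; so one space serves the whole
  cube.\<close>

definition mf_space :: "diagram \<Rightarrow> mf set" where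
  "mf_space D = {x. (\<forall>S. vars (x S) \<subseteq> edges D) \<and> (\<forall>S. \<not> S \<subseteq> {..<num_factors D} \<longrightarrow> x S = 0)}"

lemma carrier_mf_module: "carrier (mf_module (edges D) (graph_factors p D V)) = mf_space D"
  by (simp add: mf_module_def mf_space_def length_graph_factors)

lemma vars_add_subset: "vars f \<subseteq> E \<Longrightarrow> vars g \<subseteq> E \<Longrightarrow> vars (f + g) \<subseteq> E"
  and vars_mult_subset: "vars f \<subseteq> E \<Longrightarrow> vars g \<subseteq> E \<Longrightarrow> vars (f * g) \<subseteq> E"
  using vars_add[of f g] vars_mult[of f g] by blast+

lemma vars_sum_subset: "(\<And>i. i \<in> A \<Longrightarrow> vars (f i) \<subseteq> E) \<Longrightarrow> vars (sum f A) \<subseteq> E"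
  by (induction A rule: infinite_finite_induct) (simp_all add: vars_zero vars_add_subset)

lemma mf_space_subspace: "mf.subspace (mf_space D)"
proof (rule mf.subspaceI)
  show "0 \<in> mf_space D" by (simp add: mf_space_def vars_zero)
  show "x + y \<in> mf_space D" if "x \<in> mf_space D" "y \<in> mf_space D" for x y
    using that by (simp add: mf_space_def vars_add_subset)
  show "mf_scale c x \<in> mf_space D" if "x \<in> mf_space D" for c x
    using that by (simp add: mf_space_def mf_scale_def vars_mult_subset vars_Const)
qed

lemma link_diagram_edges:
  assumes "link_diagram D" "k < length (crossings D)"
  shows "e1 (crossings D ! k) \<in> edges D" "e2 (crossings D ! k) \<in> edges D"
    "e3 (crossings D ! k) \<in> edges D" "e4 (crossings D ! k) \<in> edges D"
proof -
  have c: "crossings D ! k \<in> set (crossings D)" using assms(2) by simp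
  then show "e1 (crossings D ! k) \<in> edges D" "e2 (crossings D ! k) \<in> edges D"
    by (auto simp: edges_def out_edges_def)
  have "set (in_edges D) \<subseteq> edges D" using assms(1) by (simp add: link_diagram_def edges_def)
  then show "e3 (crossings D ! k) \<in> edges D" "e4 (crossings D ! k) \<in> edges D"
    using c by (auto simp: in_edges_def)
qed

lemma crossing_map_mf_space:
  assumes D: "link_diagram D" and k: "k < length (crossings D)" and x: "x \<in> mf_space D"
  shows "crossing_map p D k x \<in> mf_space D"
proof -
  note e = link_diagram_edges[OF D k]
  have "vars (at_crossing (crossings D ! k) f) \<subseteq> edges D" for f
    unfolding at_crossing_def by (rule vars_substitute) (use e in \<open>simp add: vars_X\<close>)
  then have chi: "vars (chi0_matrix (X (e1 (crossings D ! k))) (X (e3 (crossings D ! k)))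
      (at_crossing (crossings D ! k) (chi_poly p)) \<alpha> \<beta> a b) \<subseteq> edges D"
    "vars (chi1_matrix (X (e1 (crossings D ! k))) (X (e3 (crossings D ! k)))
      (at_crossing (crossings D ! k) (chi_poly p)) \<alpha> \<beta> a b) \<subseteq> edges D" for \<alpha> \<beta> a b
    using e vars_diff[of "X (e1 (crossings D ! k))" "X (e3 (crossings D ! k))"] vars_Const[of 1]
    by (cases \<alpha>; cases \<beta>; cases a; cases b; auto simp: vars_X vars_uminus vars_zero Const_simps)+
  obtain M where M: "crossing_map p D k = local_op M (2 * k)" "\<And>\<alpha> \<beta> a b. vars (M \<alpha> \<beta> a b) \<subseteq> edges D"
    using chi unfolding crossing_map_def chi0_eq chi1_eq by (cases "positive (crossings D ! k)") auto
  have "local_op M (2 * k) x \<in> mf_space D"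
    unfolding mf_space_def
  proof (intro CollectI conjI allI impI)
    fix S
    show "vars (local_op M (2 * k) x S) \<subseteq> edges D"
      unfolding local_op_def using x by (intro vars_sum_subset vars_mult_subset M(2)) (simp add: mf_space_def)
    assume S: "\<not> S \<subseteq> {..<num_factors D}"
    have "\<not> put_bit (2 * k) a (put_bit (Suc (2 * k)) b S) \<subseteq> {..<num_factors D}" for a b
    proof -
      obtain j where "j \<in> S" "j \<notin> {..<num_factors D}" using S by blast
      then have "j \<in> S" "j \<ge> num_factors D" by simp_all
      moreover have "2 * k < num_factors D" "Suc (2 * k) < num_factors D" using k by (auto simp: num_factors_def)
      ultimately have "j \<in> put_bit (2 * k) a (put_bit (Suc (2 * k)) b S)" by (simp add: in_put_bit)
      then show ?thesis using \<open>j \<ge> num_factors D\<close> by auto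
    qed
    then show "local_op M (2 * k) x S = 0" unfolding local_op_def using x by (simp add: mf_space_def)
  qed
  then show ?thesis unfolding M(1) .
qed

definition boundaries :: "complex poly \<Rightarrow> diagram \<Rightarrow> nat set \<Rightarrow> mf set" where
  "boundaries p D V = mf_differential (graph_factors p D V) ` mf_space D"

definition cycles :: "complex poly \<Rightarrow> diagram \<Rightarrow> nat set \<Rightarrow> mf set" where
  "cycles p D V = {x \<in> mf_space D. mf_differential (graph_factors p D V) x = 0}"

lemma mf_differential_zero: "mf_differential fs 0 = 0"
  using mf_differential_add[of fs 0 0] by simp

lemma boundaries_subspace: "mf.subspace (boundaries p D V)"
proof (rule mf.subspaceI)
  note sub = mf_space_subspace[of D]
  show "0 \<in> boundaries p D V"
    unfolding boundaries_def using mf.subspace_0[OF sub] mf_differential_zero by (metis imageI)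
  show "x + y \<in> boundaries p D V" if "x \<in> boundaries p D V" "y \<in> boundaries p D V" for x y
    using that unfolding boundaries_def
    by (auto simp: mf_differential_add[symmetric] intro!: imageI mf.subspace_add[OF sub])
  show "mf_scale c x \<in> boundaries p D V" if "x \<in> boundaries p D V" for c x
    using that unfolding boundaries_def
    by (auto simp: mf_differential_scale[symmetric] intro!: imageI mf.subspace_scale[OF sub])
qed

lemma cycles_subspace: "mf.subspace (cycles p D V)"
  by (rule mf.subspaceI)
    (auto simp: cycles_def mf_differential_add mf_differential_scale mf_differential_zero
      mf.subspace_0 mf.subspace_add mf.subspace_scale mf_space_subspace)

lemma crossing_map_cycles:
  assumes D: "link_diagram D" and k: "k \<in> incoming D W" and x: "x \<in> cycles p D (flip k W)"
  shows "crossing_map p D k x \<in> cycles p D W"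
  using x crossing_map_mf_space[OF D, of k x p] crossing_map_chain_map[OF k, of p x] k
  by (simp add: cycles_def incoming_def crossing_map_zero)

lemma crossing_map_boundaries:
  assumes D: "link_diagram D" and k: "k \<in> incoming D W" and x: "x \<in> boundaries p D (flip k W)"
  shows "crossing_map p D k x \<in> boundaries p D W"
proof -
  obtain y where y: "y \<in> mf_space D" "x = mf_differential (graph_factors p D (flip k W)) y"
    using x unfolding boundaries_def by blast
  have "crossing_map p D k x = mf_differential (graph_factors p D W) (crossing_map p D k y)"
    unfolding y(2) by (rule crossing_map_chain_map[OF k, symmetric])
  then show ?thesis
    unfolding boundaries_def using crossing_map_mf_space[OF D _ y(1)] k by (auto simp: incoming_def)
qed

section \<open>The complex of a diagram\<close>

text \<open>The form that \<open>a_r_coset\<close> takes for the addition of the type;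
  \<open>a_r_coset_mf\<close> makes the translation.\<close>

definition coset :: "mf set \<Rightarrow> mf \<Rightarrow> mf set" where
  "coset N x = (\<lambda>h. h + x) ` N"

lemma mem_coset: "y \<in> coset N x \<longleftrightarrow> y - x \<in> N"
  unfolding coset_def by (metis (no_types, lifting) add_diff_cancel diff_add_cancel image_iff)

lemma coset_eq_iff:
  assumes N: "mf.subspace N"
  shows "coset N x = coset N y \<longleftrightarrow> x - y \<in> N"
proof
  assume "coset N x = coset N y"
  moreover have "x \<in> coset N x" using mf.subspace_0[OF N] by (simp add: mem_coset)
  ultimately show "x - y \<in> N" by (simp add: mem_coset)
next
  assume xy: "x - y \<in> N"
  show "coset N x = coset N y"
  proof (rule Set.set_eqI)
    fix z
    have "z - y \<in> N" if "z - x \<in> N" using mf.subspace_add[OF N that xy] by simp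
    moreover have "z - x \<in> N" if "z - y \<in> N" using mf.subspace_diff[OF N that xy] by simp
    ultimately show "z \<in> coset N x \<longleftrightarrow> z \<in> coset N y" by (auto simp: mem_coset)
  qed
qed

lemma coset_add:
  assumes N: "mf.subspace N"
  shows "(\<Union>h\<in>coset N x. \<Union>k\<in>coset N y. {h + k}) = coset N (x + y)"
proof (intro equalityI subsetI)
  fix z assume "z \<in> (\<Union>h\<in>coset N x. \<Union>k\<in>coset N y. {h + k})"
  then obtain h k where hk: "h - x \<in> N" "k - y \<in> N" "z = h + k" by (auto simp: mem_coset)
  have eq: "z - (x + y) = (h - x) + (k - y)" by (simp add: hk(3))
  show "z \<in> coset N (x + y)" unfolding mem_coset eq by (rule mf.subspace_add[OF N hk(1,2)])
next
  fix z assume "z \<in> coset N (x + y)"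
  then have "z - y \<in> coset N x" "y \<in> coset N y" "z = (z - y) + y"
    using mf.subspace_0[OF N] by (simp_all add: mem_coset diff_diff_eq add.commute)
  then show "z \<in> (\<Union>h\<in>coset N x. \<Union>k\<in>coset N y. {h + k})" by blast
qed

text \<open>The unions in \<open>quotient_module\<close> and \<open>induced_map\<close> run over
  equal sets, as all representatives of a class have the same image class.\<close>

lemma coset_image:
  assumes N: "mf.subspace N" and f: "\<And>x y. f (x - y) = f x - f y" "\<And>x. x \<in> N' \<Longrightarrow> f x \<in> N"
    and N': "mf.subspace N'"
  shows "(\<Union>z\<in>coset N' x. coset N (f z)) = coset N (f x)"
proof -
  have "coset N (f z) = coset N (f x)" if "z \<in> coset N' x" for z
    using that f(2)[of "z - x"] by (simp add: coset_eq_iff[OF N] mem_coset f(1))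
  moreover have "x \<in> coset N' x" using mf.subspace_0[OF N'] by (simp add: mem_coset)
  ultimately show ?thesis by blast
qed

lemma a_r_coset_mf: "a_r_coset (mf_module E fs) N x = coset N x"
  "a_r_coset (mf_module E fs\<lparr>carrier := Z\<rparr>) N x = coset N x"
  unfolding a_r_coset_def' coset_def by (auto simp: mf_module_def plus_fun_def)

lemma set_add_mf: "set_add (mf_module E fs\<lparr>carrier := Z\<rparr>) A B = (\<Union>h\<in>A. \<Union>k\<in>B. {h + k})"
  unfolding set_add_def' by (simp add: mf_module_def plus_fun_def)

lemma mf_cocycles_eq: "mf_cocycles (edges D) (graph_factors p D V) = cycles p D V"
  by (simp add: mf_cocycles_def cycles_def carrier_mf_module zero_fun_def)

lemma mf_coboundaries_eq: "mf_coboundaries (edges D) (graph_factors p D V) = boundaries p D V"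
  by (simp add: mf_coboundaries_def boundaries_def carrier_mf_module)

lemma mf_scale_diff: "mf_scale c (x - y) = mf_scale c x - mf_scale c y"
  by (rule mf.scale_right_diff_distrib)

lemma graph_cohomology_carrier:
  "carrier (graph_cohomology p D V) = coset (boundaries p D V) ` cycles p D V"
  unfolding graph_cohomology_def mf_cohomology_def quotient_module_def
  by (simp add: A_RCOSETS_def' a_r_coset_mf mf_cocycles_eq mf_coboundaries_eq) blast

lemma graph_cohomology_add:
  "coset (boundaries p D V) x \<oplus>\<^bsub>graph_cohomology p D V\<^esub> coset (boundaries p D V) y =
    coset (boundaries p D V) (x + y)"
  unfolding graph_cohomology_def mf_cohomology_def quotient_module_def
  by (simp add: set_add_mf coset_add[OF boundaries_subspace] mf_cocycles_eq mf_coboundaries_eq)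

lemma graph_cohomology_smult:
  "c \<odot>\<^bsub>graph_cohomology p D V\<^esub> coset (boundaries p D V) x = coset (boundaries p D V) (mf_scale c x)"
proof -
  have "c \<odot>\<^bsub>graph_cohomology p D V\<^esub> coset (boundaries p D V) x =
      (\<Union>z\<in>coset (boundaries p D V) x. coset (boundaries p D V) (mf_scale c z))"
    unfolding graph_cohomology_def mf_cohomology_def quotient_module_def
    by (simp add: a_r_coset_mf mf_cocycles_eq mf_coboundaries_eq) (simp add: mf_module_def mf_scale_def)
  also have "\<dots> = coset (boundaries p D V) (mf_scale c x)"
    by (rule coset_image[OF boundaries_subspace mf_scale_diff _ boundaries_subspace])
      (rule mf.subspace_scale[OF boundaries_subspace])
  finally show ?thesis .
qed

lemma graph_cohomology_zero: "\<zero>\<^bsub>graph_cohomology p D V\<^esub> = coset (boundaries p D V) 0"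
  unfolding graph_cohomology_def mf_cohomology_def quotient_module_def
  by (simp add: mf_coboundaries_eq coset_def)

text \<open>Makes the laws of \<open>finsum\<close> available, in terms of which the differential of
  \<open>KR_complex\<close> is defined.\<close>

lemma abelian_monoid_graph_cohomology: "abelian_monoid (graph_cohomology p D V)"
proof (rule abelian_monoidI)
  note sub = cycles_subspace[of p D V]
  show "\<zero>\<^bsub>graph_cohomology p D V\<^esub> \<in> carrier (graph_cohomology p D V)"
    unfolding graph_cohomology_carrier graph_cohomology_zero by (intro imageI mf.subspace_0[OF sub])
  fix a b assume "a \<in> carrier (graph_cohomology p D V)" "b \<in> carrier (graph_cohomology p D V)"
  then obtain x y where xy: "x \<in> cycles p D V" "y \<in> cycles p D V"
    "a = coset (boundaries p D V) x" "b = coset (boundaries p D V) y"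
    unfolding graph_cohomology_carrier by blast
  show "a \<oplus>\<^bsub>graph_cohomology p D V\<^esub> b \<in> carrier (graph_cohomology p D V)"
    unfolding xy graph_cohomology_add graph_cohomology_carrier by (intro imageI mf.subspace_add[OF sub] xy)
  show "a \<oplus>\<^bsub>graph_cohomology p D V\<^esub> b = b \<oplus>\<^bsub>graph_cohomology p D V\<^esub> a"
    unfolding xy graph_cohomology_add by (simp only: add.commute)
  fix c assume "c \<in> carrier (graph_cohomology p D V)"
  then obtain z where z: "c = coset (boundaries p D V) z" unfolding graph_cohomology_carrier by blast
  show "a \<oplus>\<^bsub>graph_cohomology p D V\<^esub> b \<oplus>\<^bsub>graph_cohomology p D V\<^esub> c =
      a \<oplus>\<^bsub>graph_cohomology p D V\<^esub> (b \<oplus>\<^bsub>graph_cohomology p D V\<^esub> c)"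
    unfolding xy z graph_cohomology_add by (simp only: add.assoc)
next
  fix a assume "a \<in> carrier (graph_cohomology p D V)"
  then obtain x where x: "a = coset (boundaries p D V) x" unfolding graph_cohomology_carrier by blast
  show "\<zero>\<^bsub>graph_cohomology p D V\<^esub> \<oplus>\<^bsub>graph_cohomology p D V\<^esub> a = a"
    unfolding x graph_cohomology_zero graph_cohomology_add by (simp only: add_0_left)
qed

lemma graph_cohomology_finsum:
  assumes "finite A" "\<And>k. k \<in> A \<Longrightarrow> f k \<in> cycles p D V"
  shows "finsum (graph_cohomology p D V) (\<lambda>k. coset (boundaries p D V) (f k)) A =
    coset (boundaries p D V) (\<Sum>k\<in>A. f k)"
proof -
  interpret abelian_monoid "graph_cohomology p D V" by (rule abelian_monoid_graph_cohomology)
  show ?thesis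
    using assms
  proof (induction A rule: finite_induct)
    case empty
    show ?case by (simp only: finsum_empty sum.empty graph_cohomology_zero)
  next
    case (insert k A)
    have "finsum (graph_cohomology p D V) (\<lambda>k. coset (boundaries p D V) (f k)) (insert k A) =
        coset (boundaries p D V) (f k) \<oplus>\<^bsub>graph_cohomology p D V\<^esub>
          finsum (graph_cohomology p D V) (\<lambda>k. coset (boundaries p D V) (f k)) A"
      using insert.hyps insert.prems by (intro finsum_insert) (auto simp: graph_cohomology_carrier)
    also have "finsum (graph_cohomology p D V) (\<lambda>k. coset (boundaries p D V) (f k)) A =
        coset (boundaries p D V) (\<Sum>k\<in>A. f k)"
      by (rule insert.IH) (use insert.prems in simp)
    finally show ?case unfolding graph_cohomology_add using insert.hyps by (simp only: sum.insert not_False_eq_True)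
  qed
qed

section \<open>The cube of resolutions on representatives\<close>

definition edge_rep :: "complex poly \<Rightarrow> diagram \<Rightarrow> nat set \<Rightarrow> nat \<Rightarrow> mf \<Rightarrow> mf" where
  "edge_rep p D W k x = mf_scale (koszul_sign k W) (crossing_map p D k x)"

lemma Const_uminus: "Const (- c) = - Const c"
  using Const_simps(3)[of c "- c"] by (simp add: Const_simps eq_neg_iff_add_eq_0 add.commute)

lemma Const_koszul_sign: "Const (koszul_sign k W) = koszul_sign k W"
proof -
  have "Const ((-1) ^ m) = (- 1) ^ m" for m
    by (induction m) (simp_all add: Const_simps Const_uminus)
  then show ?thesis by (simp add: koszul_sign_def)
qed

lemma crossing_map_diff: "crossing_map p D k (x - y) = crossing_map p D k x - crossing_map p D k y"
  using crossing_map_add[of p D k "x - y" y] by (simp add: algebra_simps)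

lemma edge_map_coset:
  assumes D: "link_diagram D" and k: "k \<in> incoming D W"
  shows "edge_map p D W k (coset (boundaries p D (flip k W)) x) = coset (boundaries p D W) (edge_rep p D W k x)"
proof -
  have "edge_map p D W k A = (\<Union>z\<in>A. coset (boundaries p D W) (edge_rep p D W k z))" for A
    unfolding edge_map_def Let_def induced_map_def a_r_coset_mf mf_coboundaries_eq
    by (intro SUP_cong refl arg_cong[of _ _ "coset _"] ext)
      (simp add: edge_rep_def mf_scale_def Const_koszul_sign crossing_map_def, simp add: koszul_sign_def)
  also have "(\<Union>z\<in>coset (boundaries p D (flip k W)) x. coset (boundaries p D W) (edge_rep p D W k z)) =
      coset (boundaries p D W) (edge_rep p D W k x)"
  proof (rule coset_image[OF boundaries_subspace _ _ boundaries_subspace])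
    show "edge_rep p D W k (x - y) = edge_rep p D W k x - edge_rep p D W k y" for x y
      unfolding edge_rep_def crossing_map_diff mf_scale_diff ..
    show "edge_rep p D W k x \<in> boundaries p D W" if "x \<in> boundaries p D (flip k W)" for x
      unfolding edge_rep_def
      by (intro mf.subspace_scale[OF boundaries_subspace] crossing_map_boundaries[OF D k that])
  qed
  finally show ?thesis .
qed

lemma resolutions_finite: "V \<in> resolutions D i \<Longrightarrow> finite V" "finite (resolutions D i)"
  by (auto simp: resolutions_def intro: finite_subset[of _ "{..<length (crossings D)}"]
      finite_subset[of _ "Pow {..<length (crossings D)}"])

lemma incoming_finite: "finite (incoming D W)"
  by (rule finite_subset[of _ "{..<length (crossings D)}"]) (auto simp: incoming_def)

lemma flip_eq: "flip k W = (if k \<in> W then W - {k} else insert k W)"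
  by (auto simp: flip_def put_bit_def)

lemma flip_resolution:
  assumes W: "W \<in> resolutions D (i + 1)" and k: "k \<in> incoming D W"
  shows "flip k W \<in> resolutions D i"
proof -
  have fin: "finite W" by (rule resolutions_finite(1)[OF W])
  let ?g = "\<lambda>k. if positive (crossings D ! k) then 1 else -1 :: int"
  have sub: "flip k W \<subseteq> {..<length (crossings D)}"
    using W k by (auto simp: resolutions_def incoming_def flip_eq split: if_splits)
  have "sum ?g W = i + 1" using W by (simp add: resolutions_def cohomological_degree_def)
  then have "sum ?g (flip k W) = i"
    using k fin by (cases "k \<in> W") (auto simp: flip_eq incoming_def sum_diff1 sum.insert)
  then show ?thesis using sub by (simp add: resolutions_def cohomological_degree_def)
qed

lemma flip_flip: "k \<noteq> l \<Longrightarrow> flip l (flip k W) = flip k (flip l W)"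
  by (auto simp: flip_eq)

lemma incoming_flip: "k \<in> incoming D W \<Longrightarrow> incoming D (flip k W) = incoming D W - {k}"
  by (auto simp: incoming_def flip_eq split: if_splits)

lemma koszul_sign_flip: "k < l \<Longrightarrow> koszul_sign k (flip l W) = koszul_sign k W"
  unfolding koszul_sign_def by (intro arg_cong[of _ _ "\<lambda>A. (-1) ^ card A"]) (auto simp: flip_eq)

lemma koszul_sign_flip_less: "k < l \<Longrightarrow> koszul_sign l (flip k W) = - koszul_sign l W"
proof -
  assume "k < l"
  define T where "T = {j \<in> W. j < l} - {k}"
  have T: "finite T" "k \<notin> T" by (auto simp: T_def intro: finite_subset[of _ "{..<l}"])
  have "{j \<in> W. j < l} = (if k \<in> W then insert k T else T)"
    "{j \<in> flip k W. j < l} = (if k \<in> W then T else insert k T)"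
    using \<open>k < l\<close> by (auto simp: T_def flip_eq)
  then show ?thesis using T by (simp add: koszul_sign_def)
qed

text \<open>Flipping a bit changes the sign at another position if and only if that position is the
  larger one. Of two distinct positions exactly one is larger, so exactly one of the two products
  changes its sign.\<close>

lemma koszul_sign_anticommute:
  "k \<noteq> l \<Longrightarrow> koszul_sign k W * koszul_sign l (flip k W) = - (koszul_sign l W * koszul_sign k (flip l W) :: complex)"
  by (cases k l rule: linorder_cases) (simp_all add: koszul_sign_flip koszul_sign_flip_less mult.commute)

lemma edge_rep_cycles:
  "link_diagram D \<Longrightarrow> k \<in> incoming D W \<Longrightarrow> x \<in> cycles p D (flip k W) \<Longrightarrow> edge_rep p D W k x \<in> cycles p D W"
  unfolding edge_rep_def by (intro mf.subspace_scale[OF cycles_subspace] crossing_map_cycles)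

lemma edge_rep_boundaries:
  "link_diagram D \<Longrightarrow> k \<in> incoming D W \<Longrightarrow> x \<in> boundaries p D (flip k W) \<Longrightarrow> edge_rep p D W k x \<in> boundaries p D W"
  unfolding edge_rep_def by (intro mf.subspace_scale[OF boundaries_subspace] crossing_map_boundaries)

lemma edge_rep_add: "edge_rep p D W k (x + y) = edge_rep p D W k x + edge_rep p D W k y"
  unfolding edge_rep_def crossing_map_add by (rule mf.scale_right_distrib)

lemma edge_rep_scale: "edge_rep p D W k (mf_scale c x) = mf_scale c (edge_rep p D W k x)"
  unfolding edge_rep_def crossing_map_scale mf.scale_scale by (simp add: mult.commute)

lemma edge_rep_sum: "edge_rep p D W k (\<Sum>i\<in>A. x i) = (\<Sum>i\<in>A. edge_rep p D W k (x i))"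
  unfolding edge_rep_def crossing_map_sum by (rule mf.scale_sum_right)

text \<open>The differential of \<open>KR_complex\<close> on representatives; the value 0 off the
  resolutions of degree \<open>i + 1\<close> conforms to \<open>cube_cycles\<close>.\<close>

definition cube_differential :: "complex poly \<Rightarrow> diagram \<Rightarrow> int \<Rightarrow> (nat set \<Rightarrow> mf) \<Rightarrow> nat set \<Rightarrow> mf" where
  "cube_differential p D i z W =
     (if W \<in> resolutions D (i + 1) then \<Sum>k\<in>incoming D W. edge_rep p D W k (z (flip k W)) else 0)"

lemma antisymmetric_sum_zero:
  assumes "finite A" "\<And>k l. k \<in> A \<Longrightarrow> l \<in> A \<Longrightarrow> k \<noteq> l \<Longrightarrow> T k l = - T l k"
  shows "(\<Sum>k\<in>A. \<Sum>l\<in>A - {k}. T k l) = (0 :: mf)"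
proof -
  define U where "U = (\<lambda>k l. if k = l then 0 else T k l)"
  have TU: "(\<Sum>k\<in>A. \<Sum>l\<in>A - {k}. T k l) = (\<Sum>k\<in>A. \<Sum>l\<in>A. U k l)"
  proof (rule sum.cong[OF refl])
    fix k assume "k \<in> A"
    have "(\<Sum>l\<in>A. U k l) = U k k + (\<Sum>l\<in>A - {k}. U k l)" by (rule sum.remove[OF assms(1) \<open>k \<in> A\<close>])
    also have "\<dots> = (\<Sum>l\<in>A - {k}. T k l)" by (auto simp: U_def intro!: sum.cong)
    finally show "(\<Sum>l\<in>A - {k}. T k l) = (\<Sum>l\<in>A. U k l)" ..
  qed
  have U: "U k l = - U l k" if "k \<in> A" "l \<in> A" for k l
  proof (cases "k = l")
    case False
    then show ?thesis using assms(2)[OF that False] False by (simp add: U_def)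
  qed (simp add: U_def)
  have "(\<Sum>k\<in>A. \<Sum>l\<in>A. U k l) = (\<Sum>k\<in>A. \<Sum>l\<in>A. - U l k)"
    by (intro sum.cong refl U)
  also have "\<dots> = - (\<Sum>k\<in>A. \<Sum>l\<in>A. U l k)" by (simp only: sum_negf)
  also have "(\<Sum>k\<in>A. \<Sum>l\<in>A. U l k) = (\<Sum>k\<in>A. \<Sum>l\<in>A. U k l)" by (rule sum.swap)
  finally have "(\<Sum>k\<in>A. \<Sum>l\<in>A. U k l) = - (\<Sum>k\<in>A. \<Sum>l\<in>A. U k l)" .
  then have "(\<Sum>k\<in>A. \<Sum>l\<in>A. U k l) + (\<Sum>k\<in>A. \<Sum>l\<in>A. U k l) = 0"
    by (metis add.right_inverse)
  \<comment> \<open>A sum that equals its negative is killed by the scalar 2, which is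
    nonzero.\<close>
  then have "mf_scale 2 (\<Sum>k\<in>A. \<Sum>l\<in>A. U k l) = 0"
    using mf.scale_left_distrib[of 1 1] by simp
  then have "(\<Sum>k\<in>A. \<Sum>l\<in>A. U k l) = 0" by simp
  then show ?thesis using TU by simp
qed

text \<open>This holds for the representatives themselves and not only up to boundaries: the maps at
  different crossings commute exactly and the signs anticommute, so the two ways around each square
  of the cube cancel.\<close>

lemma cube_differential_twice: "cube_differential p D (i + 1) (cube_differential p D i z) = 0"
proof (rule ext)
  fix U
  show "cube_differential p D (i + 1) (cube_differential p D i z) U = 0 U"
  proof (cases "U \<in> resolutions D (i + 1 + 1)")
    case True
    define T where "T = (\<lambda>k l. edge_rep p D U k (edge_rep p D (flip k U) l (z (flip l (flip k U)))))"
    have T: "T k l = mf_scale (koszul_sign k U * koszul_sign l (flip k U))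
        (crossing_map p D k (crossing_map p D l (z (flip l (flip k U)))))" for k l
      unfolding T_def edge_rep_def crossing_map_scale mf.scale_scale ..
    have anti: "T k l = - T l k" if "k \<noteq> l" for k l
      unfolding T koszul_sign_anticommute[OF that] flip_flip[OF that] crossing_map_commute[OF that]
      by (rule mf.scale_minus_left)
    have "cube_differential p D (i + 1) (cube_differential p D i z) U =
        (\<Sum>k\<in>incoming D U. \<Sum>l\<in>incoming D U - {k}. T k l)"
      unfolding cube_differential_def[of p D "i + 1"] if_P[OF True]
    proof (rule sum.cong[OF refl])
      fix k assume k: "k \<in> incoming D U"
      show "edge_rep p D U k (cube_differential p D i z (flip k U)) = (\<Sum>l\<in>incoming D U - {k}. T k l)"
        unfolding cube_differential_def if_P[OF flip_resolution[OF True k]] incoming_flip[OF k]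
          edge_rep_sum T_def ..
    qed
    also have "\<dots> = 0" by (rule antisymmetric_sum_zero[OF incoming_finite anti])
    finally show ?thesis by simp
  qed (simp add: cube_differential_def)
qed

definition cube_scale :: "complex \<Rightarrow> (nat set \<Rightarrow> mf) \<Rightarrow> nat set \<Rightarrow> mf" where
  "cube_scale c z = (\<lambda>V. mf_scale c (z V))"

lemma cube_scale_apply: "cube_scale c z V = mf_scale c (z V)"
  by (simp add: cube_scale_def)

lemma complex_vector_space_cube_scale: "complex_vector_space cube_scale"
  by unfold_locales
    (auto simp: cube_scale_def fun_eq_iff mf_scale_def Const_simps algebra_simps)

interpretation cube: complex_vector_space cube_scale by (rule complex_vector_space_cube_scale)

definition cube_cycles :: "complex poly \<Rightarrow> diagram \<Rightarrow> int \<Rightarrow> (nat set \<Rightarrow> mf) set" where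
  "cube_cycles p D i = {z. (\<forall>V\<in>resolutions D i. z V \<in> cycles p D V) \<and> (\<forall>V. V \<notin> resolutions D i \<longrightarrow> z V = 0)}"

text \<open>Entries off the resolutions of degree \<open>i\<close> are left free; members of
  \<open>cube_cycles\<close>, whose differences are tested, vanish there.\<close>

definition cube_boundaries :: "complex poly \<Rightarrow> diagram \<Rightarrow> int \<Rightarrow> (nat set \<Rightarrow> mf) set" where
  "cube_boundaries p D i = {z. \<forall>V\<in>resolutions D i. z V \<in> boundaries p D V}"

text \<open>Collects the shifts of the crossings and of the thick edges, so that one index
  \<open>j\<close> is valid across the whole cube.\<close>

definition graph_level :: "complex poly \<Rightarrow> diagram \<Rightarrow> nat set \<Rightarrow> int \<Rightarrow> mf set" where
  "graph_level p D V j = mf_filtration (edges D) (graph_factors p D V) (j - quantum_shift p D V - graph_shift V)"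

definition cube_level :: "complex poly \<Rightarrow> diagram \<Rightarrow> int \<Rightarrow> int \<Rightarrow> (nat set \<Rightarrow> mf) set" where
  "cube_level p D i j = {z \<in> cube_cycles p D i. \<forall>V\<in>resolutions D i. z V \<in> graph_level p D V j}"

definition cube_class :: "complex poly \<Rightarrow> diagram \<Rightarrow> int \<Rightarrow> (nat set \<Rightarrow> mf) \<Rightarrow> nat set \<Rightarrow> mf set" where
  "cube_class p D i z = (\<lambda>V\<in>resolutions D i. coset (boundaries p D V) (z V))"

lemma mf_filtration_iff:
  "x \<in> mf_filtration (edges D) (graph_factors p D V) j \<longleftrightarrow> x \<in> mf_space D \<and>
     (\<forall>S. \<forall>m\<in>Poly_Mapping.keys (x S). 2 * int (monomial_degree m) + (\<Sum>k\<in>S. snd (snd (graph_factors p D V ! k))) \<le> j)"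
  by (simp add: mf_filtration_def carrier_mf_module)

lemma keys_Const_mult: "Poly_Mapping.keys (Const c * f) \<subseteq> Poly_Mapping.keys f"
proof
  fix m assume "m \<in> Poly_Mapping.keys (Const c * f)"
  then obtain a b where ab: "m = a + b" "a \<in> Poly_Mapping.keys (Const c)" "b \<in> Poly_Mapping.keys f"
    using keys_mult[of "Const c" f] by blast
  then have "a = 0" by (auto simp: Const_def split: if_splits)
  then show "m \<in> Poly_Mapping.keys f" using ab by simp
qed

lemma graph_level_subspace: "mf.subspace (graph_level p D V j)"
  unfolding graph_level_def
proof (rule mf.subspaceI)
  note sub = mf_space_subspace[of D]
  show "0 \<in> mf_filtration (edges D) (graph_factors p D V) (j - quantum_shift p D V - graph_shift V)"
    unfolding mf_filtration_iff using mf.subspace_0[OF sub] by simp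
  show "x + y \<in> mf_filtration (edges D) (graph_factors p D V) (j - quantum_shift p D V - graph_shift V)"
    if "x \<in> mf_filtration (edges D) (graph_factors p D V) (j - quantum_shift p D V - graph_shift V)"
      "y \<in> mf_filtration (edges D) (graph_factors p D V) (j - quantum_shift p D V - graph_shift V)" for x y
    using that mf.subspace_add[OF sub] unfolding mf_filtration_iff
    by (auto dest!: subsetD[OF keys_add])
  show "mf_scale c x \<in> mf_filtration (edges D) (graph_factors p D V) (j - quantum_shift p D V - graph_shift V)"
    if "x \<in> mf_filtration (edges D) (graph_factors p D V) (j - quantum_shift p D V - graph_shift V)" for c x
    using that mf.subspace_scale[OF sub] unfolding mf_filtration_iff
    by (auto simp: mf_scale_def dest!: subsetD[OF keys_Const_mult])
qed

lemma graph_level_mono: "i \<le> j \<Longrightarrow> x \<in> graph_level p D V i \<Longrightarrow> x \<in> graph_level p D V j"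
  unfolding graph_level_def mf_filtration_iff by fastforce

lemma factor_degree_bound:
  assumes "S \<subseteq> {..<num_factors D}"
  shows "\<bar>\<Sum>k\<in>S. snd (snd (graph_factors p D V ! k))\<bar> \<le> (\<Sum>k<num_factors D. \<bar>snd (snd (graph_factors p D V ! k))\<bar>)"
  by (rule order_trans[OF sum_abs]) (intro sum_mono2 assms finite_lessThan; simp)

text \<open>Monomials have nonnegative degree, so nothing nonzero has a degree below
  \<open>- b\<close>, where \<open>b\<close> is the sum of the absolute values of the shifts of all
  factors. The bound \<open>l\<close> is one less, up to the overall shifts.\<close>

lemma graph_level_bounded: "\<exists>l. \<forall>j\<le>l. graph_level p D V j = {0}"
proof -
  define b where "b = (\<Sum>k<num_factors D. \<bar>snd (snd (graph_factors p D V ! k))\<bar>)"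
  define l where "l = - b - 1 + quantum_shift p D V + graph_shift V"
  have "x = 0" if j: "j \<le> l" and x: "x \<in> graph_level p D V j" for x j
  proof (rule ext)
    fix S
    show "x S = 0 S"
    proof (cases "S \<subseteq> {..<num_factors D}")
      case True
      have "m \<notin> Poly_Mapping.keys (x S)" for m
      proof
        assume "m \<in> Poly_Mapping.keys (x S)"
        then have "2 * int (monomial_degree m) + (\<Sum>k\<in>S. snd (snd (graph_factors p D V ! k))) \<le>
            j - quantum_shift p D V - graph_shift V"
          using x unfolding graph_level_def mf_filtration_iff by blast
        then show False using factor_degree_bound[OF True, of p V] j unfolding b_def[symmetric] l_def by linarith
      qed
      then have "Poly_Mapping.keys (x S) = {}" by blast
      then show ?thesis by simp
    next
      case False
      then show ?thesis using x by (simp add: graph_level_def mf_filtration_iff mf_space_def)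
    qed
  qed
  then have "graph_level p D V j = {0}" if "j \<le> l" for j
    using that mf.subspace_0[OF graph_level_subspace[of p D V j]] by blast
  then show ?thesis by blast
qed

text \<open>An element vanishes outside the finitely many subsets of factors and so involves
  finitely many monomials in total; the sum of all their degrees is an upper bound for each of
  them.\<close>

lemma graph_level_exhaustive:
  assumes x: "x \<in> mf_space D"
  shows "\<exists>j. x \<in> graph_level p D V j"
proof -
  define b where "b = (\<Sum>k<num_factors D. \<bar>snd (snd (graph_factors p D V ! k))\<bar>)"
  define M where "M = (\<Union>S\<in>Pow {..<num_factors D}. Poly_Mapping.keys (x S))"
  have M: "finite M" by (auto simp: M_def)
  define c where "c = 2 * int (\<Sum>m\<in>M. monomial_degree m) + b"
  have "2 * int (monomial_degree m) + (\<Sum>k\<in>S. snd (snd (graph_factors p D V ! k))) \<le> c"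
    if m: "m \<in> Poly_Mapping.keys (x S)" for S m
  proof -
    have S: "S \<subseteq> {..<num_factors D}"
    proof (rule ccontr)
      assume "\<not> S \<subseteq> {..<num_factors D}"
      then have "x S = 0" using x by (simp add: mf_space_def)
      then show False using m by simp
    qed
    then have "m \<in> M" using m by (auto simp: M_def)
    then have "monomial_degree m \<le> (\<Sum>m\<in>M. monomial_degree m)" by (rule member_le_sum) (use M in auto)
    then show ?thesis using factor_degree_bound[OF S, of p V] unfolding b_def[symmetric] c_def by linarith
  qed
  then have "x \<in> graph_level p D V (c + quantum_shift p D V + graph_shift V)"
    using x unfolding graph_level_def mf_filtration_iff by simp
  then show ?thesis by blast
qed

lemma cube_cycles_subspace: "cube.subspace (cube_cycles p D i)"
  by (rule cube.subspaceI)
    (auto simp: cube_cycles_def cube_scale_apply mf.subspace_0 mf.subspace_add mf.subspace_scale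
      cycles_subspace)

lemma cube_boundaries_subspace: "cube.subspace (cube_boundaries p D i)"
  by (rule cube.subspaceI)
    (auto simp: cube_boundaries_def cube_scale_apply mf.subspace_0 mf.subspace_add mf.subspace_scale
      boundaries_subspace)

lemma cube_level_subspace: "cube.subspace (cube_level p D i j)"
  by (rule cube.subspaceI)
    (auto simp: cube_level_def cube.subspace_0 cube.subspace_add cube.subspace_scale cube_cycles_subspace
      cube_scale_apply mf.subspace_0 mf.subspace_add mf.subspace_scale graph_level_subspace)

lemma int_lower_bound:
  fixes f :: "'a \<Rightarrow> int"
  assumes "finite A" shows "\<exists>l. \<forall>a\<in>A. l \<le> f a"
  using assms by (intro exI[of _ "Min (f ` A)"]) simp

lemma int_upper_bound:
  fixes f :: "'a \<Rightarrow> int"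
  assumes "finite A" shows "\<exists>l. \<forall>a\<in>A. f a \<le> l"
  using assms by (intro exI[of _ "Max (f ` A)"]) simp

text \<open>The lower and upper bounds of the single resolutions become uniform because there are
  finitely many of them.\<close>

lemma cube_level_filters: "cube.filters (cube_cycles p D i) (cube_level p D i)"
  unfolding cube.filters_def
proof (intro conjI allI impI ballI)
  fix j
  show "cube.subspace (cube_level p D i j)" by (rule cube_level_subspace)
  show "cube_level p D i j \<subseteq> cube_cycles p D i" by (auto simp: cube_level_def)
next
  fix j k :: int assume "j \<le> k"
  then show "cube_level p D i j \<subseteq> cube_level p D i k"
    unfolding cube_level_def using graph_level_mono by blast
next
  obtain b where b: "\<forall>j\<le>b V. graph_level p D V j = {0}" for V
    using graph_level_bounded[of p D] by metis
  obtain l where l: "\<forall>V\<in>resolutions D i. l \<le> b V" using int_lower_bound[OF resolutions_finite(2)] by blast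
  have "z = 0" if j: "j \<le> l" and z: "z \<in> cube_level p D i j" for z j
  proof (rule ext)
    fix V
    show "z V = 0 V"
    proof (cases "V \<in> resolutions D i")
      case True
      then have "z V \<in> graph_level p D V j" using z by (simp add: cube_level_def)
      moreover have "j \<le> b V" using l True j by force
      ultimately show ?thesis using b[of V] by simp
    next
      case False
      then show ?thesis using z by (simp add: cube_level_def cube_cycles_def)
    qed
  qed
  then have "cube_level p D i j = {0}" if "j \<le> l" for j
    using that cube.subspace_0[OF cube_level_subspace[of p D i j]] by blast
  then show "\<exists>l. \<forall>j\<le>l. cube_level p D i j = {0}" by blast
next
  fix z assume z: "z \<in> cube_cycles p D i"
  have "\<exists>j. V \<in> resolutions D i \<longrightarrow> z V \<in> graph_level p D V j" for V
    using graph_level_exhaustive[of "z V" D p V] z by (auto simp: cube_cycles_def cycles_def)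
  then obtain b where b: "V \<in> resolutions D i \<Longrightarrow> z V \<in> graph_level p D V (b V)" for V by metis
  obtain l where "\<forall>V\<in>resolutions D i. b V \<le> l" using int_upper_bound[OF resolutions_finite(2)] by blast
  then have "z \<in> cube_level p D i l"
    unfolding cube_level_def using z b graph_level_mono by blast
  then show "\<exists>j. z \<in> cube_level p D i j" by blast
qed

text \<open>Picks representatives at all vertices of the cube at once, with a default value off the
  relevant ones.\<close>

lemma PiE_restrict_image:
  assumes "\<And>V. V \<in> I \<Longrightarrow> f V \<in> g V ` A V"
  shows "\<exists>z. (\<forall>V\<in>I. z V \<in> A V \<and> f V = g V (z V)) \<and> (\<forall>V. V \<notin> I \<longrightarrow> z V = d)"
proof -
  have "\<forall>V. \<exists>y. (V \<in> I \<longrightarrow> y \<in> A V \<and> f V = g V y) \<and> (V \<notin> I \<longrightarrow> y = d)"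
    using assms by blast
  from choice[OF this] show ?thesis by blast
qed

lemma KR_carrier: "carrier (cochains (KR_complex p D) i) = cube_class p D i ` cube_cycles p D i"
proof (intro equalityI subsetI)
  fix f assume f: "f \<in> carrier (cochains (KR_complex p D) i)"
  then have "f V \<in> coset (boundaries p D V) ` cycles p D V" if "V \<in> resolutions D i" for V
    using that by (auto simp: KR_complex_def direct_sum_module_def graph_cohomology_carrier PiE_iff)
  then obtain z where z: "\<forall>V\<in>resolutions D i. z V \<in> cycles p D V \<and> f V = coset (boundaries p D V) (z V)"
    "\<forall>V. V \<notin> resolutions D i \<longrightarrow> z V = 0"
    using PiE_restrict_image[of "resolutions D i" f "\<lambda>V. coset (boundaries p D V)" "cycles p D" 0] by blast
  have "f = cube_class p D i z"
    using f z(1) by (auto simp: cube_class_def KR_complex_def direct_sum_module_def PiE_iff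
        intro!: extensionalityI[of _ "resolutions D i"])
  moreover have "z \<in> cube_cycles p D i" using z unfolding cube_cycles_def by blast
  ultimately show "f \<in> cube_class p D i ` cube_cycles p D i" by blast
next
  fix f assume "f \<in> cube_class p D i ` cube_cycles p D i"
  then show "f \<in> carrier (cochains (KR_complex p D) i)"
    by (auto simp: cube_class_def KR_complex_def direct_sum_module_def graph_cohomology_carrier cube_cycles_def)
qed

lemma KR_filtration: "filtration (KR_complex p D) i j = cube_class p D i ` cube_level p D i j"
proof -
  have level: "graph_filtration p D V (j - quantum_shift p D V) =
      coset (boundaries p D V) ` (cycles p D V \<inter> graph_level p D V j)" for V
    unfolding graph_filtration_def mf_cohomology_filtration_def graph_level_def
    by (auto simp: mf_cocycles_eq mf_coboundaries_eq a_r_coset_mf)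
  show ?thesis
  proof (intro equalityI subsetI)
    fix f assume f: "f \<in> filtration (KR_complex p D) i j"
    then have "f V \<in> coset (boundaries p D V) ` (cycles p D V \<inter> graph_level p D V j)"
      if "V \<in> resolutions D i" for V
      using that by (auto simp: KR_complex_def level PiE_iff)
    then obtain z where z: "\<forall>V\<in>resolutions D i. z V \<in> cycles p D V \<inter> graph_level p D V j \<and>
        f V = coset (boundaries p D V) (z V)" "\<forall>V. V \<notin> resolutions D i \<longrightarrow> z V = 0"
      using PiE_restrict_image[of "resolutions D i" f "\<lambda>V. coset (boundaries p D V)"
          "\<lambda>V. cycles p D V \<inter> graph_level p D V j" 0] by blast
    have "f = cube_class p D i z"
      using f z(1) by (auto simp: cube_class_def KR_complex_def PiE_iff
          intro!: extensionalityI[of _ "resolutions D i"])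
    moreover have "z \<in> cube_level p D i j" using z unfolding cube_level_def cube_cycles_def by blast
    ultimately show "f \<in> cube_class p D i ` cube_level p D i j" by blast
  next
    fix f assume "f \<in> cube_class p D i ` cube_level p D i j"
    then show "f \<in> filtration (KR_complex p D) i j"
      by (auto simp: cube_class_def KR_complex_def level cube_level_def cube_cycles_def)
  qed
qed

lemma KR_differential:
  assumes D: "link_diagram D" and z: "z \<in> cube_cycles p D i"
  shows "differential (KR_complex p D) i (cube_class p D i z) =
    cube_class p D (i + 1) (cube_differential p D i z)"
proof -
  have "finsum (graph_cohomology p D W)
        (\<lambda>k. edge_map p D W k (cube_class p D i z (if k \<in> W then W - {k} else insert k W))) (incoming D W) =
      coset (boundaries p D W) (cube_differential p D i z W)" if W: "W \<in> resolutions D (i + 1)" for W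
  proof -
    interpret abelian_monoid "graph_cohomology p D W" by (rule abelian_monoid_graph_cohomology)
    have cyc: "edge_rep p D W k (z (flip k W)) \<in> cycles p D W" if k: "k \<in> incoming D W" for k
      using z flip_resolution[OF W k] by (intro edge_rep_cycles[OF D k]) (simp add: cube_cycles_def)
    have "finsum (graph_cohomology p D W)
        (\<lambda>k. edge_map p D W k (cube_class p D i z (if k \<in> W then W - {k} else insert k W))) (incoming D W) =
      finsum (graph_cohomology p D W) (\<lambda>k. coset (boundaries p D W) (edge_rep p D W k (z (flip k W)))) (incoming D W)"
    proof (rule finsum_cong')
      show "(\<lambda>k. coset (boundaries p D W) (edge_rep p D W k (z (flip k W)))) \<in>
          incoming D W \<rightarrow> carrier (graph_cohomology p D W)"
        using cyc by (auto simp: graph_cohomology_carrier)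
      fix k assume k: "k \<in> incoming D W"
      show "edge_map p D W k (cube_class p D i z (if k \<in> W then W - {k} else insert k W)) =
          coset (boundaries p D W) (edge_rep p D W k (z (flip k W)))"
        using flip_resolution[OF W k] edge_map_coset[OF D k]
        unfolding flip_eq[symmetric] by (simp add: cube_class_def)
    qed simp
    also have "\<dots> = coset (boundaries p D W) (\<Sum>k\<in>incoming D W. edge_rep p D W k (z (flip k W)))"
      by (rule graph_cohomology_finsum[OF incoming_finite cyc])
    finally show ?thesis using W by (simp only: cube_differential_def if_True)
  qed
  then show ?thesis
    unfolding KR_complex_def cube_class_def[of p D "i + 1"] incoming_def[symmetric]
    by (simp cong: restrict_cong)
qed

theorem KR_presented:
  assumes D: "link_diagram D"
  shows "presented_complex cube_scale (KR_complex p D) (cube_cycles p D) (cube_boundaries p D)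
    (cube_differential p D) (cube_level p D) (cube_class p D)"
proof (intro presented_complex.intro complex_vector_space_cube_scale presented_complex_axioms.intro)
  fix i
  show "cube.subspace (cube_cycles p D i)" by (rule cube_cycles_subspace)
  show "cube.subspace (cube_boundaries p D i)" by (rule cube_boundaries_subspace)
  show "carrier (cochains (KR_complex p D) i) = cube_class p D i ` cube_cycles p D i" by (rule KR_carrier)
  show "cube.filters (cube_cycles p D i) (cube_level p D i)" by (rule cube_level_filters)
  show "filtration (KR_complex p D) i j = cube_class p D i ` cube_level p D i j" for j by (rule KR_filtration)
next
  fix x i assume x: "x \<in> cube_cycles p D i"
  show "cube_class p D i (cube_scale c x) = c \<odot>\<^bsub>cochains (KR_complex p D) i\<^esub> cube_class p D i x" for c
    by (auto simp: cube_class_def KR_complex_def direct_sum_module_def graph_cohomology_smult cube_scale_def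
        cong: restrict_cong)
  show "cube_differential p D i x \<in> cube_cycles p D (i + 1)"
    unfolding cube_cycles_def
  proof (intro CollectI conjI ballI allI impI)
    fix W assume W: "W \<in> resolutions D (i + 1)"
    show "cube_differential p D i x W \<in> cycles p D W"
      unfolding cube_differential_def if_P[OF W]
    proof (rule mf.subspace_sum[OF cycles_subspace])
      fix k assume k: "k \<in> incoming D W"
      show "edge_rep p D W k (x (flip k W)) \<in> cycles p D W"
        using x flip_resolution[OF W k] by (intro edge_rep_cycles[OF D k]) (simp add: cube_cycles_def)
    qed
  qed (simp add: cube_differential_def)
  show "cube_differential p D i (cube_scale c x) = cube_scale c (cube_differential p D i x)" for c
    by (rule ext) (simp add: cube_differential_def cube_scale_def edge_rep_scale mf.scale_sum_right mf.scale_zero_right)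
  show "cube_differential p D (i + 1) (cube_differential p D i x) = 0" by (rule cube_differential_twice)
  show "differential (KR_complex p D) i (cube_class p D i x) = cube_class p D (i + 1) (cube_differential p D i x)"
    by (rule KR_differential[OF D x])
  show "cube_differential p D i x \<in> cube_boundaries p D (i + 1)" if "x \<in> cube_boundaries p D i"
    unfolding cube_boundaries_def
  proof (intro CollectI ballI)
    fix W assume W: "W \<in> resolutions D (i + 1)"
    show "cube_differential p D i x W \<in> boundaries p D W"
      unfolding cube_differential_def if_P[OF W]
    proof (rule mf.subspace_sum[OF boundaries_subspace])
      fix k assume k: "k \<in> incoming D W"
      show "edge_rep p D W k (x (flip k W)) \<in> boundaries p D W"
        using that flip_resolution[OF W k] by (intro edge_rep_boundaries[OF D k]) (simp add: cube_boundaries_def)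
    qed
  qed
next
  fix x i y assume x: "x \<in> cube_cycles p D i" and y: "y \<in> cube_cycles p D i"
  show "cube_class p D i (x + y) = cube_class p D i x \<oplus>\<^bsub>cochains (KR_complex p D) i\<^esub> cube_class p D i y"
    by (auto simp: cube_class_def KR_complex_def direct_sum_module_def graph_cohomology_add cong: restrict_cong)
  show "cube_class p D i x = cube_class p D i y \<longleftrightarrow> x - y \<in> cube_boundaries p D i"
  proof -
    have "cube_class p D i x = cube_class p D i y \<longleftrightarrow>
        (\<forall>V\<in>resolutions D i. coset (boundaries p D V) (x V) = coset (boundaries p D V) (y V))"
    proof (intro iffI ballI)
      fix V assume eq: "cube_class p D i x = cube_class p D i y" and V: "V \<in> resolutions D i"
      have "cube_class p D i x V = cube_class p D i y V" by (simp only: eq)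
      then show "coset (boundaries p D V) (x V) = coset (boundaries p D V) (y V)"
        using V by (simp add: cube_class_def)
    qed (simp add: cube_class_def cong: restrict_cong)
    then show ?thesis by (simp add: cube_boundaries_def coset_eq_iff[OF boundaries_subspace])
  qed
  show "cube_differential p D i (x + y) = cube_differential p D i x + cube_differential p D i y"
    by (rule ext) (simp add: cube_differential_def edge_rep_add sum.distrib)
qed

section \<open>Change of the potential by an automorphism\<close>

definition conjugate_mf :: "(complex \<Rightarrow> complex) \<Rightarrow> mf \<Rightarrow> mf" where
  "conjugate_mf \<sigma> x = (\<lambda>S. conjugate \<sigma> (x S))"

definition conjugate_cube :: "(complex \<Rightarrow> complex) \<Rightarrow> (nat set \<Rightarrow> mf) \<Rightarrow> nat set \<Rightarrow> mf" where
  "conjugate_cube \<sigma> z = (\<lambda>V. conjugate_mf \<sigma> (z V))"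

definition conjugate_factor :: "(complex \<Rightarrow> complex) \<Rightarrow> factor \<Rightarrow> factor" where
  "conjugate_factor \<sigma> f = (conjugate \<sigma> (fst f), conjugate \<sigma> (fst (snd f)), snd (snd f))"

context
  fixes \<sigma> assumes \<sigma>: "field_automorphism \<sigma>"
begin

lemmas [simp] = conjugate_simps[OF \<sigma>]

lemma conjugate_mf_add: "conjugate_mf \<sigma> (x + y) = conjugate_mf \<sigma> x + conjugate_mf \<sigma> y"
  by (rule ext) (simp add: conjugate_mf_def)

lemma conjugate_mf_scale: "conjugate_mf \<sigma> (mf_scale c x) = mf_scale (\<sigma> c) (conjugate_mf \<sigma> x)"
  by (rule ext) (simp add: conjugate_mf_def mf_scale_def)

lemma conjugate_mf_zero: "conjugate_mf \<sigma> 0 = 0"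
  by (rule ext) (simp add: conjugate_mf_def)

lemma conjugate_mf_sum: "conjugate_mf \<sigma> (\<Sum>k\<in>A. x k) = (\<Sum>k\<in>A. conjugate_mf \<sigma> (x k))"
  by (induction A rule: infinite_finite_induct)
    (simp_all only: sum.infinite sum.empty sum.insert not_False_eq_True conjugate_mf_zero conjugate_mf_add)

lemma graph_factors_map_poly:
  "graph_factors (map_poly \<sigma> p) D V = map (conjugate_factor \<sigma>) (graph_factors p D V)"
proof -
  have arc: "arc_factor (map_poly \<sigma> p) i j = conjugate_factor \<sigma> (arc_factor p i j)" for i j
    by (simp add: arc_factor_def conjugate_factor_def arc_at_map_poly[OF \<sigma>] degree_map_poly_automorphism[OF \<sigma>])
  have "crossing_factors (map_poly \<sigma> p) t c = map (conjugate_factor \<sigma>) (crossing_factors p t c)" for t c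
    by (simp add: crossing_factors_def arc)
      (simp add: conjugate_factor_def u1_poly_map_poly[OF \<sigma>] u2_poly_map_poly[OF \<sigma>]
        conjugate_at_crossing[OF \<sigma>] degree_map_poly_automorphism[OF \<sigma>])
  then show ?thesis by (simp add: graph_factors_def map_concat arc comp_def)
qed

lemma conjugate_koszul_sign: "conjugate \<sigma> (koszul_sign m S) = koszul_sign m S"
  by (simp add: koszul_sign_def)

lemma conjugate_factor_coeff: "factor_coeff (conjugate_factor \<sigma> f) b = conjugate \<sigma> (factor_coeff f b)"
  by (simp add: factor_coeff_def conjugate_factor_def)

lemma conjugate_mf_differential:
  "conjugate_mf \<sigma> (mf_differential (graph_factors p D V) x) =
     mf_differential (graph_factors (map_poly \<sigma> p) D V) (conjugate_mf \<sigma> x)"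
  by (rule ext) (simp add: conjugate_mf_def mf_differential_eq graph_factors_map_poly conjugate_koszul_sign
      conjugate_factor_coeff)

lemma conjugate_local_op:
  assumes "\<And>\<alpha> \<beta> a b. conjugate \<sigma> (M \<alpha> \<beta> a b) = M' \<alpha> \<beta> a b"
  shows "conjugate_mf \<sigma> (local_op M A x) = local_op M' A (conjugate_mf \<sigma> x)"
  by (rule ext) (simp add: conjugate_mf_def local_op_def assms)

lemma conjugate_crossing_map:
  "conjugate_mf \<sigma> (crossing_map p D k x) = crossing_map (map_poly \<sigma> p) D k (conjugate_mf \<sigma> x)"
proof -
  have "conjugate \<sigma> (chi0_matrix x1 x3 c \<alpha> \<beta> a b) = chi0_matrix (conjugate \<sigma> x1) (conjugate \<sigma> x3) (conjugate \<sigma> c) \<alpha> \<beta> a b"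
    "conjugate \<sigma> (chi1_matrix x1 x3 c \<alpha> \<beta> a b) = chi1_matrix (conjugate \<sigma> x1) (conjugate \<sigma> x3) (conjugate \<sigma> c) \<alpha> \<beta> a b"
    for x1 x3 c \<alpha> \<beta> a b
    by (cases \<alpha>; cases \<beta>; cases a; cases b; simp)+
  then show ?thesis
    unfolding crossing_map_def chi0_eq chi1_eq
    by (simp add: conjugate_local_op conjugate_at_crossing[OF \<sigma>] chi_poly_map_poly[OF \<sigma>])
qed

lemma conjugate_mf_space: "x \<in> mf_space D \<Longrightarrow> conjugate_mf \<sigma> x \<in> mf_space D"
  by (simp add: mf_space_def conjugate_mf_def vars_conjugate[OF \<sigma>])

lemma conjugate_cycles: "x \<in> cycles p D V \<Longrightarrow> conjugate_mf \<sigma> x \<in> cycles (map_poly \<sigma> p) D V"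
  by (simp add: cycles_def conjugate_mf_space conjugate_mf_differential[symmetric] conjugate_mf_zero)

lemma conjugate_boundaries: "x \<in> boundaries p D V \<Longrightarrow> conjugate_mf \<sigma> x \<in> boundaries (map_poly \<sigma> p) D V"
  unfolding boundaries_def using conjugate_mf_space conjugate_mf_differential by auto

lemma conjugate_graph_level:
  assumes "x \<in> graph_level p D V j"
  shows "conjugate_mf \<sigma> x \<in> graph_level (map_poly \<sigma> p) D V j"
proof -
  let ?b = "j - quantum_shift p D V - graph_shift V"
  have x: "x \<in> mf_space D" "2 * int (monomial_degree m) + (\<Sum>k\<in>S. snd (snd (graph_factors p D V ! k))) \<le> ?b"
    if "m \<in> Poly_Mapping.keys (x S)" for m S
    using assms that unfolding graph_level_def mf_filtration_iff by simp_all
  \<comment> \<open>The equality is claimed only where \<open>x S\<close> is nonzero. There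
    \<open>S\<close> consists of valid indices, whereas \<open>map\<close> and \<open>!\<close> need
    not commute beyond the end of a list.\<close>
  have sum: "(\<Sum>k\<in>S. snd (snd (graph_factors (map_poly \<sigma> p) D V ! k))) = (\<Sum>k\<in>S. snd (snd (graph_factors p D V ! k)))"
    if "m \<in> Poly_Mapping.keys (x S)" for m S
  proof -
    have "S \<subseteq> {..<num_factors D}"
    proof (rule ccontr)
      assume "\<not> S \<subseteq> {..<num_factors D}"
      then have "x S = 0" using x(1)[OF that] by (simp add: mf_space_def)
      then show False using that by simp
    qed
    then show ?thesis
      by (intro sum.cong refl) (auto simp: graph_factors_map_poly conjugate_factor_def length_graph_factors)
  qed
  have "quantum_shift (map_poly \<sigma> p) D V = quantum_shift p D V"
    by (simp add: quantum_shift_def degree_map_poly_automorphism[OF \<sigma>])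
  moreover have "conjugate_mf \<sigma> x \<in> mf_space D"
    using assms unfolding graph_level_def mf_filtration_iff by (intro conjugate_mf_space) simp
  ultimately show ?thesis
    unfolding graph_level_def mf_filtration_iff
    using x(2) sum by (simp add: conjugate_mf_def keys_conjugate[OF \<sigma>])
qed

lemma conjugate_edge_rep:
  "conjugate_mf \<sigma> (edge_rep p D W k x) = edge_rep (map_poly \<sigma> p) D W k (conjugate_mf \<sigma> x)"
proof -
  have "\<sigma> (- 1) = - 1" using field_automorphism_minus[OF \<sigma>, of 1] by (simp add: field_automorphism_one[OF \<sigma>])
  then have "\<sigma> ((-1) ^ m) = (-1) ^ m" for m
    by (induction m) (simp_all add: field_automorphism_one[OF \<sigma>] field_automorphism_minus[OF \<sigma>])
  then show ?thesis
    by (simp add: edge_rep_def conjugate_mf_scale conjugate_crossing_map koszul_sign_def)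
qed

lemma conjugate_cube_props:
  "x \<in> cube_cycles p D i \<Longrightarrow> conjugate_cube \<sigma> x \<in> cube_cycles (map_poly \<sigma> p) D i"
  "x \<in> cube_boundaries p D i \<Longrightarrow> conjugate_cube \<sigma> x \<in> cube_boundaries (map_poly \<sigma> p) D i"
  "x \<in> cube_level p D i j \<Longrightarrow> conjugate_cube \<sigma> x \<in> cube_level (map_poly \<sigma> p) D i j"
  "conjugate_cube \<sigma> (x + y) = conjugate_cube \<sigma> x + conjugate_cube \<sigma> y"
  "conjugate_cube \<sigma> (cube_scale c x) = cube_scale (\<sigma> c) (conjugate_cube \<sigma> x)"
  "conjugate_cube \<sigma> (cube_differential p D i x) = cube_differential (map_poly \<sigma> p) D i (conjugate_cube \<sigma> x)"
proof -
  show cyc: "conjugate_cube \<sigma> x \<in> cube_cycles (map_poly \<sigma> p) D i" if "x \<in> cube_cycles p D i" for x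
    using that by (simp add: cube_cycles_def conjugate_cube_def conjugate_cycles conjugate_mf_zero)
  show "x \<in> cube_boundaries p D i \<Longrightarrow> conjugate_cube \<sigma> x \<in> cube_boundaries (map_poly \<sigma> p) D i"
    by (simp add: cube_boundaries_def conjugate_cube_def conjugate_boundaries)
  show "x \<in> cube_level p D i j \<Longrightarrow> conjugate_cube \<sigma> x \<in> cube_level (map_poly \<sigma> p) D i j"
    using cyc[of x] by (simp add: cube_level_def) (simp add: conjugate_cube_def conjugate_graph_level)
  show "conjugate_cube \<sigma> (x + y) = conjugate_cube \<sigma> x + conjugate_cube \<sigma> y"
    by (rule ext) (simp add: conjugate_cube_def conjugate_mf_add)
  show "conjugate_cube \<sigma> (cube_scale c x) = cube_scale (\<sigma> c) (conjugate_cube \<sigma> x)"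
    by (rule ext) (simp add: conjugate_cube_def cube_scale_def conjugate_mf_scale)
  show "conjugate_cube \<sigma> (cube_differential p D i x) = cube_differential (map_poly \<sigma> p) D i (conjugate_cube \<sigma> x)"
    by (rule ext) (simp add: conjugate_cube_def cube_differential_def conjugate_mf_sum conjugate_edge_rep
        conjugate_mf_zero)
qed

end

lemma conjugate_cube_inverse:
  assumes "field_automorphism \<sigma>" "field_automorphism \<tau>" "\<And>c. \<tau> (\<sigma> c) = c"
  shows "conjugate_cube \<tau> (conjugate_cube \<sigma> z) = z"
  by (simp add: conjugate_cube_def conjugate_mf_def conjugate_inverse[OF assms])

lemma map_poly_inverse:
  assumes "field_automorphism \<sigma>" "field_automorphism \<tau>" "\<And>c. \<tau> (\<sigma> c) = c"
  shows "map_poly \<tau> (map_poly \<sigma> p) = p"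
  by (rule poly_eqI) (simp add: coeff_map_poly field_automorphism_zero assms)

theorem KR_complex_isomorphic:
  assumes \<sigma>: "field_automorphism \<sigma>" and D: "link_diagram D"
  shows "filtered_isomorphic (KR_complex p D) (KR_complex (map_poly \<sigma> p) D)"
proof -
  let ?\<tau> = "inv_into UNIV \<sigma>"
  have \<tau>: "field_automorphism ?\<tau>" by (rule field_automorphism_inv[OF \<sigma>])
  have inverse: "?\<tau> (\<sigma> c) = c" "\<sigma> (?\<tau> c) = c" for c
    using field_automorphism_bij[OF \<sigma>] by (auto simp: bij_def surj_f_inv_f)
  note p = map_poly_inverse[OF \<sigma> \<tau> inverse(1), of p]
  \<comment> \<open>The inverse automorphism takes the conjugate potential back to the original one;
    rewriting with this fact gives the maps in the reverse direction their intended
    codomain.\<close>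
  note props = conjugate_cube_props(1,2,3,6)[OF \<tau>, where p = "map_poly \<sigma> p", unfolded p]
  show ?thesis
    by (rule isomorphic_of_semilinear[where s = "conjugate_cube \<sigma>" and s' = "conjugate_cube ?\<tau>",
          OF KR_presented[OF D] KR_presented[OF D] \<sigma>])
      (assumption | rule conjugate_cube_props[OF \<sigma>] props conjugate_cube_props(4,5)[OF \<tau>]
        conjugate_cube_inverse[OF \<sigma> \<tau> inverse(1)] conjugate_cube_inverse[OF \<tau> \<sigma> inverse(2)])+
qed

section \<open>Classes of potentials under automorphisms\<close>

lemma KR_equivalent_map_poly:
  assumes \<sigma>: "field_automorphism \<sigma>"
  shows "KR_equivalent p (map_poly \<sigma> p)"
  unfolding KR_equivalent_def
proof (intro allI impI)
  fix D assume D: "link_diagram D"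
  show "filtered_homotopy_equivalent (KR_complex p D) (KR_complex (map_poly \<sigma> p) D)"
    by (rule homotopy_equivalent_of_isomorphic[OF KR_presented[OF D] KR_presented[OF D] KR_complex_isomorphic[OF \<sigma> D]])
qed

lemma KR_equivalent_transfer:
  assumes "field_automorphism \<sigma>" "KR_equivalent p r"
  shows "KR_equivalent (map_poly \<sigma> p) r"
  unfolding KR_equivalent_def
proof (intro allI impI)
  fix D assume D: "link_diagram D"
  show "filtered_homotopy_equivalent (KR_complex (map_poly \<sigma> p) D) (KR_complex r D)"
    using assms(2) D
    by (intro homotopy_equivalent_transfer[OF KR_presented[OF D] KR_presented[OF D] KR_complex_isomorphic[OF assms(1) D]])
      (simp add: KR_equivalent_def)
qed

text \<open>Transfer along \<open>\<sigma>\<close> and along its inverse gives the two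
  inclusions.\<close>

lemma KR_class_map_poly:
  assumes \<sigma>: "field_automorphism \<sigma>" and p: "p \<in> monic_polys n" "map_poly \<sigma> p \<in> monic_polys n"
  shows "KR_relation n `` {map_poly \<sigma> p} = KR_relation n `` {p}"
proof -
  let ?\<tau> = "inv_into UNIV \<sigma>"
  have \<tau>: "field_automorphism ?\<tau>" by (rule field_automorphism_inv[OF \<sigma>])
  have "?\<tau> (\<sigma> c) = c" for c
    using field_automorphism_bij[OF \<sigma>] by (auto simp: bij_def)
  then have "map_poly ?\<tau> (map_poly \<sigma> p) = p" by (rule map_poly_inverse[OF \<sigma> \<tau>])
  then have "KR_equivalent (map_poly \<sigma> p) r \<longleftrightarrow> KR_equivalent p r" for r
    using KR_equivalent_transfer[OF \<sigma>, of p r] KR_equivalent_transfer[OF \<tau>, of "map_poly \<sigma> p" r] by auto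
  then show ?thesis using p by (auto simp: KR_relation_def)
qed

lemma monic_poly_eq_map_poly:
  assumes \<sigma>: "field_automorphism \<sigma>" and p: "p \<in> monic_polys n" "q \<in> monic_polys n"
    and "\<forall>i<n. \<sigma> (coeff p i) = coeff q i"
  shows "q = map_poly \<sigma> p"
proof (rule poly_eqI)
  fix i
  have n: "coeff p n = 1" "coeff q n = 1" "degree p = n" "degree q = n"
    using p by (auto simp: monic_polys_def)
  have "coeff q i = \<sigma> (coeff p i)"
  proof (cases i n rule: linorder_cases)
    case equal
    then show ?thesis using n by (simp add: field_automorphism_one[OF \<sigma>])
  next
    case greater
    then show ?thesis using n by (simp add: coeff_eq_0 field_automorphism_zero[OF \<sigma>])
  qed (use assms(4) in simp)
  then show "coeff q i = coeff (map_poly \<sigma> p) i"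
    by (simp add: coeff_map_poly field_automorphism_zero[OF \<sigma>])
qed

lemma countable_KR_classes: "countable (monic_polys n // KR_relation n)"
proof -
  obtain c :: "(nat \<Rightarrow> complex) \<Rightarrow> int_expr list option list" where
    c: "\<forall>a b. c a = c b \<longrightarrow> (\<exists>\<sigma>. field_automorphism \<sigma> \<and> (\<forall>i<n. \<sigma> (a i) = b i))"
    using countably_many_automorphism_classes by blast
  define k where "k = (\<lambda>p. c (coeff p))"
  have eq: "KR_relation n `` {p} = KR_relation n `` {q}"
    if pq: "p \<in> monic_polys n" "q \<in> monic_polys n" and "k p = k q" for p q
  proof -
    obtain \<sigma> where \<sigma>: "field_automorphism \<sigma>" "\<forall>i<n. \<sigma> (coeff p i) = coeff q i"
      using c \<open>k p = k q\<close> unfolding k_def by blast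
    have "q = map_poly \<sigma> p" by (rule monic_poly_eq_map_poly[OF \<sigma>(1) pq \<sigma>(2)])
    then show ?thesis using KR_class_map_poly[OF \<sigma>(1) pq(1)] pq(2) by simp
  qed
  \<comment> \<open>Leads from a code back to a class by choosing any potential with that code; for
    codes that occur, the class does not depend on the choice.\<close>
  define h where "h = (\<lambda>x. KR_relation n `` {SOME p. p \<in> monic_polys n \<and> k p = x})"
  have "monic_polys n // KR_relation n \<subseteq> range h"
  proof
    fix K assume "K \<in> monic_polys n // KR_relation n"
    then obtain p where p: "p \<in> monic_polys n" "K = KR_relation n `` {p}" by (auto simp: quotient_def)
    have "\<exists>q. q \<in> monic_polys n \<and> k q = k p" using p(1) by blast
    from someI_ex[OF this] have "h (k p) = K"
      unfolding h_def p(2) by (intro eq p(1)) simp_all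
    then show "K \<in> range h" by blast
  qed
  then show ?thesis by (rule countable_subset) simp
qed

text \<open>Variables from \<open>n\<close> on become 0, in agreement with the padding in
  \<open>cut_off\<close>.\<close>

primrec expr_mpoly :: "nat \<Rightarrow> int_expr \<Rightarrow> mpoly" where
  "expr_mpoly n (Var i) = (if i < n then X i else 0)"
| "expr_mpoly n (Num z) = Const (of_int z)"
| "expr_mpoly n (Diff e e') = expr_mpoly n e - expr_mpoly n e'"
| "expr_mpoly n (Times e e') = expr_mpoly n e * expr_mpoly n e'"

lemma vars_expr_mpoly: "vars (expr_mpoly n e) \<subseteq> {..<n}"
proof (induction e)
  case (Diff e e')
  then show ?case using vars_diff[of "expr_mpoly n e" "expr_mpoly n e'"] unfolding expr_mpoly.simps by blast
next
  case (Times e e')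
  then show ?case using vars_mult_subset by simp
qed (simp_all add: vars_X vars_zero vars_Const)

lemma eval_at_expr_mpoly: "eval_at a (expr_mpoly n e) = expr_value (cut_off n a) e"
  by (induction e) (simp_all add: eval_at_simps cut_off_def)

section \<open>Generic sets in the Zariski topology\<close>

lemma openin_zariski: "openin (zariski n) U \<longleftrightarrow> is_zariski_open n U"
  unfolding zariski_def using istopology_zariski topology_inverse' by metis

lemma topspace_zariski: "topspace (zariski n) = monic_polys n"
proof (rule antisym)
  show "topspace (zariski n) \<subseteq> monic_polys n"
    unfolding topspace_def openin_zariski is_zariski_open_def by auto
  have "is_zariski_open n (monic_polys n)"
    unfolding is_zariski_open_def
    by (intro exI[of _ "{Const 1}"]) (auto simp: zero_locus_def vars_Const eval_at_simps)
  then show "monic_polys n \<subseteq> topspace (zariski n)"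
    by (intro openin_subset) (simp add: openin_zariski)
qed

definition monic_of :: "nat \<Rightarrow> (nat \<Rightarrow> complex) \<Rightarrow> complex poly" where
  "monic_of n a = monom 1 n + (\<Sum>i<n. monom (a i) i)"

lemma coeff_monic_of: "coeff (monic_of n a) i = (if i < n then a i else if i = n then 1 else 0)"
  by (auto simp: monic_of_def coeff_sum)

lemma monic_of_monic: "monic_of n a \<in> monic_polys n"
proof -
  have "degree (monic_of n a) = n"
    by (rule antisym) (auto intro!: degree_le le_degree simp: coeff_monic_of)
  then show ?thesis by (simp add: monic_polys_def coeff_monic_of)
qed

text \<open>On the line through two points at which \<open>f\<close> and \<open>g\<close>, respectively, do not vanish, both have
  finitely many zeros.\<close>

lemma common_nonzero:
  assumes f: "vars f \<subseteq> {..<n}" "eval_at (coeff p) f \<noteq> 0" and g: "vars g \<subseteq> {..<n}" "eval_at (coeff q) g \<noteq> 0"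
  shows "\<exists>r\<in>monic_polys n. eval_at (coeff r) f \<noteq> 0 \<and> eval_at (coeff r) g \<noteq> 0"
proof -
  \<comment> \<open>\<open>L\<close> passes through the coefficients of \<open>p\<close> at
    parameter 0 and of \<open>q\<close> at parameter 1; \<open>P h\<close> is the restriction of
    \<open>h\<close> to this line.\<close>
  define L where "L = (\<lambda>i. [:coeff p i, coeff q i - coeff p i:])"
  define P where "P = (\<lambda>h. mpoly_value (\<lambda>c. [:c:]) L h)"
  have hom: "coeff_hom (\<lambda>c::complex. [:c:])" by (simp add: coeff_hom_def one_pCons)
  have P: "poly (P h) t = eval_at (\<lambda>i. poly (L i) t) h" for h t
    unfolding P_def
    by (induction h rule: mpoly_ring_induct) (simp_all add: mpoly_value_simps[OF hom] eval_at_simps)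
  have "poly (P f) 0 \<noteq> 0" "poly (P g) 1 \<noteq> 0" using f(2) g(2) unfolding P by (simp_all add: L_def)
  then have "P f * P g \<noteq> 0" by auto
  then obtain t where t: "poly (P f * P g) t \<noteq> 0" using poly_all_0_iff_0 by blast
  \<comment> \<open>Both \<open>f\<close> and \<open>g\<close> involve the first \<open>n\<close>
    coefficients only, so passing to a monic polynomial does not change their values.\<close>
  define r where "r = monic_of n (\<lambda>i. poly (L i) t)"
  have r: "eval_at (coeff r) h = eval_at (\<lambda>i. poly (L i) t) h" if "vars h \<subseteq> {..<n}" for h
    using that by (intro mpoly_value_cong_vars) (auto simp: r_def coeff_monic_of)
  have "eval_at (coeff r) f \<noteq> 0" "eval_at (coeff r) g \<noteq> 0"
    using t by (simp_all add: r[OF f(1)] r[OF g(1)] P)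
  moreover have "r \<in> monic_polys n" unfolding r_def by (rule monic_of_monic)
  ultimately show ?thesis by blast
qed

text \<open>Irreducibility of affine space: a nonempty open set contains a nonempty set on which a
  single polynomial does not vanish, and any two of those meet by
  \<open>common_nonzero\<close>.\<close>

lemma zariski_dense:
  assumes U: "openin (zariski n) U" "U \<noteq> {}"
  shows "zariski n closure_of U = topspace (zariski n)"
proof -
  have basic: "\<exists>f. vars f \<subseteq> {..<n} \<and> eval_at (coeff p) f \<noteq> 0 \<and> {r \<in> monic_polys n. eval_at (coeff r) f \<noteq> 0} \<subseteq> T"
    if T: "openin (zariski n) T" "p \<in> T" for T p
  proof -
    obtain A where A: "\<forall>f\<in>A. vars f \<subseteq> {..<n}" "T = monic_polys n - zero_locus n A"
      using T(1) unfolding openin_zariski is_zariski_open_def by (elim exE conjE)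
    then obtain f where f: "f \<in> A" "eval_at (coeff p) f \<noteq> 0"
      using T(2) by (auto simp: zero_locus_def)
    then have "{r \<in> monic_polys n. eval_at (coeff r) f \<noteq> 0} \<subseteq> T"
      unfolding A(2) by (auto simp: zero_locus_def)
    then show ?thesis using f A(1) by blast
  qed
  obtain q where "q \<in> U" using U(2) by blast
  then obtain g where g: "vars g \<subseteq> {..<n}" "eval_at (coeff q) g \<noteq> 0"
      "{r \<in> monic_polys n. eval_at (coeff r) g \<noteq> 0} \<subseteq> U"
    using basic[OF U(1)] by blast
  have "\<exists>y. y \<in> U \<and> y \<in> T" if T: "openin (zariski n) T" "p \<in> T" for T p
  proof -
    obtain f where f: "vars f \<subseteq> {..<n}" "eval_at (coeff p) f \<noteq> 0"
      "{r \<in> monic_polys n. eval_at (coeff r) f \<noteq> 0} \<subseteq> T"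
      using basic[OF T] by blast
    show ?thesis using common_nonzero[OF f(1,2) g(1,2)] f(3) g(3) by blast
  qed
  then have "topspace (zariski n) \<subseteq> zariski n closure_of U"
    unfolding subset_iff in_closure_of by blast
  then show ?thesis using closure_of_subset_topspace by (rule antisym[rotated])
qed

text \<open>Two points of all of these sets satisfy the same integral relations. The case distinction makes it
  unnecessary to know that only the zero polynomial vanishes identically.\<close>

definition generic_set :: "nat \<Rightarrow> nat \<Rightarrow> complex poly set" where
  "generic_set n i = (let f = expr_mpoly n (from_nat i); U = monic_polys n - zero_locus n {f} in
     if U = {} then monic_polys n else U)"

lemma generic_set_open: "openin (zariski n) (generic_set n i)"
proof -
  have "openin (zariski n) (monic_polys n - zero_locus n {expr_mpoly n e})" for e
    unfolding openin_zariski is_zariski_open_def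
    by (intro exI[of _ "{expr_mpoly n e}"]) (simp add: vars_expr_mpoly)
  then show ?thesis
    using openin_topspace[of "zariski n"] by (simp add: generic_set_def Let_def topspace_zariski)
qed

lemma generic_set_subset: "generic_set n i \<subseteq> monic_polys n"
  by (auto simp: generic_set_def Let_def)

lemma generic_set_nonempty: "generic_set n i \<noteq> {}"
  using monic_of_monic[of n] by (auto simp: generic_set_def Let_def)

lemma generic_sets_equivalent:
  assumes p: "p \<in> (\<Inter>i. generic_set n i)" and q: "q \<in> (\<Inter>i. generic_set n i)"
  shows "\<exists>\<sigma>. field_automorphism \<sigma> \<and> (\<forall>i<n. \<sigma> (coeff p i) = coeff q i)"
proof (rule generic_automorphism)
  fix e :: int_expr
  have monic: "r \<in> monic_polys n" if "r \<in> (\<Inter>i. generic_set n i)" for r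
    using that generic_set_subset[of n 0] by blast
  let ?U = "monic_polys n - zero_locus n {expr_mpoly n e}"
  have gen: "generic_set n (to_nat e) = (if ?U = {} then monic_polys n else ?U)"
    by (simp add: generic_set_def Let_def)
  \<comment> \<open>A member of all the generic sets lies in \<open>?U\<close> as soon as
    \<open>?U\<close> is nonempty, so that membership is the same for \<open>p\<close> and
    \<open>q\<close>.\<close>
  have *: "r \<in> ?U \<longleftrightarrow> ?U \<noteq> {}" if "r \<in> (\<Inter>i. generic_set n i)" for r
    using that gen by (auto split: if_splits)
  have **: "r \<in> ?U \<longleftrightarrow> expr_value (cut_off n (coeff r)) e \<noteq> 0" if "r \<in> (\<Inter>i. generic_set n i)" for r
    using monic[OF that] by (simp add: zero_locus_def eval_at_expr_mpoly)
  show "expr_value (cut_off n (coeff p)) e = 0 \<longleftrightarrow> expr_value (cut_off n (coeff q)) e = 0"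
    using *[OF p] *[OF q] **[OF p] **[OF q] by blast
qed

theorem corollary3p8:
  fixes n :: nat
  assumes "n \<ge> 1"
  shows "countable (monic_polys n // KR_relation n) \<and>
    (\<exists>K \<in> monic_polys n // KR_relation n. \<exists>U :: nat \<Rightarrow> complex poly set.
       (\<forall>i. openin (zariski n) (U i) \<and> U i \<noteq> {} \<and>
            zariski n closure_of U i = topspace (zariski n)) \<and>
       (\<Inter>i. U i) \<subseteq> K)"
proof (intro conjI countable_KR_classes)
  \<comment> \<open>A point of the intersection if there is one. The default, the polynomial with
    all lower coefficients 0, still provides a class when the intersection is empty; the inclusion
    is then trivial.\<close>
  define p where "p = (if (\<Inter>i. generic_set n i) = {} then monic_of n (\<lambda>_. 0) else SOME p. p \<in> (\<Inter>i. generic_set n i))"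
  have monic: "r \<in> monic_polys n" if "r \<in> (\<Inter>i. generic_set n i)" for r
    using that generic_set_subset[of n 0] by blast
  have p_gen: "p \<in> (\<Inter>i. generic_set n i)" if "(\<Inter>i. generic_set n i) \<noteq> {}"
    unfolding p_def if_not_P[OF that] by (rule someI_ex) (use that in blast)
  have p: "p \<in> monic_polys n"
    using monic[OF p_gen] monic_of_monic by (cases "(\<Inter>i. generic_set n i) = {}") (auto simp: p_def)
  have "(\<Inter>i. generic_set n i) \<subseteq> KR_relation n `` {p}"
  proof
    fix q assume q: "q \<in> (\<Inter>i. generic_set n i)"
    then have "p \<in> (\<Inter>i. generic_set n i)" by (intro p_gen) blast
    from generic_sets_equivalent[OF this q]
    obtain \<sigma> where \<sigma>: "field_automorphism \<sigma>" "\<forall>i<n. \<sigma> (coeff p i) = coeff q i"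
      by (elim exE conjE)
    have "q = map_poly \<sigma> p" by (rule monic_poly_eq_map_poly[OF \<sigma>(1) p monic[OF q] \<sigma>(2)])
    then have "KR_equivalent p q" using KR_equivalent_map_poly[OF \<sigma>(1)] by simp
    then show "q \<in> KR_relation n `` {p}" using p monic[OF q] by (simp add: KR_relation_def)
  qed
  moreover have "KR_relation n `` {p} \<in> monic_polys n // KR_relation n" using p by (rule quotientI)
  ultimately show "\<exists>K \<in> monic_polys n // KR_relation n. \<exists>U :: nat \<Rightarrow> complex poly set.
       (\<forall>i. openin (zariski n) (U i) \<and> U i \<noteq> {} \<and>
            zariski n closure_of U i = topspace (zariski n)) \<and>
       (\<Inter>i. U i) \<subseteq> K"
    using generic_set_open generic_set_nonempty zariski_dense[OF generic_set_open generic_set_nonempty]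
    by (intro bexI[of _ "KR_relation n `` {p}"] exI[of _ "generic_set n"]) simp_all
qed

end
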